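(* Let $n\ge 2$ and let $U_S$, $W$, $B$, $x_{ij}$, $\omega_k$ be as defined in the context. Then: (a) $U_S\cong W\otimes B$ as associative algebras, and $Z(U_S)\cong Z(W)$. (b) All the ordered monomials in the elements $x_{ij}$ ($1\le i\ne j\le n$) and $\omega_k$ ($1\le k\le n$) form a basis of $W$ over $\mathbb{C}$.
   Context: All algebras are over $\mathbb{C}$, $\otimes=\otimes_{\mathbb C}$, and $Z(A)$ is the center of an algebra $A$. Fix $n\ge 2$. Let $e_{ij}$, $0\le i,j\le n$, be the matrix units of $\mathfrak{gl}_{n+1}$, $I_{n+1}=\sum_{i=0}^n e_{ii}$, and $h_i=e_{ii}-\frac1{n+1}I_{n+1}\in\mathfrak{sl}_{n+1}$ for $0\le i\le n$. Let $\mathfrak h_n$ be the Cartan subalgebra of diagonal matrices of $\mathfrak{sl}_{n+1}$ (with basis $h_1,\dots,h_n$) and $\mathfrak m_n=\bigoplus_{i=1}^n\mathbb{C}e_{0i}$. Let $U=U(\mathfrak{sl}_{n+1})$ and let $U_S$ be the localization of $U$ with respect to the Ore subset $S=\{e_{01}^{i_1}\cdots e_{0n}^{i_n}\mid i_1,\dots,i_n\in\mathbb{Z}_{\ge0}\}$. Define the subalgebra $W=\{u\in U_S\mid [\mathfrak h_n,u]=[\mathfrak m_n,u]=0\}$ of $U_S$, and let $B$ be the subalgebra of $U_S$ generated by $h_i,e_{0k},e_{0k}^{-1}$, $1\le i,k\le n$. For $i,j,k\in\{1,\dots,n\}$, $i\ne j$, put $$x_{ij}=e_{ij}e_{0i}e_{0j}^{-1}-h_i,\qquad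 \omega_k=e_{k0}e_{0k}+\sum_{j=1}^n\Big(e_{kj}-\frac{\delta_{jk}}{n+1}I_{n+1}\Big)(h_j-1)e_{0k}e_{0j}^{-1}$$ (for $j=k$ the factor $e_{kk}-\frac1{n+1}I_{n+1}$ is $h_k$); these elements lie in $W$. "Ordered monomials" are taken with respect to a fixed total order on the finite set of generators $x_{ij},\omega_k$, with non-negative integer exponents. *)

theory Defs
  imports
    "HOL-Analysis.Determinants"
    "HOL-Library.Poly_Mapping"
    "HOL-Algebra.Module"
    "HOL-Algebra.QuotRing"
begin

class complex_vector = ab_group_add +
  fixes scaleC :: "complex \<Rightarrow> 'a \<Rightarrow> 'a"  (infixr "*\<^sub>C" 75)
  assumes scaleC_add_right: "c *\<^sub>C (x + y) = c *\<^sub>C x + c *\<^sub>C y"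
    and scaleC_add_left: "(c + d) *\<^sub>C x = c *\<^sub>C x + d *\<^sub>C x"
    and scaleC_scaleC: "c *\<^sub>C d *\<^sub>C x = (c * d) *\<^sub>C x"
    and scaleC_one: "1 *\<^sub>C x = x"

interpretation complex_vector: vector_space "scaleC :: complex \<Rightarrow> 'a \<Rightarrow> 'a::complex_vector"
  by unfold_locales (simp_all add: scaleC_add_right scaleC_add_left scaleC_scaleC scaleC_one)

class complex_algebra_1 = complex_vector + ring_1 +
  assumes mult_scaleC_left: "(c *\<^sub>C x) * y = c *\<^sub>C (x * y)"
    and mult_scaleC_right: "x * (c *\<^sub>C y) = c *\<^sub>C (x * y)"

class complex_lie_algebra = complex_vector +
  fixes lie_bracket :: "'a \<Rightarrow> 'a \<Rightarrow> 'a"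
  assumes lie_bracket_add_left: "lie_bracket (x + y) z = lie_bracket x z + lie_bracket y z"
    and lie_bracket_add_right: "lie_bracket x (y + z) = lie_bracket x y + lie_bracket x z"
    and lie_bracket_scaleC_left: "lie_bracket (c *\<^sub>C x) y = c *\<^sub>C lie_bracket x y"
    and lie_bracket_scaleC_right: "lie_bracket x (c *\<^sub>C y) = c *\<^sub>C lie_bracket x y"
    and lie_bracket_self: "lie_bracket x x = 0"
    and jacobi: "lie_bracket x (lie_bracket y z) + lie_bracket y (lie_bracket z x)
                   + lie_bracket z (lie_bracket x y) = 0"

definition algebra_hom :: "('a::complex_algebra_1 \<Rightarrow> 'b::complex_algebra_1) \<Rightarrow> bool" where
  "algebra_hom f \<longleftrightarrow>
     (\<forall>x y. f (x + y) = f x + f y) \<and> (\<forall>x y. f (x * y) = f x * f y) \<and>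
     (\<forall>c x. f (c *\<^sub>C x) = c *\<^sub>C f x) \<and> f 1 = 1"

definition subalgebra :: "'a::complex_algebra_1 set \<Rightarrow> bool" where
  "subalgebra A \<longleftrightarrow> complex_vector.subspace A \<and> 1 \<in> A \<and> (\<forall>x\<in>A. \<forall>y\<in>A. x * y \<in> A)"

definition center :: "'a::complex_algebra_1 set \<Rightarrow> 'a set" where
  "center A = {z \<in> A. \<forall>a\<in>A. z * a = a * z}"

definition invertible_elt :: "'a::ring_1 \<Rightarrow> bool" where
  "invertible_elt x \<longleftrightarrow> (\<exists>y. x * y = 1 \<and> y * x = 1)"

definition inv_elt :: "'a::ring_1 \<Rightarrow> 'a" where
  "inv_elt x = (THE y. x * y = 1 \<and> y * x = 1)"

definition family_basis :: "('i \<Rightarrow> 'a::complex_vector) \<Rightarrow> 'i set \<Rightarrow> 'a set \<Rightarrow> bool" where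
  "family_basis f I V \<longleftrightarrow>
     inj_on f I \<and> complex_vector.independent (f ` I) \<and> complex_vector.span (f ` I) = V"

definition alg_on :: "'a::complex_algebra_1 set \<Rightarrow> (complex, 'a) module" where
  "alg_on A = \<lparr>carrier = A, mult = (*), one = 1, zero = 0, add = (+), smult = scaleC\<rparr>"

definition alg_isomorphic :: "(complex, 'a) module \<Rightarrow> (complex, 'b) module \<Rightarrow> bool" where
  "alg_isomorphic A B \<longleftrightarrow>
     (\<exists>f \<in> ring_iso A B. \<forall>c. \<forall>x\<in>carrier A. f (c \<odot>\<^bsub>A\<^esub> x) = c \<odot>\<^bsub>B\<^esub> f x)"

text \<open>The tensor product is the free vector space on \<open>carrier A \<times> carrier B\<close> modulo the bilinearity
  relations. The product of the free space is the bilinear extension of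
  \<open>(a, b) (a', b') = (a a', b b')\<close>.\<close>

definition pure_tensor :: "'a \<Rightarrow> 'b \<Rightarrow> ('a \<times> 'b) \<Rightarrow>\<^sub>0 complex" where
  "pure_tensor a b = Poly_Mapping.single (a, b) 1"

definition free_scale :: "complex \<Rightarrow> ('i \<Rightarrow>\<^sub>0 complex) \<Rightarrow> ('i \<Rightarrow>\<^sub>0 complex)" where
  "free_scale c p = Poly_Mapping.map ((*) c) p"

definition free_mult ::
  "(complex, 'a) module \<Rightarrow> (complex, 'b) module
     \<Rightarrow> (('a \<times> 'b) \<Rightarrow>\<^sub>0 complex) \<Rightarrow> (('a \<times> 'b) \<Rightarrow>\<^sub>0 complex) \<Rightarrow> (('a \<times> 'b) \<Rightarrow>\<^sub>0 complex)" where
  "free_mult A B p q =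
     (\<Sum>(a, b)\<in>Poly_Mapping.keys p. \<Sum>(a', b')\<in>Poly_Mapping.keys q.
        free_scale (Poly_Mapping.lookup p (a, b) * Poly_Mapping.lookup q (a', b'))
          (pure_tensor (a \<otimes>\<^bsub>A\<^esub> a') (b \<otimes>\<^bsub>B\<^esub> b')))"

definition free_product ::
  "(complex, 'a) module \<Rightarrow> (complex, 'b) module \<Rightarrow> (('a \<times> 'b) \<Rightarrow>\<^sub>0 complex) ring" where
  "free_product A B =
     \<lparr>carrier = {p. Poly_Mapping.keys p \<subseteq> carrier A \<times> carrier B},
      mult = free_mult A B, one = pure_tensor \<one>\<^bsub>A\<^esub> \<one>\<^bsub>B\<^esub>, zero = 0, add = (+)\<rparr>"

inductive_set bilinear_rel ::
  "(complex, 'a) module \<Rightarrow> (complex, 'b) module \<Rightarrow> (('a \<times> 'b) \<Rightarrow>\<^sub>0 complex) set"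
  for A :: "(complex, 'a) module" and B :: "(complex, 'b) module" where
  zero: "0 \<in> bilinear_rel A B"
| add: "p \<in> bilinear_rel A B \<Longrightarrow> q \<in> bilinear_rel A B \<Longrightarrow> p + q \<in> bilinear_rel A B"
| scale: "p \<in> bilinear_rel A B \<Longrightarrow> free_scale c p \<in> bilinear_rel A B"
| add_left: "a \<in> carrier A \<Longrightarrow> a' \<in> carrier A \<Longrightarrow> b \<in> carrier B \<Longrightarrow>
    pure_tensor (a \<oplus>\<^bsub>A\<^esub> a') b - pure_tensor a b - pure_tensor a' b \<in> bilinear_rel A B"
| add_right: "a \<in> carrier A \<Longrightarrow> b \<in> carrier B \<Longrightarrow> b' \<in> carrier B \<Longrightarrow>
    pure_tensor a (b \<oplus>\<^bsub>B\<^esub> b') - pure_tensor a b - pure_tensor a b' \<in> bilinear_rel A B"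
| smult_left: "a \<in> carrier A \<Longrightarrow> b \<in> carrier B \<Longrightarrow>
    pure_tensor (c \<odot>\<^bsub>A\<^esub> a) b - free_scale c (pure_tensor a b) \<in> bilinear_rel A B"
| smult_right: "a \<in> carrier A \<Longrightarrow> b \<in> carrier B \<Longrightarrow>
    pure_tensor a (c \<odot>\<^bsub>B\<^esub> b) - free_scale c (pure_tensor a b) \<in> bilinear_rel A B"

definition tensor_alg ::
  "(complex, 'a) module \<Rightarrow> (complex, 'b) module
     \<Rightarrow> (complex, (('a \<times> 'b) \<Rightarrow>\<^sub>0 complex) set) module" where
  "tensor_alg A B =
     (let F = free_product A B; N = bilinear_rel A B; T = F Quot N in
      \<lparr>carrier = carrier T, mult = mult T, one = one T, zero = zero T, add = add T,
       smult = (\<lambda>c X. \<Union>p\<in>X. N +>\<^bsub>F\<^esub> free_scale c p)\<rparr>)"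

datatype 'g word = Word (letters: "'g list")

instantiation word :: (type) monoid_add
begin

definition "0 = Word []"

definition "u + v = Word (letters u @ letters v)"

instance
  by standard (simp_all add: zero_word_def plus_word_def)

end

lemma word_add_eq_0_iff: "u + v = 0 \<longleftrightarrow> u = 0 \<and> v = (0 :: 'g word)"
  by (cases u; cases v) (auto simp: zero_word_def plus_word_def)

text \<open>Since words form the free monoid, \<open>'g word \<Rightarrow>\<^sub>0 complex\<close> with the convolution product is the free
  algebra on the set \<open>'g\<close>. Imposing linearity of the generators turns it into the tensor algebra of
  the vector space \<open>'g\<close>.\<close>

type_synonym 'g free_alg = "'g word \<Rightarrow>\<^sub>0 complex"

definition letter :: "'g \<Rightarrow> 'g free_alg" where
  "letter x = Poly_Mapping.single (Word [x]) 1"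

definition free_const :: "complex \<Rightarrow> 'g free_alg" where
  "free_const c = Poly_Mapping.single 0 c"

lemma free_const_commute: "p * free_const c = free_const c * (p :: 'g free_alg)"
proof (induction p rule: update_induct)
  case const
  then show ?case by simp
next
  case (update p w d)
  have "Poly_Mapping.update w d p = p + Poly_Mapping.single w d"
    using update by (intro poly_mapping_eqI)
      (auto simp: lookup_update lookup_add lookup_single when_def in_keys_iff)
  with update show ?case
    by (simp add: distrib_left distrib_right free_const_def mult_single mult.commute)
qed

lemma mult_free_const_left: "p * (free_const c * q) = free_const c * (p * q :: 'g free_alg)"
proof -
  have "p * (free_const c * q) = (p * free_const c) * q"
    by (rule mult.assoc[symmetric])
  also have "\<dots> = (free_const c * p) * q"
    by (rule arg_cong[where f = "\<lambda>r. r * q", OF free_const_commute])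
  also have "\<dots> = free_const c * (p * q)"
    by (rule mult.assoc)
  finally show ?thesis .
qed

lemma free_const_mult: "free_const c * free_const d = (free_const (c * d) :: 'g free_alg)"
  by (simp add: free_const_def mult_single)

inductive_set uea_relators :: "'g::complex_lie_algebra free_alg set" where
  add: "letter (x + y) - (letter x + letter y) \<in> uea_relators"
| scale: "letter (c *\<^sub>C x) - free_const c * letter x \<in> uea_relators"
| bracket: "letter x * letter y - letter y * letter x - letter (lie_bracket x y) \<in> uea_relators"

inductive_set uea_ideal :: "'g::complex_lie_algebra free_alg set" where
  zero: "0 \<in> uea_ideal"
| add: "p \<in> uea_ideal \<Longrightarrow> q \<in> uea_ideal \<Longrightarrow> p + q \<in> uea_ideal"
| relator: "r \<in> uea_relators \<Longrightarrow> a * r * b \<in> uea_ideal"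

lemma uea_ideal_mult_left: "p \<in> uea_ideal \<Longrightarrow> a * p \<in> uea_ideal"
proof (induction rule: uea_ideal.induct)
  case (relator r b c)
  then show ?case
    using uea_ideal.relator[of r "a * b" c] by (simp add: mult.assoc)
qed (auto simp: distrib_left intro: uea_ideal.intros)

lemma uea_ideal_mult_right: "p \<in> uea_ideal \<Longrightarrow> p * a \<in> uea_ideal"
proof (induction rule: uea_ideal.induct)
  case (relator r b c)
  then show ?case
    using uea_ideal.relator[of r b "c * a"] by (simp add: mult.assoc)
qed (auto simp: distrib_right intro: uea_ideal.intros)

lemma uea_ideal_eqI: "p = q \<Longrightarrow> p - q \<in> uea_ideal"
  by (simp add: uea_ideal.zero)

lemma uea_ideal_uminus: "p \<in> uea_ideal \<Longrightarrow> - p \<in> uea_ideal"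
  using uea_ideal_mult_left[of p "- 1"] by simp

lemma uea_ideal_diff: "p \<in> uea_ideal \<Longrightarrow> q \<in> uea_ideal \<Longrightarrow> p - q \<in> uea_ideal"
  using uea_ideal.add[of p "- q"] uea_ideal_uminus[of q] by simp

lemma lookup_mult_0:
  "Poly_Mapping.lookup (p * q) 0 = Poly_Mapping.lookup p 0 * Poly_Mapping.lookup q (0 :: 'g word)"
proof -
  have *: "(\<Sum>v. Poly_Mapping.lookup q v when u + v = 0) = (Poly_Mapping.lookup q 0 when u = 0)"
    for u :: "'g word"
    by (simp add: word_add_eq_0_iff when_def cong: conj_cong)
  show ?thesis
    by (simp add: lookup_mult * mult_when)
qed

lemma lookup_letter_0: "Poly_Mapping.lookup (letter x) 0 = 0"
  by (simp add: letter_def lookup_single when_def zero_word_def)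

lemma uea_relators_lookup_0: "r \<in> uea_relators \<Longrightarrow> Poly_Mapping.lookup r 0 = 0"
  by (induction rule: uea_relators.induct)
     (simp_all add: lookup_minus lookup_add lookup_mult_0 lookup_letter_0)

lemma uea_ideal_lookup_0: "p \<in> uea_ideal \<Longrightarrow> Poly_Mapping.lookup p 0 = 0"
  by (induction rule: uea_ideal.induct)
     (simp_all add: lookup_add lookup_mult_0 uea_relators_lookup_0)

quotient_type (overloaded) 'g uea = "'g::complex_lie_algebra free_alg" / "\<lambda>p q. p - q \<in> uea_ideal"
proof (rule equivpI)
  show "reflp (\<lambda>p q. p - q \<in> uea_ideal)"
    by (auto simp: reflp_def intro: uea_ideal.zero)
  show "symp (\<lambda>p q. p - q \<in> uea_ideal)"
    using uea_ideal_uminus by (fastforce simp: symp_def)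
  show "transp (\<lambda>p q. p - q \<in> uea_ideal)"
    using uea_ideal.add by (fastforce simp: transp_def)
qed

instantiation uea :: (complex_lie_algebra) complex_algebra_1
begin

lift_definition zero_uea :: "'a uea" is 0 .

lift_definition one_uea :: "'a uea" is 1 .

lift_definition plus_uea :: "'a uea \<Rightarrow> 'a uea \<Rightarrow> 'a uea" is "(+)"
  by (metis add_diff_add uea_ideal.add)

lift_definition uminus_uea :: "'a uea \<Rightarrow> 'a uea" is uminus
  by (metis minus_diff_minus uea_ideal_uminus)

lift_definition minus_uea :: "'a uea \<Rightarrow> 'a uea \<Rightarrow> 'a uea" is "(-)"
proof -
  fix p p' q q' :: "'a free_alg"
  assume "p - p' \<in> uea_ideal" "q - q' \<in> uea_ideal"
  then have "(p - p') - (q - q') \<in> uea_ideal"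
    by (rule uea_ideal_diff)
  then show "(p - q) - (p' - q') \<in> uea_ideal"
    by (simp add: algebra_simps)
qed

lift_definition times_uea :: "'a uea \<Rightarrow> 'a uea \<Rightarrow> 'a uea" is "(*)"
proof -
  fix p p' q q' :: "'a free_alg"
  assume "p - p' \<in> uea_ideal" "q - q' \<in> uea_ideal"
  then have "(p - p') * q + p' * (q - q') \<in> uea_ideal"
    by (intro uea_ideal.add uea_ideal_mult_left uea_ideal_mult_right)
  then show "p * q - p' * q' \<in> uea_ideal"
    by (simp add: algebra_simps)
qed

lift_definition scaleC_uea :: "complex \<Rightarrow> 'a uea \<Rightarrow> 'a uea" is "\<lambda>c p. free_const c * p"
  by (metis right_diff_distrib uea_ideal_mult_left)

instance
proof
  fix x y z :: "'a uea" and c d :: complex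
  show "x + y + z = x + (y + z)"
    by transfer (simp add: uea_ideal.zero algebra_simps)
  show "x + y = y + x"
    by transfer (simp add: uea_ideal.zero algebra_simps)
  show "0 + x = x"
    by transfer (simp add: uea_ideal.zero)
  show "- x + x = 0"
    by transfer (simp add: uea_ideal.zero)
  show "x - y = x + - y"
    by transfer (simp add: uea_ideal.zero)
  show "x * y * z = x * (y * z)"
    by transfer (simp add: uea_ideal.zero mult.assoc)
  show "1 * x = x" "x * 1 = x"
    by (transfer, simp add: uea_ideal.zero)+
  show "(x + y) * z = x * z + y * z" "x * (y + z) = x * y + x * z"
    by (transfer, simp add: uea_ideal.zero algebra_simps)+
  show "(0 :: 'a uea) \<noteq> 1"
    by transfer (auto dest: uea_ideal_lookup_0 simp: lookup_one)
  show "c *\<^sub>C (x + y) = c *\<^sub>C x + c *\<^sub>C y"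
    by transfer (simp add: uea_ideal.zero distrib_left)
  show "(c + d) *\<^sub>C x = c *\<^sub>C x + d *\<^sub>C x"
    by transfer (simp add: uea_ideal.zero free_const_def single_add distrib_right)
  show "c *\<^sub>C d *\<^sub>C x = (c * d) *\<^sub>C x"
    by transfer (rule uea_ideal_eqI, simp only: free_const_mult mult.assoc[symmetric])
  show "1 *\<^sub>C x = x"
    by transfer (simp add: uea_ideal.zero free_const_def)
  show "(c *\<^sub>C x) * y = c *\<^sub>C (x * y)"
    by transfer (simp add: uea_ideal.zero mult.assoc)
  show "x * (c *\<^sub>C y) = c *\<^sub>C (x * y)"
    by transfer (rule uea_ideal_eqI, rule mult_free_const_left)
qed

end

lift_definition uea_of :: "'g::complex_lie_algebra \<Rightarrow> 'g uea" is letter .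

lemma uea_of_add: "uea_of (x + y) = uea_of x + uea_of y"
  by transfer (use uea_ideal.relator[OF uea_relators.add, of 1 _ _ 1] in simp)

lemma uea_of_scaleC: "uea_of (c *\<^sub>C x) = c *\<^sub>C uea_of x"
  by transfer (use uea_ideal.relator[OF uea_relators.scale, of 1 _ _ 1] in simp)

lemma uea_of_bracket: "uea_of (lie_bracket x y) = uea_of x * uea_of y - uea_of y * uea_of x"
proof transfer
  fix x y :: "'g::complex_lie_algebra"
  have "letter x * letter y - letter y * letter x - letter (lie_bracket x y) \<in> uea_ideal"
    using uea_ideal.relator[OF uea_relators.bracket, of 1 x y 1] by simp
  from uea_ideal_uminus[OF this]
  show "letter (lie_bracket x y) - (letter x * letter y - letter y * letter x) \<in> uea_ideal"
    by simp
qed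

typedef 'k sl = "{A :: complex ^ 'k ^ 'k::finite. trace A = 0}"
  morphisms sl_matrix Abs_sl
  by (rule exI[of _ 0]) (simp add: trace_def)

setup_lifting type_definition_sl

instantiation sl :: (finite) complex_lie_algebra
begin

lift_definition zero_sl :: "'a sl" is 0
  by (simp add: trace_def)

lift_definition plus_sl :: "'a sl \<Rightarrow> 'a sl \<Rightarrow> 'a sl" is "(+)"
  by (simp add: trace_add)

lift_definition uminus_sl :: "'a sl \<Rightarrow> 'a sl" is uminus
  by (simp add: trace_def sum_negf)

lift_definition minus_sl :: "'a sl \<Rightarrow> 'a sl \<Rightarrow> 'a sl" is "(-)"
  by (simp add: trace_sub)

lift_definition scaleC_sl :: "complex \<Rightarrow> 'a sl \<Rightarrow> 'a sl" is "\<lambda>c A. \<chi> i j. c * A $ i $ j"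
  by (simp add: trace_def flip: sum_distrib_left)

lift_definition lie_bracket_sl :: "'a sl \<Rightarrow> 'a sl \<Rightarrow> 'a sl" is "\<lambda>A B. A ** B - B ** A"
  by (metis trace_sub trace_mul_sym right_minus_eq)

instance
proof
  fix x y z :: "'a sl" and c d :: complex
  show "x + y + z = x + (y + z)" by transfer simp
  show "x + y = y + x" by transfer simp
  show "0 + x = x" by transfer simp
  show "- x + x = 0" by transfer simp
  show "x - y = x + - y" by transfer simp
  show "c *\<^sub>C (x + y) = c *\<^sub>C x + c *\<^sub>C y"
    by transfer (simp add: vec_eq_iff distrib_left)
  show "(c + d) *\<^sub>C x = c *\<^sub>C x + d *\<^sub>C x"
    by transfer (simp add: vec_eq_iff distrib_right)
  show "c *\<^sub>C d *\<^sub>C x = (c * d) *\<^sub>C x"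
    by transfer (simp add: vec_eq_iff)
  show "1 *\<^sub>C x = x"
    by transfer (simp add: vec_eq_iff)
  have mm_add: "A ** (B + C) = A ** B + A ** C" "(B + C) ** A = B ** A + C ** A"
    and mm_sub: "A ** (B - C) = A ** B - A ** C" "(B - C) ** A = B ** A - C ** A"
    for A B C :: "complex ^ 'a ^ 'a"
    by (simp_all add: vec_eq_iff matrix_matrix_mult_def sum.distrib sum_subtractf distrib_left
        distrib_right left_diff_distrib right_diff_distrib)
  show "lie_bracket (x + y) z = lie_bracket x z + lie_bracket y z"
    by transfer (simp add: mm_add)
  show "lie_bracket x (y + z) = lie_bracket x y + lie_bracket x z"
    by transfer (simp add: mm_add)
  have mm_left: "(\<chi> i j. k * A $ i $ j) ** C = (\<chi> i j. k * (A ** C) $ i $ j)"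
    and mm_right: "C ** (\<chi> i j. k * A $ i $ j) = (\<chi> i j. k * (C ** A) $ i $ j)"
    for k :: complex and A C :: "complex ^ 'a ^ 'a"
    by (simp_all add: vec_eq_iff matrix_matrix_mult_def sum_distrib_left mult.assoc
        mult.left_commute)
  show "lie_bracket (c *\<^sub>C x) y = c *\<^sub>C lie_bracket x y"
    by transfer (simp only: mm_left mm_right, simp add: vec_eq_iff right_diff_distrib)
  show "lie_bracket x (c *\<^sub>C y) = c *\<^sub>C lie_bracket x y"
    by transfer (simp only: mm_left mm_right, simp add: vec_eq_iff right_diff_distrib)
  show "lie_bracket x x = 0"
    by transfer simp
  have cancel: "(p - q - (r - s)) + (r - t - (u - q)) + (u - s - (p - t)) = 0"
    for p q r s t u :: "complex ^ 'a ^ 'a"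
    by (simp add: vec_eq_iff)
  show "lie_bracket x (lie_bracket y z) + lie_bracket y (lie_bracket z x)
          + lie_bracket z (lie_bracket x y) = 0"
    by transfer (simp only: mm_sub matrix_mul_assoc cancel)
qed

end

text \<open>The matrix \<open>e_ij - (\<delta>_ij / m) I_m\<close>, where \<open>m = CARD('k)\<close>: the matrix unit \<open>e_ij\<close> if \<open>i \<noteq> j\<close>,
  and \<open>h_i\<close> if \<open>i = j\<close>.\<close>

lift_definition sl_unit :: "'k::finite \<Rightarrow> 'k \<Rightarrow> 'k sl" is
  "\<lambda>i j. \<chi> a b. (if a = i \<and> b = j then 1 else 0)
                 - (if i = j \<and> a = b then 1 / of_nat CARD('k) else 0)"
proof -
  fix i j :: 'k
  have 1: "(\<Sum>a\<in>UNIV. if a = i \<and> a = j then 1 else 0 :: complex) = (if i = j then 1 else 0)"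
    by (cases "i = j") (auto intro!: sum.neutral)
  have 2: "(\<Sum>a\<in>(UNIV::'k set). if i = j \<and> a = a then 1 / of_nat CARD('k) else 0 :: complex)
             = (if i = j then 1 else 0)"
    by (cases "i = j") simp_all
  show "trace (\<chi> a b. (if a = i \<and> b = j then 1 else 0)
          - (if i = j \<and> a = b then 1 / of_nat CARD('k) else 0 :: complex)) = 0"
    unfolding trace_def vec_lambda_beta sum_subtractf 1 2 by (rule diff_self)
qed

text \<open>From here on, the index set \<open>{0, \<dots>, n}\<close> is \<open>'n option\<close> with \<open>n = CARD('n)\<close>: \<open>None\<close> stands for
  \<open>0\<close> and the elements \<open>Some i\<close> stand for \<open>1, \<dots>, n\<close>.\<close>

definition cartan :: "'n::finite option sl set" where
  "cartan = {H. \<forall>a b. a \<noteq> b \<longrightarrow> sl_matrix H $ a $ b = 0}"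

definition nil_m :: "'n::finite option sl set" where
  "nil_m = complex_vector.span (range (\<lambda>i. sl_unit None (Some i)))"

text \<open>\<open>f\<close> exhibits the codomain as the algebra \<open>S\<^sup>-\<^sup>1 R\<close> of left fractions \<open>s\<^sup>-\<^sup>1 r\<close>. For an Ore set
  \<open>S\<close> such an \<open>f\<close> exists and is unique up to a unique isomorphism.\<close>

definition is_localization ::
  "'r set \<Rightarrow> ('r::complex_algebra_1 \<Rightarrow> 'q::complex_algebra_1) \<Rightarrow> bool" where
  "is_localization S f \<longleftrightarrow>
     algebra_hom f \<and>
     (\<forall>s\<in>S. invertible_elt (f s)) \<and>
     (\<forall>q. \<exists>s\<in>S. \<exists>r. q = inv_elt (f s) * f r) \<and>
     (\<forall>r. f r = 0 \<longleftrightarrow> (\<exists>s\<in>S. s * r = 0))"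

text \<open>The \<open>e_0k\<close> commute with each other, so the enumeration \<open>ks\<close> of the index set is immaterial.\<close>

definition ore_set :: "'n::finite option sl uea set" where
  "ore_set = {prod_list (map (\<lambda>k. uea_of (sl_unit None (Some k)) ^ i k) ks) | i ks.
     distinct ks \<and> set ks = UNIV}"

context
  fixes \<phi> :: "'n::finite option sl uea \<Rightarrow> 'q::complex_algebra_1"
begin

definition emb :: "'n option sl \<Rightarrow> 'q" where
  "emb X = \<phi> (uea_of X)"

definition e_elt :: "'n option \<Rightarrow> 'n option \<Rightarrow> 'q" where
  "e_elt i j = emb (sl_unit i j)"

definition W_alg :: "'q set" where
  "W_alg = {u. (\<forall>X\<in>cartan. emb X * u - u * emb X = 0) \<and> (\<forall>X\<in>nil_m. emb X * u - u * emb X = 0)}"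

definition B_alg :: "'q set" where
  "B_alg = subalgebra hull
     (range (\<lambda>i. e_elt (Some i) (Some i)) \<union> range (\<lambda>k. e_elt None (Some k))
      \<union> range (\<lambda>k. inv_elt (e_elt None (Some k))))"

definition x_elt :: "'n \<Rightarrow> 'n \<Rightarrow> 'q" where
  "x_elt i j = e_elt (Some i) (Some j) * e_elt None (Some i) * inv_elt (e_elt None (Some j)) - e_elt (Some i) (Some i)"

definition omega_elt :: "'n \<Rightarrow> 'q" where
  "omega_elt k = e_elt (Some k) None * e_elt None (Some k) +
     (\<Sum>j\<in>UNIV. e_elt (Some k) (Some j) * (e_elt (Some j) (Some j) - 1)
        * e_elt None (Some k) * inv_elt (e_elt None (Some j)))"

end

datatype 'n gen = X_gen 'n 'n | Omega_gen 'n

definition gens :: "'n gen set" where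
  "gens = {X_gen i j | i j. i \<noteq> j} \<union> range Omega_gen"

primrec gen_val :: "('n::finite option sl uea \<Rightarrow> 'q::complex_algebra_1) \<Rightarrow> 'n gen \<Rightarrow> 'q" where
  "gen_val \<phi> (X_gen i j) = x_elt \<phi> i j"
| "gen_val \<phi> (Omega_gen k) = omega_elt \<phi> k"

text \<open>The total order on the generators is given by the list \<open>gs\<close> enumerating them.\<close>

definition ordered_monomial ::
  "('n::finite option sl uea \<Rightarrow> 'q::complex_algebra_1) \<Rightarrow> 'n gen list \<Rightarrow> ('n gen \<Rightarrow> nat) \<Rightarrow> 'q" where
  "ordered_monomial \<phi> gs a = prod_list (map (\<lambda>g. gen_val \<phi> g ^ a g) gs)"

definition exponents :: "('n gen \<Rightarrow> nat) set" where
  "exponents = {a. \<forall>g. g \<notin> gens \<longrightarrow> a g = 0}"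

end

theory Submission
  imports Defs
begin

text \<open>
  Write \<open>Q\<close> for the localization, \<open>e_k\<close> for \<open>e_0k\<close>, and put \<open>y_k = h_k e_k^-1\<close>. Then \<open>[e_j, y_k] = \<delta>_jk\<close>, so \<open>B\<close> is a Weyl
  algebra with the \<open>e_k\<close> inverted, while the \<open>x_ij\<close> and \<open>\<omega>_k\<close> commute with all \<open>e_k\<close> and \<open>h_k\<close>, hence with \<open>B\<close>.
  The whole theorem follows from one basis of \<open>Q\<close>, the products \<open>e^\<alpha> y^\<beta> M\<close> with \<open>\<alpha>\<close> integral,
  \<open>\<beta>\<close> natural and \<open>M\<close> an ordered monomial in the \<open>x_ij\<close> and \<open>\<omega>_k\<close> (\<open>independent_pbw\<close>, \<open>span_pbw\<close>).
  Since \<open>[e_k, _]\<close> differentiates \<open>e^\<alpha> y^\<beta>\<close> with respect to \<open>y_k\<close> and \<open>[h_k, _]\<close> multiplies it by \<open>\<beta>_k - \<alpha>_k\<close>,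
  an element commuting with all \<open>e_k\<close> and \<open>h_k\<close> involves only \<open>\<alpha> = \<beta> = 0\<close>; this is part (b)
  (\<open>mon_basis\<close>). The same basis shows that the monomials \<open>M\<close> are independent over \<open>B\<close>, so the
  multiplication map \<open>W \<otimes> B \<rightarrow> Q\<close> is injective; it is onto because \<open>Q = W B\<close> (\<open>tensor_iso\<close>). As \<open>W\<close> is the
  centralizer of \<open>B\<close> and \<open>Q = W B\<close>, the centers of \<open>Q\<close> and \<open>W\<close> are even equal (\<open>center_eq\<close>).

  Spanning is a straightening argument. Over \<open>B\<close> the matrix units \<open>e_ij\<close> and \<open>e_k0\<close> are expressed by \<open>x_ij\<close>
  and \<open>\<omega>_k\<close>. Filter \<open>Q\<close> by giving \<open>e_k^\<plusminus>1\<close> degree \<open>0\<close>, the block \<open>e_ij\<close> with \<open>i, j \<ge> 1\<close> degree \<open>1\<close>, and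
  \<open>e_k0\<close> degree \<open>2\<close>. Commutators lower the degree by one, so a word in the \<open>x_ij\<close> and \<open>\<omega>_k\<close> may be sorted
  at the cost of terms of smaller degree (\<open>filt_commutator\<close>, \<open>gprod_permute\<close>, \<open>filt_ordered_span\<close>).

  Independence is where a theorem of Poincare-Birkhoff-Witt type is hidden. It is obtained from
  one explicit module: functions of a matrix \<open>\<xi>\<close>, on which \<open>e_ij\<close> acts as \<open>\<Sum>_k X_ki D_kj\<close>, where \<open>X\<close> and \<open>D\<close> are
  difference operators with the commutation relations of coordinates and partial derivatives. Along a
  ray \<open>t \<xi>\<close>, the operator of \<open>e_ij\<close> multiplies the leading term of a function by \<open>t \<xi>_ij\<close>. Therefore
  products have multiplicative symbols, and a linear relation between the \<open>e^\<alpha> y^\<beta> M\<close> yields, in top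
  degree, a linear relation between their symbols. These symbols are Laurent monomials in quantities
  that can be given arbitrary nonzero values by the choice of \<open>\<xi>\<close>, that is, distinct characters of a
  torus, and distinct characters are linearly independent (\<open>characters_independent\<close>).
\<close>

section \<open>Independent families and characters\<close>

abbreviation cspan :: "'a::complex_vector set \<Rightarrow> 'a set" where "cspan \<equiv> complex_vector.span"
lemmas mult_scaleC = mult_scaleC_left mult_scaleC_right

definition indep_family :: "('i \<Rightarrow> 'a::complex_vector) \<Rightarrow> 'i set \<Rightarrow> bool" where
  "indep_family f I \<longleftrightarrow>
     (\<forall>J c. finite J \<longrightarrow> J \<subseteq> I \<longrightarrow> (\<Sum>i\<in>J. c i *\<^sub>C f i) = 0 \<longrightarrow> (\<forall>i\<in>J. c i = 0))"

lemma indep_familyD: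
  assumes "indep_family f I" "finite J" "J \<subseteq> I" "(\<Sum>i\<in>J. c i *\<^sub>C f i) = 0" "i \<in> J"
  shows "c i = 0"
  using assms unfolding indep_family_def by blast

lemma indep_family_inj_on:
  assumes "indep_family f I" shows "inj_on f I"
proof (rule inj_onI, rule ccontr)
  fix i j assume ij: "i \<in> I" "j \<in> I" "f i = f j" "i \<noteq> j"
  have "(\<Sum>k\<in>{i, j}. (if k = i then 1 else - 1) *\<^sub>C f k) = 0"
    using ij by simp
  then have "(if i = i then 1 else - 1) = (0::complex)"
    using indep_familyD[OF assms, of "{i,j}" "\<lambda>k. if k = i then 1 else - 1" i] ij by blast
  then show False by simp
qed

lemma indep_family_independent:
  assumes "indep_family f I" shows "complex_vector.independent (f ` I)"
proof -
  have "c v = 0" if t: "finite t" "t \<subseteq> f ` I" "(\<Sum>v\<in>t. c v *\<^sub>C v) = 0" "v \<in> t" for t c v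
  proof -
    obtain J where J: "J \<subseteq> I" "t = f ` J" "inj_on f J"
      using subset_image_inj[THEN iffD1, OF t(2)] by auto
    have "finite J" using J t(1) finite_image_iff by blast
    moreover have "(\<Sum>i\<in>J. c (f i) *\<^sub>C f i) = 0"
      using t(3) J by (simp add: sum.reindex)
    ultimately have "c (f i) = 0" if "i \<in> J" for i
      using indep_familyD[OF assms _ J(1), of "\<lambda>i. c (f i)" i] that by simp
    with t(4) J(2) show ?thesis by auto
  qed
  then show ?thesis
    unfolding complex_vector.independent_explicit_module by blast
qed

lemma indep_family_reindex:
  assumes "indep_family f I" "inj_on s J" "s ` J \<subseteq> I"
  shows "indep_family (\<lambda>j. f (s j)) J"
  unfolding indep_family_def
proof (intro allI impI ballI)
  fix K c j
  assume K: "finite K" "K \<subseteq> J" "(\<Sum>i\<in>K. c i *\<^sub>C f (s i)) = 0" "j \<in> K"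
  have inj: "inj_on s K" using assms(2) K(2) by (rule inj_on_subset)
  have "(\<Sum>i\<in>s ` K. c (the_inv_into K s i) *\<^sub>C f i) = 0"
    using K(3) by (simp add: sum.reindex[OF inj] the_inv_into_f_f[OF inj])
  then have "c (the_inv_into K s (s j)) = 0"
    using K assms(3) by (intro indep_familyD[OF assms(1), of "s ` K"]) auto
  then show "c j = 0"
    using K(4) by (simp add: the_inv_into_f_f[OF inj])
qed

lemma family_spanE:
  assumes "inj_on f I" "x \<in> cspan (f ` I)"
  obtains J c where "finite J" "J \<subseteq> I" "x = (\<Sum>i\<in>J. c i *\<^sub>C f i)"
proof -
  from assms(2) obtain t r where t: "finite t" "t \<subseteq> f ` I" "x = (\<Sum>a\<in>t. r a *\<^sub>C a)"
    unfolding complex_vector.span_explicit by auto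
  obtain J where J: "J \<subseteq> I" "t = f ` J" "inj_on f J"
    using subset_image_inj[THEN iffD1, OF t(2)] by auto
  have "finite J" using J t(1) finite_image_iff by blast
  moreover have "x = (\<Sum>i\<in>J. r (f i) *\<^sub>C f i)"
    using t(3) J by (simp add: sum.reindex)
  ultimately show thesis using J(1) that[of J "\<lambda>i. r (f i)"] by simp
qed

text \<open>Artin's argument. If a relation holds, evaluating it at a product \<open>q p\<close> and subtracting
  \<open>ch j q\<close> times its value at \<open>p\<close> removes the character \<open>j\<close> and multiplies the coefficient of \<open>i\<close> by
  \<open>ch i q - ch j q\<close>, which is nonzero for a suitable \<open>q\<close>. The monoid of points is given by a carrier
  \<open>P\<close> and a product \<open>pm\<close>, so that it can be a set of tuples of functions.\<close>

lemma characters_independent: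
  fixes ch :: "'i \<Rightarrow> 'p \<Rightarrow> complex" and pm :: "'p \<Rightarrow> 'p \<Rightarrow> 'p"
  assumes "finite I"
    and "\<And>p q. p \<in> P \<Longrightarrow> q \<in> P \<Longrightarrow> pm p q \<in> P"
    and "\<And>i p q. i \<in> I \<Longrightarrow> p \<in> P \<Longrightarrow> q \<in> P \<Longrightarrow> ch i (pm p q) = ch i p * ch i q"
    and "\<And>i. i \<in> I \<Longrightarrow> \<exists>p\<in>P. ch i p \<noteq> 0"
    and "\<And>i j. i \<in> I \<Longrightarrow> j \<in> I \<Longrightarrow> i \<noteq> j \<Longrightarrow> \<exists>p\<in>P. ch i p \<noteq> ch j p"
    and "\<And>p. p \<in> P \<Longrightarrow> (\<Sum>i\<in>I. c i * ch i p) = 0"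
    and "i \<in> I"
  shows "c i = 0"
  using assms
proof (induction I arbitrary: c i rule: finite_induct)
  case empty
  then show ?case by simp
next
  case (insert j I)
  have rest: "c i = 0" if i: "i \<in> I" for i
  proof -
    obtain q where q: "q \<in> P" "ch i q \<noteq> ch j q"
      using insert.prems(4)[of i j] i insert.hyps(2) by blast
    have "(\<Sum>i\<in>I. (c i * (ch i q - ch j q)) * ch i p) = 0" if p: "p \<in> P" for p
    proof -
      have "(\<Sum>i\<in>I. (c i * (ch i q - ch j q)) * ch i p)
          = (\<Sum>i\<in>insert j I. (c i * (ch i q - ch j q)) * ch i p)"
        using insert.hyps by simp
      also have "\<dots> = (\<Sum>i\<in>insert j I. c i * ch i (pm q p))
                  - ch j q * (\<Sum>i\<in>insert j I. c i * ch i p)"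
        unfolding sum_distrib_left sum_subtractf[symmetric]
        by (rule sum.cong) (use p q insert.prems(2) in \<open>auto simp: algebra_simps\<close>)
      also have "\<dots> = 0"
        using p q insert.prems(1)[of q p] insert.prems(5)[of "pm q p"] insert.prems(5)[of p] by simp
      finally show ?thesis .
    qed
    then have "c i * (ch i q - ch j q) = 0"
      by (intro insert.IH[of "\<lambda>i. c i * (ch i q - ch j q)" i])
         (use insert.prems(1-4) i in simp_all)
    then show ?thesis using q by simp
  qed
  obtain p where p: "p \<in> P" "ch j p \<noteq> 0" using insert.prems(3) by blast
  have "c j * ch j p = 0"
    using insert.prems(5)[OF p(1)] insert.hyps rest by simp
  with p rest insert.prems(6) show ?case by auto
qed

section \<open>From Lie modules to modules over the enveloping algebra\<close>

definition linear_op :: "(('x \<Rightarrow> complex) \<Rightarrow> 'x \<Rightarrow> complex) \<Rightarrow> bool" where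
  "linear_op T \<longleftrightarrow> (\<forall>f g. T (\<lambda>x. f x + g x) = (\<lambda>x. T f x + T g x))
                \<and> (\<forall>c f. T (\<lambda>x. c * f x) = (\<lambda>x. c * T f x))"

lemma linear_op_add: "linear_op T \<Longrightarrow> T (\<lambda>x. f x + g x) = (\<lambda>x. T f x + T g x)"
  and linear_op_scale: "linear_op T \<Longrightarrow> T (\<lambda>x. c * f x) = (\<lambda>x. c * T f x)"
  unfolding linear_op_def by blast+

lemma linear_op_zero: "linear_op T \<Longrightarrow> T (\<lambda>x. 0) = (\<lambda>x. 0)"
  using linear_op_scale[of T 0 "\<lambda>x. 0"] by simp

lemma linear_op_sum:
  assumes "linear_op T"
  shows "T (\<lambda>x. \<Sum>i\<in>I. f i x) = (\<lambda>x. \<Sum>i\<in>I. T (f i) x)"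
  by (induction I rule: infinite_finite_induct)
     (simp_all add: linear_op_zero[OF assms] linear_op_add[OF assms])

lemma linear_op_comp: "linear_op S \<Longrightarrow> linear_op T \<Longrightarrow> linear_op (\<lambda>f. S (T f))"
  unfolding linear_op_def by simp

lemma linear_op_sum_ops:
  assumes "\<And>i. i \<in> I \<Longrightarrow> linear_op (T i)" shows "linear_op (\<lambda>f x. \<Sum>i\<in>I. c i * T i f x)"
  using assms unfolding linear_op_def
  by (auto simp: fun_eq_iff sum.distrib distrib_left sum_distrib_left mult.left_commute)

abbreviation lookup where "lookup \<equiv> Poly_Mapping.lookup"
abbreviation keys where "keys \<equiv> Poly_Mapping.keys"

definition word_act :: "('g \<Rightarrow> ('x \<Rightarrow> complex) \<Rightarrow> 'x \<Rightarrow> complex) \<Rightarrow> 'g word \<Rightarrow> ('x \<Rightarrow> complex) \<Rightarrow> 'x \<Rightarrow> complex" where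
  "word_act \<rho> w = foldr \<rho> (letters w)"

definition free_act :: "('g \<Rightarrow> ('x \<Rightarrow> complex) \<Rightarrow> 'x \<Rightarrow> complex) \<Rightarrow> 'g free_alg \<Rightarrow> ('x \<Rightarrow> complex) \<Rightarrow> 'x \<Rightarrow> complex" where
  "free_act \<rho> p f = (\<lambda>x. \<Sum>w\<in>keys p. lookup p w * word_act \<rho> w f x)"

lemma word_act_add: "word_act \<rho> (u + v) f = word_act \<rho> u (word_act \<rho> v f)"
  by (simp add: word_act_def plus_word_def)

lemma word_act_linear:
  assumes "\<And>x. linear_op (\<rho> x)" shows "linear_op (word_act \<rho> w)"
proof -
  have "linear_op (foldr \<rho> xs)" for xs
  proof (induction xs)
    case Nil
    then show ?case by (simp add: linear_op_def)
  next
    case (Cons a xs)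
    then show ?case using linear_op_comp[OF assms[of a]] by (simp add: comp_def)
  qed
  then show ?thesis by (simp add: word_act_def)
qed

lemma free_act_superset:
  assumes "finite K" "keys p \<subseteq> K"
  shows "free_act \<rho> p f x = (\<Sum>w\<in>K. lookup p w * word_act \<rho> w f x)"
  unfolding free_act_def
  by (rule sum.mono_neutral_left) (use assms in \<open>auto simp: in_keys_iff\<close>)

lemma free_act_add: "free_act \<rho> (p + q) f x = free_act \<rho> p f x + free_act \<rho> q f x"
proof -
  let ?K = "keys p \<union> keys q"
  have "free_act \<rho> r f x = (\<Sum>w\<in>?K. lookup r w * word_act \<rho> w f x)"
    if "r \<in> {p, q, p + q}" for r
    by (rule free_act_superset) (use that keys_add[of p q] in auto)
  then show ?thesis by (simp add: lookup_add distrib_right sum.distrib)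
qed

lemma free_act_single: "free_act \<rho> (Poly_Mapping.single w c) f x = c * word_act \<rho> w f x"
  by (subst free_act_superset[of "{w}"]) auto

lemma free_act_zero: "free_act \<rho> 0 f x = 0"
  by (simp add: free_act_def)

lemma free_act_uminus: "free_act \<rho> (- p) f x = - free_act \<rho> p f x"
  using free_act_add[of \<rho> p "- p" f x] by (simp add: free_act_zero add_eq_0_iff)

lemma free_act_diff: "free_act \<rho> (p - q) f x = free_act \<rho> p f x - free_act \<rho> q f x"
  using free_act_add[of \<rho> p "- q" f x] by (simp add: free_act_uminus)

lemma free_act_linear:
  assumes "\<And>x. linear_op (\<rho> x)" shows "linear_op (free_act \<rho> p)"
proof -
  have "linear_op (word_act \<rho> w)" for w
    by (rule word_act_linear) (rule assms)
  then show ?thesis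
    unfolding free_act_def by (rule linear_op_sum_ops)
qed

lemma free_alg_induct [case_names zero add]:
  fixes p :: "'g free_alg"
  assumes "P 0" and "\<And>w c p. P p \<Longrightarrow> P (Poly_Mapping.single w c + p)"
  shows "P p"
proof (induction p rule: update_induct)
  case const
  then show ?case by (rule assms(1))
next
  case (update p w d)
  have "Poly_Mapping.update w d p = Poly_Mapping.single w d + p"
    using update by (intro poly_mapping_eqI)
      (auto simp: lookup_update lookup_add lookup_single when_def in_keys_iff)
  with assms(2)[OF update(3)] show ?case by metis
qed

lemma free_act_mult:
  assumes lin: "\<And>x. linear_op (\<rho> x)"
  shows "free_act \<rho> (p * q) f = free_act \<rho> p (free_act \<rho> q f)"
proof -
  have word: "linear_op (word_act \<rho> w)" for w
    by (rule word_act_linear) (rule lin)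
  have single: "free_act \<rho> (Poly_Mapping.single u c * q) f = (\<lambda>x. c * word_act \<rho> u (free_act \<rho> q f) x)" for u c
  proof (induction q rule: free_alg_induct)
    case zero
    then show ?case
      by (simp add: free_act_def linear_op_zero[OF word])
  next
    case (add w d q)
    have "free_act \<rho> (Poly_Mapping.single w d + q) f = (\<lambda>x. d * word_act \<rho> w f x + free_act \<rho> q f x)"
      by (simp add: free_act_add free_act_single fun_eq_iff)
    with add show ?case
      by (simp add: fun_eq_iff distrib_left mult_single free_act_add free_act_single word_act_add
          linear_op_add[OF word] linear_op_scale[OF word])
  qed
  show ?thesis
    by (induction p rule: free_alg_induct)
       (simp_all add: fun_eq_iff free_act_zero free_act_add distrib_right single free_act_single)
qed

lemma free_act_letter: "free_act \<rho> (letter x) f y = \<rho> x f y"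
  by (simp add: letter_def free_act_single word_act_def)

lemma free_act_const: "free_act \<rho> (free_const c) f x = c * f x"
  by (simp add: free_const_def free_act_single word_act_def zero_word_def)

text \<open>The universal property of the enveloping algebra in the form that is used here: an action of the
  Lie algebra by linear operators that respects brackets kills the defining ideal.\<close>

lemma free_act_uea_ideal:
  assumes lin: "\<And>x. linear_op (\<rho> x)"
    and add: "\<And>x y f. \<rho> (x + y) f = (\<lambda>t. \<rho> x f t + \<rho> y f t)"
    and scale: "\<And>c x f. \<rho> (c *\<^sub>C x) f = (\<lambda>t. c * \<rho> x f t)"
    and bracket: "\<And>x y f. \<rho> (lie_bracket x y) f = (\<lambda>t. \<rho> x (\<rho> y f) t - \<rho> y (\<rho> x f) t)"
    and p: "p \<in> uea_ideal"
  shows "free_act \<rho> p f x = 0"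
  using p
proof (induction arbitrary: x f rule: uea_ideal.induct)
  case zero
  then show ?case by (rule free_act_zero)
next
  case (add p q)
  then show ?case by (simp add: free_act_add)
next
  case (relator r a b)
  have let_fun: "free_act \<rho> (letter x) f = \<rho> x f" for x f
    by (rule ext) (rule free_act_letter)
  have "free_act \<rho> r g y = 0" for g y
    using relator
    by cases (simp_all add: free_act_diff free_act_add free_act_letter free_act_mult[OF lin]
        free_act_const let_fun assms(2,3,4))
  then have "free_act \<rho> r g = (\<lambda>y. 0)" for g
    by (rule ext)
  moreover have "linear_op (free_act \<rho> a)"
    by (rule free_act_linear) (rule lin)
  ultimately show ?case
    by (simp add: free_act_mult[OF lin] linear_op_zero)
qed

lemma uea_induct [case_names zero add scale one mult]:
  fixes u :: "'g::complex_lie_algebra uea"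
  assumes "P 0" "\<And>u v. P u \<Longrightarrow> P v \<Longrightarrow> P (u + v)" "\<And>c u. P u \<Longrightarrow> P (c *\<^sub>C u)" "P 1"
    "\<And>x u. P u \<Longrightarrow> P (uea_of x * u)"
  shows "P u"
proof -
  have word: "P (abs_uea (Poly_Mapping.single (Word xs) 1))" for xs :: "'g list"
  proof (induction xs)
    case Nil
    have "abs_uea (Poly_Mapping.single (Word []) 1) = (1 :: 'g uea)"
      by (simp add: one_uea_def zero_word_def[symmetric])
    with assms(4) show ?case by simp
  next
    case (Cons x xs)
    have "abs_uea (Poly_Mapping.single (Word (x # xs)) 1) = uea_of x * abs_uea (Poly_Mapping.single (Word xs) 1)"
      by (simp add: uea_of.abs_eq times_uea.abs_eq letter_def mult_single plus_word_def)
    with assms(5)[OF Cons] show ?case by simp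
  qed
  have "P (abs_uea p)" for p :: "'g free_alg"
  proof (induction p rule: free_alg_induct)
    case zero
    then show ?case using assms(1) by (simp add: zero_uea_def)
  next
    case (add w c p)
    have "abs_uea (Poly_Mapping.single w c + p) = c *\<^sub>C abs_uea (Poly_Mapping.single w 1) + abs_uea p"
      by (simp add: plus_uea.abs_eq scaleC_uea.abs_eq free_const_def mult_single)
    moreover have "P (abs_uea (Poly_Mapping.single w 1))"
      using word[of "letters w"] by simp
    ultimately show ?case using add assms(2,3) by simp
  qed
  then show ?thesis by (induction u rule: uea.abs_induct)
qed

section \<open>A module of functions of a matrix\<close>

type_synonym 'k pt = "'k \<Rightarrow> 'k \<Rightarrow> complex"
type_synonym 'k fn = "'k pt \<Rightarrow> complex"

definition bump :: "'k \<Rightarrow> 'k \<Rightarrow> complex \<Rightarrow> 'k pt \<Rightarrow> 'k pt" where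
  "bump k i c \<xi> = (\<lambda>a b. \<xi> a b + (if a = k \<and> b = i then c else 0))"

text \<open>\<open>Xop\<close> and \<open>Dop\<close> model multiplication by the coordinate \<open>x_ki\<close> and the partial derivative \<open>\<partial>_kj\<close>.
  Reading \<open>f\<close> as the family of
  coefficients of a series \<open>\<Sum>_\<xi> f(\<xi>) x^\<xi>\<close>, a coordinate acts by a shift, and a derivative by a
  shift and a linear factor. Subtracting a constant from a coordinate does not change the commutation
  relations; the constants are chosen such that \<open>Xop k i\<close> tends to \<open>\<delta>_ki\<close> when the shifts become negligible.\<close>

definition Xop :: "'k \<Rightarrow> 'k \<Rightarrow> 'k fn \<Rightarrow> 'k fn" where
  "Xop k i f \<xi> = f (bump k i (- 1) \<xi>) - (if k = i then 0 else f \<xi>)"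

definition Dop :: "'k \<Rightarrow> 'k \<Rightarrow> 'k fn \<Rightarrow> 'k fn" where
  "Dop k j f \<xi> = (\<xi> k j + 1) * f (bump k j 1 \<xi>)"

lemma bump_commute: "bump k i c (bump l j d \<xi>) = bump l j d (bump k i c \<xi>)"
  by (auto simp: bump_def fun_eq_iff)

lemma bump_cancel: "bump k i (- 1) (bump k i 1 \<xi>) = \<xi>" "bump k i 1 (bump k i (- 1) \<xi>) = \<xi>"
  by (auto simp: bump_def fun_eq_iff)

lemma bump_apply: "bump k i c \<xi> a b = \<xi> a b + (if a = k \<and> b = i then c else 0)"
  by (simp add: bump_def)

lemma linear_Xop: "linear_op (Xop k i)"
  by (auto simp: linear_op_def Xop_def fun_eq_iff algebra_simps)

lemma linear_Dop: "linear_op (Dop k j)"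
  by (auto simp: linear_op_def Dop_def fun_eq_iff algebra_simps)

lemma Xop_commute: "Xop k i (Xop l j f) = Xop l j (Xop k i f)"
  by (auto simp: Xop_def fun_eq_iff bump_commute[of k i _ l j])

lemma Dop_commute: "Dop k i (Dop l j f) = Dop l j (Dop k i f)"
  by (auto simp: Dop_def fun_eq_iff bump_commute[of k i _ l j] bump_apply)

text \<open>The canonical commutation relation \<open>[\<partial>_kj, x_li] = \<delta>_kl \<delta>_ji\<close>.\<close>

lemma Dop_Xop: "Dop k j (Xop l i f) \<xi> = Xop l i (Dop k j f) \<xi> + (if k = l \<and> j = i then f \<xi> else 0)"
proof (cases "k = l \<and> j = i")
  case True
  then show ?thesis
    by (auto simp: Dop_def Xop_def bump_cancel bump_apply algebra_simps)
next
  case False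
  have "bump k j 1 (bump l i (- 1) \<xi>) = bump l i (- 1) (bump k j 1 \<xi>)"
    by (rule bump_commute)
  with False show ?thesis
    by (auto simp: Dop_def Xop_def bump_apply algebra_simps)
qed

text \<open>The vector fields \<open>\<Sum>_k x_ki \<partial>_kj\<close> on the space of matrices represent the matrix units of \<open>gl\<close>, and
  that depends on the canonical commutation relations only.\<close>

definition Eop :: "'k::finite \<Rightarrow> 'k \<Rightarrow> 'k fn \<Rightarrow> 'k fn" where
  "Eop i j f \<xi> = (\<Sum>k\<in>UNIV. Xop k i (Dop k j f) \<xi>)"

lemma linear_Eop: "linear_op (Eop i j)"
proof -
  have "linear_op (\<lambda>f \<xi>. \<Sum>k\<in>UNIV. 1 * Xop k i (Dop k j f) \<xi>)"
    by (rule linear_op_sum_ops) (rule linear_op_comp[OF linear_Xop linear_Dop])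
  then show ?thesis by (simp add: Eop_def[abs_def])
qed

text \<open>In the normally ordered form, with all coordinates left of all derivatives, the double sum is
  symmetric in the two factors; only the contraction survives in a bracket.\<close>

lemma Eop_Eop: "Eop i j (Eop l m f) \<xi> =
   (\<Sum>k\<in>UNIV. \<Sum>r\<in>UNIV. Xop k i (Xop r l (Dop k j (Dop r m f))) \<xi>)
     + (if j = l then Eop i m f \<xi> else 0)"
proof -
  have D: "Dop k j (Eop l m f) = (\<lambda>\<xi>. (\<Sum>r\<in>UNIV. Xop r l (Dop k j (Dop r m f)) \<xi>)
       + (if j = l then Dop k m f \<xi> else 0))" for k
  proof -
    have "Dop k j (Eop l m f) = (\<lambda>\<xi>. \<Sum>r\<in>UNIV. Dop k j (Xop r l (Dop r m f)) \<xi>)"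
      unfolding Eop_def[abs_def] by (rule linear_op_sum[OF linear_Dop])
    also have "\<dots> = (\<lambda>\<xi>. (\<Sum>r\<in>UNIV. Xop r l (Dop k j (Dop r m f)) \<xi>)
       + (\<Sum>r\<in>UNIV. if k = r \<and> j = l then Dop r m f \<xi> else 0))"
      by (simp add: Dop_Xop sum.distrib)
    also have "(\<lambda>\<xi>. \<Sum>r\<in>UNIV. if k = r \<and> j = l then Dop r m f \<xi> else 0)
      = (\<lambda>\<xi>. if j = l then Dop k m f \<xi> else 0)"
      by (auto simp: fun_eq_iff)
    finally show ?thesis by (simp add: fun_eq_iff)
  qed
  have X: "Xop k i (Dop k j (Eop l m f)) \<xi> = (\<Sum>r\<in>UNIV. Xop k i (Xop r l (Dop k j (Dop r m f))) \<xi>)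
       + (if j = l then Xop k i (Dop k m f) \<xi> else 0)" for k
    unfolding D linear_op_add[OF linear_Xop] linear_op_sum[OF linear_Xop]
    by (simp add: linear_op_zero[OF linear_Xop])
  show ?thesis
    unfolding Eop_def[of i j] X sum.distrib by (auto simp: Eop_def)
qed

lemma Eop_bracket: "Eop i j (Eop l m f) \<xi> - Eop l m (Eop i j f) \<xi>
   = (if j = l then Eop i m f \<xi> else 0) - (if m = i then Eop l j f \<xi> else 0)"
proof -
  have "(\<Sum>k\<in>UNIV. \<Sum>r\<in>UNIV. Xop k i (Xop r l (Dop k j (Dop r m f))) \<xi>)
      = (\<Sum>r\<in>UNIV. \<Sum>k\<in>UNIV. Xop r l (Xop k i (Dop r m (Dop k j f))) \<xi>)"
    by (subst sum.swap) (simp add: Xop_commute[of _ i _ l] Dop_commute[of _ j _ m])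
  then show ?thesis unfolding Eop_Eop by simp
qed

definition sl_act :: "'k::finite sl \<Rightarrow> 'k fn \<Rightarrow> 'k fn" where
  "sl_act A f \<xi> = (\<Sum>i\<in>UNIV. \<Sum>j\<in>UNIV. sl_matrix A $ i $ j * Eop i j f \<xi>)"

lemma linear_sl_act: "linear_op (sl_act A)"
proof -
  have "linear_op (\<lambda>f \<xi>. \<Sum>j\<in>UNIV. sl_matrix A $ i $ j * Eop i j f \<xi>)" for i
    by (rule linear_op_sum_ops) (rule linear_Eop)
  then have "linear_op (\<lambda>f \<xi>. \<Sum>i\<in>UNIV. 1 * (\<Sum>j\<in>UNIV. sl_matrix A $ i $ j * Eop i j f \<xi>))"
    by (rule linear_op_sum_ops)
  then show ?thesis by (simp add: sl_act_def[abs_def])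
qed

lemma sl_act_add: "sl_act (A + B) f = (\<lambda>t. sl_act A f t + sl_act B f t)"
  by (simp add: sl_act_def fun_eq_iff plus_sl.rep_eq distrib_right sum.distrib)

lemma sl_act_scale: "sl_act (c *\<^sub>C A) f = (\<lambda>t. c * sl_act A f t)"
  by (simp add: sl_act_def fun_eq_iff scaleC_sl.rep_eq sum_distrib_left mult.assoc)

lemma Eop_sl_act:
  "Eop i j (sl_act B f) t - sl_act B (Eop i j f) t
     = (\<Sum>m\<in>UNIV. sl_matrix B $ j $ m * Eop i m f t) - (\<Sum>l\<in>UNIV. sl_matrix B $ l $ i * Eop l j f t)"
proof -
  let ?b = "\<lambda>l m. sl_matrix B $ l $ m"
  have "Eop i j (sl_act B f) t = (\<Sum>l\<in>UNIV. \<Sum>m\<in>UNIV. ?b l m * Eop i j (Eop l m f) t)"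
    unfolding sl_act_def[abs_def] linear_op_sum[OF linear_Eop] linear_op_scale[OF linear_Eop] ..
  then have "Eop i j (sl_act B f) t - sl_act B (Eop i j f) t = (\<Sum>l\<in>UNIV. \<Sum>m\<in>UNIV. ?b l m *
      ((if j = l then Eop i m f t else 0) - (if m = i then Eop l j f t else 0)))"
    unfolding sl_act_def[of B "Eop i j f"]
    by (simp only: sum_subtractf[symmetric] right_diff_distrib[symmetric] Eop_bracket)
  also have "\<dots> = (\<Sum>l\<in>UNIV. \<Sum>m\<in>UNIV. (if j = l then ?b l m * Eop i m f t else 0)
      - (if m = i then ?b l m * Eop l j f t else 0))"
    by (intro sum.cong refl) (auto simp: right_diff_distrib)
  also have "\<dots> = (\<Sum>m\<in>UNIV. \<Sum>l\<in>UNIV. if j = l then ?b l m * Eop i m f t else 0) - (\<Sum>l\<in>UNIV. ?b l i * Eop l j f t)"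
    unfolding sum_subtractf by (subst sum.swap) simp
  finally show ?thesis by simp
qed

lemma sl_act_bracket:
  "sl_act (lie_bracket A B) f = (\<lambda>t. sl_act A (sl_act B f) t - sl_act B (sl_act A f) t)"
proof
  fix t
  let ?a = "\<lambda>i j. sl_matrix A $ i $ j" and ?b = "\<lambda>i j. sl_matrix B $ i $ j"
  have "sl_act B (sl_act A f) t = (\<Sum>i\<in>UNIV. \<Sum>j\<in>UNIV. ?a i j * sl_act B (Eop i j f) t)"
    unfolding sl_act_def[of A f, abs_def] linear_op_sum[OF linear_sl_act] linear_op_scale[OF linear_sl_act] ..
  then have "sl_act A (sl_act B f) t - sl_act B (sl_act A f) t
     = (\<Sum>i\<in>UNIV. \<Sum>j\<in>UNIV. ?a i j * (Eop i j (sl_act B f) t - sl_act B (Eop i j f) t))"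
    by (simp add: sl_act_def[of A "sl_act B f"] sum_subtractf right_diff_distrib)
  also have "\<dots> = (\<Sum>i\<in>UNIV. \<Sum>j\<in>UNIV. \<Sum>m\<in>UNIV. ?a i j * ?b j m * Eop i m f t)
      - (\<Sum>i\<in>UNIV. \<Sum>j\<in>UNIV. \<Sum>l\<in>UNIV. ?a i j * ?b l i * Eop l j f t)"
    unfolding Eop_sl_act by (simp add: right_diff_distrib sum_subtractf sum_distrib_left mult.assoc)
  also have "(\<Sum>i\<in>UNIV. \<Sum>j\<in>UNIV. \<Sum>m\<in>UNIV. ?a i j * ?b j m * Eop i m f t)
      = (\<Sum>i\<in>UNIV. \<Sum>m\<in>UNIV. \<Sum>j\<in>UNIV. ?a i j * ?b j m * Eop i m f t)"
    by (intro sum.cong refl sum.swap)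
  also have "(\<Sum>i\<in>UNIV. \<Sum>j\<in>UNIV. \<Sum>l\<in>UNIV. ?a i j * ?b l i * Eop l j f t)
      = (\<Sum>i\<in>UNIV. \<Sum>l\<in>UNIV. \<Sum>j\<in>UNIV. ?a i j * ?b l i * Eop l j f t)"
    by (intro sum.cong refl sum.swap)
  also have "\<dots> = (\<Sum>l\<in>UNIV. \<Sum>i\<in>UNIV. \<Sum>j\<in>UNIV. ?a i j * ?b l i * Eop l j f t)"
    by (rule sum.swap)
  also have "\<dots> = (\<Sum>l\<in>UNIV. \<Sum>j\<in>UNIV. \<Sum>i\<in>UNIV. ?a i j * ?b l i * Eop l j f t)"
    by (intro sum.cong refl sum.swap)
  also have "(\<Sum>i\<in>UNIV. \<Sum>m\<in>UNIV. \<Sum>j\<in>UNIV. ?a i j * ?b j m * Eop i m f t)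
       - (\<Sum>l\<in>UNIV. \<Sum>j\<in>UNIV. \<Sum>i\<in>UNIV. ?a i j * ?b l i * Eop l j f t) = sl_act (lie_bracket A B) f t"
    unfolding sl_act_def lie_bracket_sl.rep_eq
    by (simp add: matrix_matrix_mult_def left_diff_distrib sum_subtractf sum_distrib_right
        mult.commute[of "sl_matrix B $ a $ b" "sl_matrix A $ c $ d" for a b c d])
  finally show "sl_act (lie_bracket A B) f t = sl_act A (sl_act B f) t - sl_act B (sl_act A f) t" ..
qed

lift_definition uea_act :: "'k::finite sl uea \<Rightarrow> 'k fn \<Rightarrow> 'k fn"
  is "free_act sl_act"
proof -
  fix p q :: "'k sl free_alg"
  assume "p - q \<in> uea_ideal"
  from free_act_uea_ideal[OF linear_sl_act sl_act_add sl_act_scale sl_act_bracket this]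
  show "free_act sl_act p = free_act sl_act q"
    by (simp add: free_act_diff fun_eq_iff)
qed

lemma uea_act_of: "uea_act (uea_of A) f = sl_act A f"
  by transfer (simp add: free_act_letter fun_eq_iff)

lemma uea_act_mult: "uea_act (u * v) f = uea_act u (uea_act v f)"
  by transfer (simp add: free_act_mult[OF linear_sl_act])

lemma uea_act_add: "uea_act (u + v) f = (\<lambda>t. uea_act u f t + uea_act v f t)"
  by transfer (simp add: free_act_add fun_eq_iff)

lemma uea_act_scaleC: "uea_act (c *\<^sub>C u) f = (\<lambda>t. c * uea_act u f t)"
  by transfer (simp add: free_act_mult[OF linear_sl_act] free_act_const fun_eq_iff)

lemma uea_act_zero: "uea_act 0 f = (\<lambda>t. 0)"
  by transfer (simp add: free_act_zero fun_eq_iff)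

lemma uea_act_one: "uea_act 1 f = f"
  by transfer (simp add: free_act_single word_act_def zero_word_def fun_eq_iff flip: single_one)

section \<open>Symbols\<close>

text \<open>\<open>f\<close> behaves like \<open>c t^e\<close> at infinity along all lines parallel to \<open>\<xi>\<close>. Asking for the same limit on
  every parallel line makes the notion invariant under the shifts that occur in \<open>Xop\<close> and \<open>Dop\<close>.\<close>

definition asymptotic :: "'k pt \<Rightarrow> int \<Rightarrow> complex \<Rightarrow> 'k fn \<Rightarrow> bool" where
  "asymptotic \<xi> e c f \<longleftrightarrow> (\<forall>v. ((\<lambda>t::real. f (\<lambda>a b. of_real t * \<xi> a b + v a b) / of_real (t powi e)) \<longlongrightarrow> c) at_top)"

lemma asymptotic_bump:
  assumes "asymptotic \<xi> e c f"
  shows "asymptotic \<xi> e c (\<lambda>\<eta>. f (bump k i d \<eta>))"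
  unfolding asymptotic_def
proof
  fix v
  have "bump k i d (\<lambda>a b. of_real t * \<xi> a b + v a b) = (\<lambda>a b. of_real t * \<xi> a b + bump k i d v a b)" for t :: real
    by (auto simp: bump_def fun_eq_iff)
  then show "((\<lambda>t. f (bump k i d (\<lambda>a b. of_real t * \<xi> a b + v a b)) / of_real (t powi e)) \<longlongrightarrow> c) at_top"
    using assms unfolding asymptotic_def by (simp only: mult.assoc)
qed

lemma asymptotic_add: "asymptotic \<xi> e c f \<Longrightarrow> asymptotic \<xi> e d g \<Longrightarrow> asymptotic \<xi> e (c + d) (\<lambda>x. f x + g x)"
  unfolding asymptotic_def by (auto simp: add_divide_distrib intro: tendsto_add)

lemma asymptotic_zero: "asymptotic \<xi> e 0 (\<lambda>x. 0)"
  by (simp add: asymptotic_def)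

lemma asymptotic_scale: "asymptotic \<xi> e c f \<Longrightarrow> asymptotic \<xi> e (d * c) (\<lambda>x. d * f x)"
  unfolding asymptotic_def by (auto simp: times_divide_eq_right[symmetric] simp del: times_divide_eq_right intro: tendsto_mult_left)

lemma asymptotic_diff: "asymptotic \<xi> e c f \<Longrightarrow> asymptotic \<xi> e d g \<Longrightarrow> asymptotic \<xi> e (c - d) (\<lambda>x. f x - g x)"
  using asymptotic_add[of \<xi> e c f "- 1 * d" "\<lambda>x. - 1 * g x"] asymptotic_scale[of \<xi> e d g "- 1"] by simp

lemma asymptotic_sum: "(\<And>i. i \<in> I \<Longrightarrow> asymptotic \<xi> e (c i) (f i)) \<Longrightarrow> asymptotic \<xi> e (\<Sum>i\<in>I. c i) (\<lambda>x. \<Sum>i\<in>I. f i x)"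
  by (induction I rule: infinite_finite_induct) (simp_all add: asymptotic_zero asymptotic_add)

lemma asymptotic_unique: "asymptotic \<xi> e c f \<Longrightarrow> asymptotic \<xi> e d f \<Longrightarrow> c = d"
  unfolding asymptotic_def by (elim allE[of _ "\<lambda>_ _. 0"]) (rule tendsto_unique[OF trivial_limit_at_top_linorder])

lemma powi_Suc_real: "t > 0 \<Longrightarrow> complex_of_real t powi (1 + e) = of_real t * of_real t powi e"
  by (simp add: power_int_add)

text \<open>On the line through \<open>v\<close>, the factor is \<open>t (\<xi>_kj + (v_kj + d) / t)\<close>.\<close>

lemma asymptotic_coordinate:
  assumes "asymptotic \<xi> e c f"
  shows "asymptotic \<xi> (e + 1) (\<xi> k j * c) (\<lambda>\<eta>. (\<eta> k j + d) * f \<eta>)"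
  unfolding asymptotic_def
proof
  fix v
  have lim: "((\<lambda>t::real. (\<xi> k j + (v k j + d) * of_real (1 / t))) \<longlongrightarrow> \<xi> k j + (v k j + d) * of_real 0) at_top"
    by (intro tendsto_intros tendsto_of_real tendsto_divide_0[OF tendsto_const] filterlim_at_top_imp_at_infinity filterlim_ident)
  have "((\<lambda>t::real. (\<xi> k j + (v k j + d) * of_real (1 / t)) *
      (f (\<lambda>a b. of_real t * \<xi> a b + v a b) / of_real (t powi e))) \<longlongrightarrow> \<xi> k j * c) at_top"
    using tendsto_mult[OF lim assms[unfolded asymptotic_def, rule_format, of v]] by simp
  then show "((\<lambda>t. (of_real t * \<xi> k j + v k j + d) * f (\<lambda>a b. of_real t * \<xi> a b + v a b) / of_real (t powi (e + 1)))
     \<longlongrightarrow> \<xi> k j * c) at_top"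
    by (rule Lim_transform_eventually)
       (use eventually_gt_at_top[of "0::real"] in eventually_elim, simp add: powi_Suc_real field_simps)
qed

lemma asymptotic_lower:
  assumes "asymptotic \<xi> e c f" shows "asymptotic \<xi> (e + 1) 0 f"
  unfolding asymptotic_def
proof
  fix v
  have "((\<lambda>t::real. of_real (1 / t) * (f (\<lambda>a b. of_real t * \<xi> a b + v a b) / of_real (t powi e))) \<longlongrightarrow> of_real 0 * c) at_top"
    by (intro tendsto_mult tendsto_of_real tendsto_divide_0[OF tendsto_const] filterlim_at_top_imp_at_infinity filterlim_ident)
       (use assms in \<open>simp add: asymptotic_def\<close>)
  then have "((\<lambda>t::real. of_real (1 / t) * (f (\<lambda>a b. of_real t * \<xi> a b + v a b) / of_real (t powi e))) \<longlongrightarrow> 0) at_top"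
    by simp
  then show "((\<lambda>t. f (\<lambda>a b. of_real t * \<xi> a b + v a b) / of_real (t powi (e + 1))) \<longlongrightarrow> 0) at_top"
    by (rule Lim_transform_eventually)
       (use eventually_gt_at_top[of "0::real"] in eventually_elim, simp add: powi_Suc_real field_simps)
qed

lemma asymptotic_Dop: "asymptotic \<xi> e c f \<Longrightarrow> asymptotic \<xi> (e + 1) (\<xi> k j * c) (Dop k j f)"
  using asymptotic_coordinate[OF asymptotic_bump[of \<xi> e c f k j 1], of k j 1] by (simp add: Dop_def[abs_def])

lemma asymptotic_Xop: "asymptotic \<xi> e c f \<Longrightarrow> asymptotic \<xi> e (if k = i then c else 0) (Xop k i f)"
  using asymptotic_diff[OF asymptotic_bump[of \<xi> e c f k i "-1"], of c f] asymptotic_bump[of \<xi> e c f k i "-1"]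
  by (cases "k = i") (simp_all add: Xop_def[abs_def])

text \<open>To leading order \<open>Xop k i\<close> is \<open>\<delta>_ki\<close> and \<open>Dop k j\<close> is multiplication by \<open>t \<xi>_kj\<close>, so only the summand
  \<open>k = i\<close> contributes.\<close>

lemma asymptotic_Eop:
  assumes "asymptotic \<xi> e c f" shows "asymptotic \<xi> (e + 1) (\<xi> i j * c) (Eop i j f)"
proof -
  have "asymptotic \<xi> (e + 1) (\<Sum>k\<in>UNIV. if k = i then \<xi> k j * c else 0) (Eop i j f)"
    unfolding Eop_def[abs_def] by (intro asymptotic_sum asymptotic_Xop asymptotic_Dop assms)
  then show ?thesis by simp
qed

text \<open>\<open>s\<close> is the value at the point \<open>\<xi>\<close> of the symbol of order \<open>d\<close>. Elements of smaller order have symbol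
  \<open>0\<close> at order \<open>d\<close>. Symbols are recorded for one point at a time and as a relation, which allows to
  compute with them before knowing that they are unique.\<close>

definition has_symbol :: "'k::finite pt \<Rightarrow> int \<Rightarrow> complex \<Rightarrow> 'k sl uea \<Rightarrow> bool" where
  "has_symbol \<xi> d s u \<longleftrightarrow> (\<forall>e c f. asymptotic \<xi> e c f \<longrightarrow> asymptotic \<xi> (e + d) (s * c) (uea_act u f))"

lemma has_symbol_uea_of:
  "has_symbol \<xi> 1 (\<Sum>i\<in>UNIV. \<Sum>j\<in>UNIV. sl_matrix A $ i $ j * \<xi> i j) (uea_of A)"
  unfolding has_symbol_def
proof (intro allI impI)
  fix e c f assume f: "asymptotic \<xi> e c f"
  have "asymptotic \<xi> (e + 1) (\<Sum>i\<in>UNIV. \<Sum>j\<in>UNIV. sl_matrix A $ i $ j * (\<xi> i j * c)) (uea_act (uea_of A) f)"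
    unfolding uea_act_of sl_act_def[abs_def] by (intro asymptotic_sum asymptotic_scale asymptotic_Eop f)
  then show "asymptotic \<xi> (e + 1) ((\<Sum>i\<in>UNIV. \<Sum>j\<in>UNIV. sl_matrix A $ i $ j * \<xi> i j) * c) (uea_act (uea_of A) f)"
    by (simp add: sum_distrib_right mult.assoc)
qed

text \<open>On traceless \<open>\<xi>\<close> the scalar matrix that is subtracted from \<open>e_ii\<close> has symbol zero.\<close>

lemma has_symbol_sl_unit:
  assumes "(\<Sum>i\<in>UNIV. \<xi> i i) = 0"
  shows "has_symbol \<xi> 1 (\<xi> i j) (uea_of (sl_unit i j))"
proof -
  have "(\<Sum>a\<in>UNIV. \<Sum>b\<in>UNIV. sl_matrix (sl_unit i j) $ a $ b * \<xi> a b)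
     = (\<Sum>a\<in>UNIV. \<Sum>b\<in>UNIV. (if a = i \<and> b = j then \<xi> a b else 0))
       - (\<Sum>a\<in>UNIV. \<Sum>b\<in>UNIV. (if i = j \<and> a = b then \<xi> a b / of_nat CARD('a) else 0))"
    unfolding sum_subtractf[symmetric] sl_unit.rep_eq
    by (intro sum.cong refl) (simp add: left_diff_distrib)
  also have "(\<Sum>a\<in>UNIV. \<Sum>b\<in>UNIV. (if a = i \<and> b = j then \<xi> a b else 0))
     = (\<Sum>a\<in>UNIV. if a = i then (\<Sum>b\<in>UNIV. if b = j then \<xi> a b else 0) else 0)"
    by (intro sum.cong refl) auto
  also have "\<dots> = \<xi> i j" by simp
  also have "(\<Sum>a\<in>UNIV. \<Sum>b\<in>UNIV. (if i = j \<and> a = b then \<xi> a b / of_nat CARD('a) else 0))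
     = (if i = j then (\<Sum>a\<in>UNIV. \<xi> a a) / of_nat CARD('a) else 0)"
    by (simp add: sum_divide_distrib)
  finally have "(\<Sum>a\<in>UNIV. \<Sum>b\<in>UNIV. sl_matrix (sl_unit i j) $ a $ b * \<xi> a b) = \<xi> i j"
    using assms by simp
  then show ?thesis using has_symbol_uea_of[of \<xi> "sl_unit i j"] by simp
qed

lemma has_symbol_mult: "has_symbol \<xi> d s u \<Longrightarrow> has_symbol \<xi> e r v \<Longrightarrow> has_symbol \<xi> (d + e) (s * r) (u * v)"
  unfolding has_symbol_def uea_act_mult
proof (intro allI impI)
  fix n c f
  assume u: "\<forall>e c f. asymptotic \<xi> e c f \<longrightarrow> asymptotic \<xi> (e + d) (s * c) (uea_act u f)"
    and v: "\<forall>n c f. asymptotic \<xi> n c f \<longrightarrow> asymptotic \<xi> (n + e) (r * c) (uea_act v f)"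
    and f: "asymptotic \<xi> n c f"
  then have "asymptotic \<xi> (n + e + d) (s * (r * c)) (uea_act u (uea_act v f))"
    by simp
  then show "asymptotic \<xi> (n + (d + e)) (s * r * c) (uea_act u (uea_act v f))"
    by (simp add: ac_simps)
qed

lemma has_symbol_one: "has_symbol \<xi> 0 1 1"
  by (simp add: has_symbol_def uea_act_one)

lemma has_symbol_zero: "has_symbol \<xi> d 0 0"
  by (simp add: has_symbol_def uea_act_zero asymptotic_zero)

lemma has_symbol_add: "has_symbol \<xi> d s u \<Longrightarrow> has_symbol \<xi> d r v \<Longrightarrow> has_symbol \<xi> d (s + r) (u + v)"
  unfolding has_symbol_def uea_act_add distrib_right using asymptotic_add by blast

lemma has_symbol_scaleC: "has_symbol \<xi> d s u \<Longrightarrow> has_symbol \<xi> d (c * s) (c *\<^sub>C u)"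
  unfolding has_symbol_def uea_act_scaleC mult.assoc using asymptotic_scale by blast

lemma has_symbol_lower: "has_symbol \<xi> d s u \<Longrightarrow> has_symbol \<xi> (d + 1) 0 u"
  unfolding has_symbol_def using asymptotic_lower by (fastforce simp: add.assoc)

text \<open>The constant function \<open>1\<close> is a test function of order \<open>0\<close>.\<close>

lemma has_symbol_zero_unique:
  assumes "has_symbol \<xi> d s 0" shows "s = 0"
proof -
  have "asymptotic \<xi> 0 1 (\<lambda>_. 1)" by (simp add: asymptotic_def)
  with assms have "asymptotic \<xi> d s (\<lambda>t. 0)"
    unfolding has_symbol_def uea_act_zero by (metis add_0 mult_1_right)
  from asymptotic_unique[OF this asymptotic_zero] show ?thesis .
qed

lemma has_symbol_prod_list:
  assumes "\<And>x. x \<in> set xs \<Longrightarrow> has_symbol \<xi> (d x) (s x) (f x)"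
  shows "has_symbol \<xi> (sum_list (map d xs)) (prod_list (map s xs)) (prod_list (map f xs))"
  using assms by (induction xs) (simp_all add: has_symbol_one has_symbol_mult)

lemma has_symbol_power:
  assumes "has_symbol \<xi> d s u" shows "has_symbol \<xi> (int m * d) (s ^ m) (u ^ m)"
  by (induction m) (use assms has_symbol_mult in \<open>auto simp: has_symbol_one distrib_right\<close>)

section \<open>Products and commutators in associative algebras\<close>

definition commutator :: "'a::ring_1 \<Rightarrow> 'a \<Rightarrow> 'a" where
  "commutator a b = a * b - b * a"

lemma commutator_eq_0_iff: "commutator a b = 0 \<longleftrightarrow> a * b = b * a"
  by (simp add: commutator_def)

lemma commutator_mult_right: "commutator a (b * c) = commutator a b * c + b * commutator a c"
  by (simp add: commutator_def algebra_simps)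

lemma commutator_mult_left: "commutator (a * b) c = a * commutator b c + commutator a c * b"
  by (simp add: commutator_def algebra_simps)

lemma commutator_add_right: "commutator a (b + c) = commutator a b + commutator a c"
  and commutator_diff_right: "commutator a (b - c) = commutator a b - commutator a c"
  and commutator_add_left: "commutator (a + b) c = commutator a c + commutator b c"
  by (simp_all add: commutator_def algebra_simps)

lemma commutator_zero [simp]: "commutator 0 a = 0" "commutator a 0 = 0"
  and commutator_one [simp]: "commutator 1 a = 0" "commutator a 1 = 0"
  by (simp_all add: commutator_def)

lemma commutator_sum_right: "commutator a (\<Sum>i\<in>I. b i) = (\<Sum>i\<in>I. commutator a (b i))"
  by (simp add: commutator_def sum_distrib_left sum_distrib_right sum_subtractf)

lemma commutator_sum_left: "commutator (\<Sum>i\<in>I. b i) a = (\<Sum>i\<in>I. commutator (b i) a)"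
  by (simp add: commutator_def sum_distrib_left sum_distrib_right sum_subtractf)

lemma commutator_scaleC_right: "commutator a (c *\<^sub>C b) = c *\<^sub>C commutator a (b::'a::complex_algebra_1)"
  and commutator_scaleC_left: "commutator (c *\<^sub>C a) b = c *\<^sub>C commutator a (b::'a::complex_algebra_1)"
  by (simp_all add: commutator_def mult_scaleC complex_vector.scale_right_diff_distrib)

lemma commutator_swap: "commutator a b = - commutator b a"
  by (simp add: commutator_def)

lemma span_mult:
  fixes A B :: "'a::complex_algebra_1 set"
  assumes "\<And>a b. a \<in> A \<Longrightarrow> b \<in> B \<Longrightarrow> a * b \<in> cspan C"
    and "p \<in> cspan A" "q \<in> cspan B"
  shows "p * q \<in> cspan C"
  using assms(2)
proof (induction rule: complex_vector.span_induct_alt)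
  case base
  then show ?case by (simp add: complex_vector.span_zero)
next
  case (step c a p)
  have "a * q \<in> cspan C"
    using assms(3)
  proof (induction rule: complex_vector.span_induct_alt)
    case base
    then show ?case by (simp add: complex_vector.span_zero)
  next
    case (step c b q)
    then show ?case
      using assms(1)[OF \<open>a \<in> A\<close>] by (simp add: distrib_left mult_scaleC_right complex_vector.span_add complex_vector.span_scale)
  qed
  with step show ?case
    by (simp add: distrib_right mult_scaleC_left complex_vector.span_add complex_vector.span_scale)
qed

lemma commute_prod_list:
  fixes z :: "'a::monoid_mult"
  assumes "\<And>x. x \<in> set xs \<Longrightarrow> z * x = x * z"
  shows "z * prod_list xs = prod_list xs * z"
  using assms
proof (induction xs)
  case (Cons x xs)
  then have "z * x = x * z" by simp
  then have "z * (x * prod_list xs) = x * (z * prod_list xs)"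
    by (simp only: mult.assoc[symmetric])
  with Cons show ?case by (simp add: mult.assoc)
qed simp

lemma commute_power: "z * x = x * z \<Longrightarrow> z * x ^ m = x ^ m * (z::'a::monoid_mult)"
  using power_commuting_commutes[of x z m] by simp

lemma commute_inverse:
  fixes z :: "'a::monoid_mult"
  assumes "z * x = x * z" "x * y = 1" "y * x = 1"
  shows "z * y = y * z"
proof -
  have "z * y = (y * x) * (z * y)" using assms by simp
  also have "\<dots> = y * (x * z) * y" by (simp only: mult.assoc)
  also have "\<dots> = y * (z * x) * y" using assms by simp
  also have "\<dots> = y * z * (x * y)" by (simp only: mult.assoc)
  finally show ?thesis using assms by simp
qed

lemma inv_elt_inverse:
  assumes "invertible_elt x" shows "x * inv_elt x = 1" "inv_elt x * x = 1"
proof -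
  obtain y where y: "x * y = 1" "y * x = 1" using assms unfolding invertible_elt_def by blast
  have "inv_elt x = y"
    unfolding inv_elt_def
  proof (rule the_equality)
    fix w assume w: "x * w = 1 \<and> w * x = 1"
    then have "w = (y * x) * w" using y by simp
    also have "\<dots> = y * (x * w)" by (rule mult.assoc)
    finally show "w = y" using w by simp
  qed (use y in simp)
  with y show "x * inv_elt x = 1" "inv_elt x * x = 1" by simp_all
qed

lemma sum_option: "(\<Sum>x\<in>UNIV. F x) = F None + (\<Sum>i\<in>UNIV. F (Some i))"
  for F :: "'n::finite option \<Rightarrow> 'a::comm_monoid_add"
proof -
  have "(\<Sum>x\<in>UNIV. F x) = F None + (\<Sum>x\<in>range Some. F x)"
    unfolding UNIV_option_conv by (rule sum.insert) auto
  then show ?thesis by (simp add: sum.reindex)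
qed

section \<open>The matrix units of the special linear Lie algebra\<close>

lemma sl_unit_entry: "sl_matrix (sl_unit i j) $ a $ b
   = (if a = i \<and> b = j then 1 else 0) - (if i = j \<and> a = b then 1 / of_nat CARD('k) else 0)"
  for i j :: "'k::finite"
  by (simp add: sl_unit.rep_eq)

lemma sl_unit_mult_entry:
  fixes i j l m a b :: "'k::finite"
  defines "kap \<equiv> \<lambda>i j :: 'k. if i = j then 1 / of_nat CARD('k) else (0::complex)"
  shows "(sl_matrix (sl_unit i j) ** sl_matrix (sl_unit l m)) $ a $ b
     = (if a = i \<and> b = m \<and> j = l then 1 else 0) - kap i j * (if a = l \<and> b = m then 1 else 0)
        - kap l m * (if a = i \<and> b = j then 1 else 0) + kap i j * kap l m * (if a = b then 1 else 0)"
proof -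
  have "(sl_matrix (sl_unit i j) ** sl_matrix (sl_unit l m)) $ a $ b
     = (\<Sum>c\<in>UNIV. (if c = j then (if a = i \<and> b = m \<and> j = l then 1 else 0) else 0)
         - (if c = a then kap i j * (if a = l \<and> b = m then 1 else 0) else 0)
         - (if c = b then kap l m * (if a = i \<and> b = j then 1 else 0) else 0)
         + (if c = a then (if a = b then kap i j * kap l m else 0) else 0))"
  proof -
    have "sl_matrix (sl_unit i j) $ a $ c * sl_matrix (sl_unit l m) $ c $ b
       = (if c = j then (if a = i \<and> b = m \<and> j = l then 1 else 0) else 0)
         - (if c = a then kap i j * (if a = l \<and> b = m then 1 else 0) else 0)
         - (if c = b then kap l m * (if a = i \<and> b = j then 1 else 0) else 0)
         + (if c = a then (if a = b then kap i j * kap l m else 0) else 0)" for c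
    proof -
      have distrib: "(p - q) * (r - s) = p * r - q * r - p * s + q * s" for p q r s :: complex
        by (simp add: algebra_simps)
      have "(if i = j \<and> a = c then 1 / of_nat CARD('k) else 0) = (if c = a then kap i j else 0)"
        "(if l = m \<and> c = b then 1 / of_nat CARD('k) else 0) = (if c = b then kap l m else 0)"
        by (auto simp: kap_def)
      then have "sl_matrix (sl_unit i j) $ a $ c * sl_matrix (sl_unit l m) $ c $ b
        = ((if a = i \<and> c = j then 1 else 0) - (if c = a then kap i j else 0))
           * ((if c = l \<and> b = m then 1 else 0) - (if c = b then kap l m else 0))"
        by (simp only: sl_unit_entry)
      also have "\<dots> = (if a = i \<and> c = j then 1 else 0) * (if c = l \<and> b = m then 1 else 0)
          - (if c = a then kap i j else 0) * (if c = l \<and> b = m then 1 else 0)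
          - (if a = i \<and> c = j then 1 else 0) * (if c = b then kap l m else 0)
          + (if c = a then kap i j else 0) * (if c = b then kap l m else 0)"
        by (rule distrib)
      also have "(if a = i \<and> c = j then 1 else 0) * (if c = l \<and> b = m then 1 else (0::complex))
          = (if c = j then (if a = i \<and> b = m \<and> j = l then 1 else 0) else 0)"
        by auto
      also have "(if a = i \<and> c = j then 1 else 0) * (if c = b then kap l m else 0)
          = (if c = b then kap l m * (if a = i \<and> b = j then 1 else 0) else 0)"
        by auto
      also have "(if c = a then kap i j else 0) * (if c = l \<and> b = m then 1 else 0)
          = (if c = a then kap i j * (if a = l \<and> b = m then 1 else 0) else 0)"
        by auto
      also have "(if c = a then kap i j else 0) * (if c = b then kap l m else 0)
          = (if c = a then (if a = b then kap i j * kap l m else 0) else 0)"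
        by auto
      finally show ?thesis .
    qed
    then show ?thesis
      unfolding matrix_matrix_mult_def vec_lambda_beta by (intro sum.cong refl)
  qed
  also have "\<dots> = (if a = i \<and> b = m \<and> j = l then 1 else 0) - kap i j * (if a = l \<and> b = m then 1 else 0)
        - kap l m * (if a = i \<and> b = j then 1 else 0) + kap i j * kap l m * (if a = b then 1 else 0)"
    unfolding sum.distrib sum_subtractf by simp
  finally show ?thesis .
qed

text \<open>The scalar parts of the \<open>h_i\<close> are central, so the brackets are those of the matrix units of \<open>gl\<close>;
  on the right the scalar parts occur only for \<open>i = m\<close> and \<open>j = l\<close>, where they cancel.\<close>

lemma lie_bracket_sl_unit:
  "lie_bracket (sl_unit i j) (sl_unit l m)
     = (if j = l then sl_unit i m else 0) - (if m = i then sl_unit l j else 0)"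
proof -
  have "sl_matrix (lie_bracket (sl_unit i j) (sl_unit l m)) $ a $ b
     = sl_matrix ((if j = l then sl_unit i m else 0) - (if m = i then sl_unit l j else 0)) $ a $ b" for a b
  proof -
    have cancel: "(p - k1 * q - k2 * r + k1 * k2 * d) - (p' - k2 * r - k1 * q + k2 * k1 * d) = p - p'"
      for p p' k1 k2 q r d :: complex by simp
    have "sl_matrix (lie_bracket (sl_unit i j) (sl_unit l m)) $ a $ b
      = (if a = i \<and> b = m \<and> j = l then 1 else 0) - (if a = l \<and> b = j \<and> m = i then 1 else 0)"
      unfolding lie_bracket_sl.rep_eq vector_minus_component sl_unit_mult_entry cancel ..
    then show ?thesis
      unfolding minus_sl.rep_eq vector_minus_component
      by (cases "j = l"; cases "m = i") (simp_all add: sl_unit_entry zero_sl.rep_eq)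
  qed
  then show ?thesis
    by (simp add: sl_matrix_inject[symmetric] vec_eq_iff)
qed

lemma sl_matrix_sum: "sl_matrix (\<Sum>i\<in>I. F i) = (\<Sum>i\<in>I. sl_matrix (F i))"
  by (induction I rule: infinite_finite_induct) (simp_all add: zero_sl.rep_eq plus_sl.rep_eq)

lemma sl_expand:
  fixes A :: "'k::finite sl"
  shows "A = (\<Sum>i\<in>UNIV. \<Sum>j\<in>UNIV. (sl_matrix A $ i $ j) *\<^sub>C sl_unit i j)"
proof -
  have tr: "(\<Sum>i\<in>UNIV. sl_matrix A $ i $ i) = 0"
    using sl_matrix[of A] by (simp add: trace_def)
  have "sl_matrix A $ a $ b = sl_matrix (\<Sum>i\<in>UNIV. \<Sum>j\<in>UNIV. (sl_matrix A $ i $ j) *\<^sub>C sl_unit i j) $ a $ b" for a b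
  proof -
    have "sl_matrix (\<Sum>i\<in>UNIV. \<Sum>j\<in>UNIV. (sl_matrix A $ i $ j) *\<^sub>C sl_unit i j) $ a $ b
       = (\<Sum>i\<in>UNIV. \<Sum>j\<in>UNIV. (if j = b then (if i = a then sl_matrix A $ i $ j else 0) else 0)
              - (if j = i then (if a = b then sl_matrix A $ i $ i / of_nat CARD('k) else 0) else 0))"
      unfolding sl_matrix_sum sum_component scaleC_sl.rep_eq vec_lambda_beta sl_unit_entry
    proof (intro sum.cong refl)
      fix i j
      show "sl_matrix A $ i $ j * ((if a = i \<and> b = j then 1 else 0) - (if i = j \<and> a = b then 1 / of_nat CARD('k) else 0))
        = (if j = b then (if i = a then sl_matrix A $ i $ j else 0) else 0)
              - (if j = i then (if a = b then sl_matrix A $ i $ i / of_nat CARD('k) else 0) else 0)"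
        by (cases "j = i"; cases "a = b"; cases "i = a"; cases "j = b") (simp_all add: right_diff_distrib)
    qed
    also have "\<dots> = sl_matrix A $ a $ b
        - (if a = b then (\<Sum>i\<in>UNIV. sl_matrix A $ i $ i) / of_nat CARD('k) else 0)"
      unfolding sum_subtractf by (simp add: sum_divide_distrib)
    finally show ?thesis
      by (simp add: tr)
  qed
  then show ?thesis
    unfolding sl_matrix_inject[symmetric] vec_eq_iff by (intro allI)
qed

lemma sum_sl_unit_diag: "(\<Sum>i\<in>UNIV. sl_unit i i) = (0 :: 'k::finite sl)"
proof -
  have "sl_matrix (\<Sum>i\<in>UNIV. sl_unit i i) $ a $ b = 0" for a b :: 'k
  proof -
    have "sl_matrix (\<Sum>i\<in>UNIV. sl_unit i i) $ a $ b
       = (\<Sum>i\<in>UNIV. (if i = a then (if a = b then 1 else 0) else 0)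
              - (if a = b then 1 / of_nat CARD('k) else 0))"
      unfolding sl_matrix_sum sum_component sl_unit_entry
    proof (intro sum.cong refl)
      fix i
      show "(if a = i \<and> b = i then 1 else 0) - (if i = i \<and> a = b then 1 / of_nat CARD('k) else 0)
        = (if i = a then (if a = b then 1 else 0) else 0) - (if a = b then 1 / of_nat CARD('k) else (0::complex))"
        by (cases "a = b"; cases "i = a") simp_all
    qed
    then show ?thesis by (simp add: sum_subtractf)
  qed
  then show ?thesis
    by (simp add: sl_matrix_inject[symmetric] vec_eq_iff zero_sl.rep_eq)
qed

section \<open>The localization and its commutation relations\<close>

locale ore_localization =
  fixes \<phi> :: "'n::finite option sl uea \<Rightarrow> 'q::complex_algebra_1"
  assumes loc: "is_localization ore_set \<phi>"
begin

lemma hom_add: "\<phi> (u + v) = \<phi> u + \<phi> v"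
  and hom_mult: "\<phi> (u * v) = \<phi> u * \<phi> v"
  and hom_scaleC: "\<phi> (c *\<^sub>C u) = c *\<^sub>C \<phi> u"
  and hom_one: "\<phi> 1 = 1"
  using loc unfolding is_localization_def algebra_hom_def by blast+

lemma hom_zero: "\<phi> 0 = 0"
  using hom_add[of 0 0] by simp

lemma hom_uminus: "\<phi> (- u) = - \<phi> u"
  using hom_add[of u "- u"] by (simp add: hom_zero add_eq_0_iff)

lemma hom_diff: "\<phi> (u - v) = \<phi> u - \<phi> v"
  using hom_add[of u "- v"] by (simp add: hom_uminus)

lemma hom_sum: "\<phi> (\<Sum>i\<in>I. F i) = (\<Sum>i\<in>I. \<phi> (F i))"
  by (induction I rule: infinite_finite_induct) (simp_all add: hom_zero hom_add)

lemma hom_power: "\<phi> (u ^ m) = \<phi> u ^ m"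
  by (induction m) (simp_all add: hom_one hom_mult)

lemma hom_prod_list: "\<phi> (prod_list (map F xs)) = prod_list (map (\<lambda>x. \<phi> (F x)) xs)"
  by (induction xs) (simp_all add: hom_one hom_mult)

lemma hom_eq_0D: "\<phi> u = 0 \<Longrightarrow> \<exists>s\<in>ore_set. s * u = 0"
  and hom_ore_invertible: "s \<in> ore_set \<Longrightarrow> invertible_elt (\<phi> s)"
  and fraction: "\<exists>s\<in>ore_set. \<exists>r. q = inv_elt (\<phi> s) * \<phi> r"
  using loc unfolding is_localization_def by blast+

abbreviation E :: "'n option \<Rightarrow> 'n option \<Rightarrow> 'q" where "E \<equiv> e_elt \<phi>"
abbreviation e :: "'n \<Rightarrow> 'q" where "e k \<equiv> E None (Some k)"
abbreviation e_inv :: "'n \<Rightarrow> 'q" where "e_inv k \<equiv> inv_elt (e k)"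
abbreviation g :: "'n \<Rightarrow> 'n \<Rightarrow> 'q" where "g i j \<equiv> E (Some i) (Some j)"
abbreviation h :: "'n \<Rightarrow> 'q" where "h i \<equiv> g i i"
abbreviation f :: "'n \<Rightarrow> 'q" where "f k \<equiv> E (Some k) None"
abbreviation x :: "'n \<Rightarrow> 'n \<Rightarrow> 'q" where "x \<equiv> x_elt \<phi>"
abbreviation W :: "'q set" where "W \<equiv> W_alg \<phi>"
abbreviation B :: "'q set" where "B \<equiv> B_alg \<phi>"
abbreviation \<omega> :: "'n \<Rightarrow> 'q" where "\<omega> \<equiv> omega_elt \<phi>"

lemma E_eq: "E i j = \<phi> (uea_of (sl_unit i j))"
  by (simp add: e_elt_def emb_def)

lemma commutator_E: "commutator (E i j) (E l m) = (if j = l then E i m else 0) - (if m = i then E l j else 0)"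
proof -
  have zero: "\<phi> (uea_of 0) = 0"
    using uea_of_add[of "0 :: 'n option sl" 0] by (simp add: hom_zero)
  have diff: "\<phi> (uea_of (A - B)) = \<phi> (uea_of A) - \<phi> (uea_of B)" for A B
    using uea_of_add[of "A - B" B] hom_add[of "uea_of (A - B)" "uea_of B"] by (simp add: algebra_simps)
  have "commutator (E i j) (E l m) = \<phi> (uea_of (lie_bracket (sl_unit i j) (sl_unit l m)))"
    by (simp add: E_eq commutator_def uea_of_bracket hom_diff hom_mult)
  then show ?thesis
    unfolding lie_bracket_sl_unit diff by (auto simp: E_eq zero)
qed

lemma emb_zero: "emb \<phi> 0 = 0"
  using uea_of_add[of "0 :: 'n option sl" 0] by (simp add: hom_zero emb_def)

lemma emb_sum: "emb \<phi> (\<Sum>i\<in>I. c i *\<^sub>C A i) = (\<Sum>i\<in>I. c i *\<^sub>C emb \<phi> (A i))"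
proof -
  show ?thesis
    by (induction I rule: infinite_finite_induct)
       (simp_all add: emb_zero, simp_all add: emb_def uea_of_add uea_of_scaleC hom_add hom_scaleC)
qed

lemma emb_expand: "emb \<phi> A = (\<Sum>i\<in>UNIV. \<Sum>j\<in>UNIV. (sl_matrix A $ i $ j) *\<^sub>C E i j)"
proof -
  have "emb \<phi> A = emb \<phi> (\<Sum>i\<in>UNIV. 1 *\<^sub>C (\<Sum>j\<in>UNIV. (sl_matrix A $ i $ j) *\<^sub>C sl_unit i j))"
    using sl_expand[of A] by (simp add: scaleC_one)
  then show ?thesis
    unfolding emb_sum e_elt_def by (simp add: scaleC_one)
qed

lemma E_None_None: "E None None = - (\<Sum>i\<in>UNIV. h i)"
proof -
  have "(\<Sum>i\<in>UNIV. E i i) = emb \<phi> (\<Sum>i\<in>UNIV. 1 *\<^sub>C sl_unit i i)"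
    unfolding emb_sum by (simp add: e_elt_def)
  also have "\<dots> = 0"
    by (simp add: sum_sl_unit_diag emb_zero)
  finally show ?thesis
    by (simp add: sum_option eq_neg_iff_add_eq_0)
qed

lemma e_in_ore_set: "uea_of (sl_unit None (Some (k::'n))) \<in> ore_set"
proof -
  obtain ks :: "'n list" where ks: "set ks = UNIV" "distinct ks"
    using finite_distinct_list[OF finite_class.finite_UNIV] by blast
  let ?F = "\<lambda>j. uea_of (sl_unit None (Some j)) ^ (if j = k then 1 else 0)"
  have "prod_list (map ?F js) = (if k \<in> set js then uea_of (sl_unit None (Some k)) else 1)"
    if "distinct js" for js
    using that by (induction js) auto
  from this[OF ks(2)] have "prod_list (map ?F ks) = uea_of (sl_unit None (Some k))"
    using ks by simp
  then show ?thesis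
    unfolding ore_set_def using ks by (intro CollectI exI[of _ "\<lambda>j. if j = k then 1 else 0"] exI[of _ ks]) simp
qed

lemma e_inverse [simp]: "e k * e_inv k = 1" "e_inv k * e k = 1"
  using inv_elt_inverse[OF hom_ore_invertible[OF e_in_ore_set[of k]]] by (simp_all add: E_eq)

lemma e_cancel [simp]: "e k * (e_inv k * a) = a" "e_inv k * (e k * a) = a"
  by (simp_all add: mult.assoc[symmetric])

lemma e_e: "e j * e k = e k * e j"
  using commutator_E[of None "Some j" None "Some k"] by (simp add: commutator_def)

lemma commute_e_inv: "z * e k = e k * z \<Longrightarrow> z * e_inv k = e_inv k * z"
  by (rule commute_inverse[of _ "e k"]) simp_all

lemma e_e_inv: "e j * e_inv k = e_inv k * e j"
  by (rule commute_e_inv) (rule e_e)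

lemma e_inv_e_inv: "e_inv j * e_inv k = e_inv k * e_inv j"
  by (rule commute_e_inv) (rule e_e_inv[symmetric])

lemma e_h: "e k * h j = h j * e k + (if j = k then e k else 0)"
  using commutator_E[of None "Some k" "Some j" "Some j"] by (auto simp: commutator_def algebra_simps)

definition weight :: "'n \<Rightarrow> complex \<Rightarrow> 'q \<Rightarrow> bool" where
  "weight l c a \<longleftrightarrow> commutator (h l) a = c *\<^sub>C a"

lemma weight_mult: "weight l c a \<Longrightarrow> weight l d b \<Longrightarrow> weight l (c + d) (a * b)"
  by (simp add: weight_def commutator_mult_right mult_scaleC scaleC_add_left)

lemma weight_add: "weight l c a \<Longrightarrow> weight l c b \<Longrightarrow> weight l c (a + b)"
  and weight_diff: "weight l c a \<Longrightarrow> weight l c b \<Longrightarrow> weight l c (a - b)"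
  by (simp_all add: weight_def commutator_add_right commutator_diff_right scaleC_add_right
      complex_vector.scale_right_diff_distrib)

lemma weight_sum: "(\<And>i. i \<in> I \<Longrightarrow> weight l c (F i)) \<Longrightarrow> weight l c (\<Sum>i\<in>I. F i)"
  by (simp add: weight_def commutator_sum_right complex_vector.scale_sum_right)

lemma weight_one: "weight l 0 1"
  by (simp add: weight_def)

lemma weight_E: "weight l (of_bool (i = Some l) - of_bool (j = Some l)) (E i j)"
  using commutator_E[of "Some l" "Some l" i j]
  by (auto simp: weight_def complex_vector.scale_minus_left scaleC_one)

lemma weight_inverse:
  assumes "weight l c a" "a * b = 1" "b * a = 1" shows "weight l (- c) b"
proof -
  have "a * commutator (h l) b = commutator (h l) (a * b) - commutator (h l) a * b"
    by (simp only: commutator_mult_right) simp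
  also have "\<dots> = - (c *\<^sub>C 1)"
    using assms by (simp add: weight_def mult_scaleC_left)
  finally have "b * (a * commutator (h l) b) = b * - (c *\<^sub>C 1)" by simp
  then show ?thesis
    using assms(3)
    by (simp add: weight_def mult.assoc[symmetric] mult_scaleC_right complex_vector.scale_minus_left)
qed

lemma weight_e_inv: "weight l (of_bool (k = l)) (e_inv k)"
  using weight_inverse[OF weight_E[of l None "Some k"], of "e_inv k"] by simp

lemma weight_x: "weight l 0 (x i j)"
proof -
  have "weight l ((of_bool (i = l) - of_bool (j = l)) + (0 - of_bool (i = l)) + of_bool (j = l))
     (g i j * e i * e_inv j)"
    using weight_mult[OF weight_mult[OF weight_E[of l "Some i" "Some j"] weight_E[of l None "Some i"]] weight_e_inv[of l j]]
    by simp
  then have "weight l 0 (g i j * e i * e_inv j)" by simp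
  moreover have "weight l 0 (h i)"
    using weight_E[of l "Some i" "Some i"] by simp
  ultimately show ?thesis
    unfolding x_elt_def by (rule weight_diff)
qed

lemma weight_omega: "weight l 0 (\<omega> k)"
proof -
  have "weight l 0 (f k * e k)"
    using weight_mult[OF weight_E[of l "Some k" None] weight_E[of l None "Some k"]] by simp
  moreover have "weight l 0 (g k j * (h j - 1) * e k * e_inv j)" for j
  proof -
    have h: "weight l 0 (h j - 1)"
      using weight_diff[OF _ weight_one] weight_E[of l "Some j" "Some j"] by simp
    have "weight l ((of_bool (k = l) - of_bool (j = l)) + 0 + (0 - of_bool (k = l)) + of_bool (j = l))
      (g k j * (h j - 1) * e k * e_inv j)"
      using weight_mult[OF weight_mult[OF weight_mult[OF weight_E[of l "Some k" "Some j"] h]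
             weight_E[of l None "Some k"]] weight_e_inv[of l j]]
      by simp
    then show ?thesis by simp
  qed
  ultimately show ?thesis
    unfolding omega_elt_def by (intro weight_add weight_sum)
qed

lemma commutator_e_x: "commutator (e l) (x i j) = 0"
proof -
  have g: "commutator (e l) (g i j) = (if l = i then e j else 0)"
    using commutator_E[of None "Some l" "Some i" "Some j"] by simp
  have h: "commutator (e l) (h i) = (if l = i then e i else 0)"
    using commutator_E[of None "Some l" "Some i" "Some i"] by simp
  have e: "commutator (e l) (e i) = 0" "commutator (e l) (e_inv j) = 0"
    using e_e[of l i] e_e_inv[of l j] by (simp_all add: commutator_def)
  have "e j * (e i * e_inv j) = e i"
    by (simp add: e_e_inv)
  then show ?thesis
    unfolding x_elt_def commutator_diff_right commutator_mult_right g h e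
    by (simp add: mult.assoc)
qed

text \<open>For \<open>l \<noteq> k\<close> the derivation \<open>[e_l, _]\<close> sends the first summand of \<open>\<omega>_k\<close> to \<open>- e_kl e_k\<close>, and the sum to
  \<open>e_kl e_k\<close> through \<open>h_l\<close>. For \<open>l = k\<close> there are the additional terms \<open>e_00 e_k\<close> and \<open>\<Sum>_j h_j e_k\<close>, where the shift
  in \<open>h_j - 1\<close> is absorbed by moving \<open>e_j\<close> past it; they cancel because the trace vanishes.\<close>

lemma commutator_e_omega: "commutator (e l) (\<omega> k) = 0"
proof -
  have g: "commutator (e l) (g i j) = (if l = i then e j else 0)" for i j
    using commutator_E[of None "Some l" "Some i" "Some j"] by simp
  have e: "commutator (e l) (e i) = 0" "commutator (e l) (e_inv j) = 0" for i j
    using e_e[of l i] e_e_inv[of l j] by (simp_all add: commutator_def)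
  have f: "commutator (e l) (f k) = (if l = k then E None None else 0) - g k l"
    using commutator_E[of None "Some l" "Some k" None] by simp
  have ej: "e j * (e k * e_inv j) = e k" for j
    by (simp add: e_e_inv)
  have "e j * (h j - 1) * e k * e_inv j = h j * e k" for j
  proof -
    have "e j * (h j - 1) = h j * e j"
      using e_h[of j j] by (simp add: right_diff_distrib)
    then show ?thesis by (simp add: mult.assoc ej)
  qed
  moreover have "commutator (e l) (g k j * (h j - 1) * e k * e_inv j)
      = (if l = k then e j * (h j - 1) * e k * e_inv j else 0) + (if j = l then g k j * (e j * (e k * e_inv j)) else 0)" for j
    unfolding commutator_mult_right commutator_diff_right g e by (simp add: mult.assoc distrib_right)
  ultimately have "commutator (e l) (g k j * (h j - 1) * e k * e_inv j)
      = (if l = k then h j * e k else 0) + (if j = l then g k l * e k else 0)" for j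
    by (auto simp: ej)
  then have "commutator (e l) (\<Sum>j\<in>UNIV. g k j * (h j - 1) * e k * e_inv j)
      = (if l = k then (\<Sum>j\<in>UNIV. h j) * e k else 0) + g k l * e k"
    unfolding commutator_sum_right by (simp add: sum.distrib sum_distrib_right)
  moreover have "commutator (e l) (f k * e k) = (if l = k then E None None * e k else 0) - g k l * e k"
    unfolding commutator_mult_right f e by (simp add: left_diff_distrib)
  ultimately show ?thesis
    unfolding omega_elt_def commutator_add_right by (simp add: E_None_None)
qed

text \<open>The diagonal traceless matrices are spanned by the \<open>h_i\<close> with \<open>i \<ge> 1\<close>, as \<open>h_0 = - \<Sum>_i h_i\<close>.\<close>

lemma W_alg_iff: "u \<in> W \<longleftrightarrow> (\<forall>k. commutator (e k) u = 0) \<and> (\<forall>k. commutator (h k) u = 0)"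
proof
  assume u: "u \<in> W"
  have "sl_unit None (Some k) \<in> nil_m" for k
    unfolding nil_m_def by (rule complex_vector.span_base) simp
  moreover have "sl_unit (Some k) (Some k) \<in> cartan" for k
    unfolding cartan_def by (auto simp: sl_unit_entry)
  ultimately show "(\<forall>k. commutator (e k) u = 0) \<and> (\<forall>k. commutator (h k) u = 0)"
    using u unfolding W_alg_def by (auto simp: e_elt_def commutator_def)
next
  assume u: "(\<forall>k. commutator (e k) u = 0) \<and> (\<forall>k. commutator (h k) u = 0)"
  have sum_left: "commutator (\<Sum>i\<in>I. c i *\<^sub>C F i) u = (\<Sum>i\<in>I. c i *\<^sub>C commutator (F i) u)"
    for I :: "'i set" and c F
    by (simp add: commutator_sum_left commutator_scaleC_left)
  have "commutator (E None None) u = - commutator (\<Sum>i\<in>UNIV. 1 *\<^sub>C h i) u"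
    by (simp add: E_None_None commutator_def algebra_simps scaleC_one)
  also have "\<dots> = 0" unfolding sum_left using u by simp
  finally have diag: "commutator (E i i) u = 0" for i
    using u by (cases i) auto
  have "commutator (emb \<phi> H) u = 0" if "H \<in> cartan" for H
  proof -
    have "commutator (emb \<phi> H) u = (\<Sum>i\<in>UNIV. \<Sum>j\<in>UNIV. (sl_matrix H $ i $ j) *\<^sub>C commutator (E i j) u)"
      unfolding emb_expand[of H] commutator_sum_left commutator_scaleC_left ..
    also have "\<dots> = 0"
    proof (intro sum.neutral ballI)
      fix i j
      show "(sl_matrix H $ i $ j) *\<^sub>C commutator (E i j) u = 0"
        using that by (cases "i = j") (auto simp: diag cartan_def)
    qed
    finally show ?thesis .
  qed
  moreover have "commutator (emb \<phi> A) u = 0" if A: "A \<in> nil_m" for A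
  proof -
    obtain t r where "A = (\<Sum>a\<in>t. r a *\<^sub>C a)" "t \<subseteq> range (\<lambda>i. sl_unit None (Some i))"
      using A unfolding nil_m_def complex_vector.span_explicit by auto
    moreover from this(2) have "commutator (emb \<phi> a) u = 0" if "a \<in> t" for a
      using u that by (auto simp: e_elt_def)
    ultimately show ?thesis
      by (simp add: emb_sum sum_left)
  qed
  ultimately show "u \<in> W"
    unfolding W_alg_def by (simp add: commutator_def)
qed

lemma gen_val_in_W: "gen_val \<phi> a \<in> W"
  using weight_x weight_omega commutator_e_x commutator_e_omega
  by (cases a) (auto simp: W_alg_iff weight_def)

end

section \<open>A basis of monomials for the subalgebra B\<close>

text \<open>A product of factors indexed by \<open>ks\<close> depends on the factor \<open>k\<close> through \<open>A \<mapsto> L A R\<close>, where \<open>L\<close> and \<open>R\<close>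
  commute with everything that commutes with the other factors. This reduces computations with
  monomials in several commuting pairs of variables to a single pair.\<close>

lemma prod_list_split:
  fixes F :: "'i \<Rightarrow> 'a::monoid_mult"
  assumes "distinct ks" "k \<in> set ks"
  obtains L R where "\<And>A. prod_list (map (F(k := A)) ks) = L * A * R"
    and "\<And>z. (\<And>j. j \<noteq> k \<Longrightarrow> z * F j = F j * z) \<Longrightarrow> z * L = L * z \<and> z * R = R * z"
proof -
  obtain us vs where ks: "ks = us @ k # vs" using split_list[OF assms(2)] by blast
  then have nk: "k \<notin> set us" "k \<notin> set vs" using assms(1) by auto
  show thesis
  proof (rule that[of "prod_list (map F us)" "prod_list (map F vs)"])
    fix A
    have "map (F(k := A)) us = map F us" "map (F(k := A)) vs = map F vs"
      using nk by auto
    then show "prod_list (map (F(k := A)) ks) = prod_list (map F us) * A * prod_list (map F vs)"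
      unfolding ks map_append list.map prod_list.append prod_list.Cons by (simp only: fun_upd_same mult.assoc)
  next
    fix z assume z: "\<And>j. j \<noteq> k \<Longrightarrow> z * F j = F j * z"
    have "z * F j = F j * z" if "j \<in> set us \<union> set vs" for j
      using z[of j] nk that by blast
    then show "z * prod_list (map F us) = prod_list (map F us) * z \<and> z * prod_list (map F vs) = prod_list (map F vs) * z"
      by (intro conjI commute_prod_list) auto
  qed
qed

text \<open>Products over the index set are taken in a noncommutative ring and need a fixed order.\<close>

definition enumeration :: "'n::finite list" where
  "enumeration = (SOME ks. distinct ks \<and> set ks = UNIV)"

lemma enumeration: "distinct (enumeration :: 'n::finite list)" "set (enumeration :: 'n list) = UNIV"
proof -
  have "\<exists>ks :: 'n list. distinct ks \<and> set ks = UNIV"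
    using finite_distinct_list[OF finite_class.finite_UNIV] by blast
  from someI_ex[OF this] show "distinct (enumeration :: 'n list)" "set (enumeration :: 'n list) = UNIV"
    unfolding enumeration_def by blast+
qed

context ore_localization
begin

abbreviation ks :: "'n list" where "ks \<equiv> enumeration"

lemmas ks = enumeration[where 'n = 'n]

definition epow :: "'n \<Rightarrow> int \<Rightarrow> 'q" where
  "epow k a = (if a \<ge> 0 then e k ^ nat a else e_inv k ^ nat (- a))"

text \<open>The partner of \<open>e_k\<close> in a Weyl pair: \<open>[e_k, y_k] = 1\<close>. In terms of \<open>y_k\<close> instead of \<open>h_k\<close>, commuting with
  \<open>e_k\<close> acts on monomials as a derivative and not as a difference.\<close>

definition y :: "'n \<Rightarrow> 'q" where
  "y k = h k * e_inv k"

lemma epow_0 [simp]: "epow k 0 = 1"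
  by (simp add: epow_def)

lemma e_epow: "e k * epow k a = epow k (a + 1)"
proof (cases "a \<ge> 0")
  case True
  then have "nat (a + 1) = Suc (nat a)" by simp
  with True show ?thesis by (simp add: epow_def)
next
  case False
  define m where "m = nat (- (a + 1))"
  have m: "nat (- a) = Suc m" "nat (- (a + 1)) = m"
    using False unfolding m_def by arith+
  with False show ?thesis by (cases "a = - 1") (simp_all add: epow_def)
qed

lemma e_inv_epow: "e_inv k * epow k a = epow k (a - 1)"
  using e_epow[of k "a - 1"] e_cancel(2)[of k "epow k (a - 1)"] by simp

lemma epow_commute: "z * e k = e k * z \<Longrightarrow> z * epow k a = epow k a * z"
  by (simp add: epow_def commute_power commute_e_inv)

lemma commutator_e_y: "commutator (e j) (y k) = (if j = k then 1 else 0)"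
proof -
  have "commutator (e j) (h k) = (if j = k then e k else 0)"
    using commutator_E[of None "Some j" "Some k" "Some k"] by simp
  moreover have "commutator (e j) (e_inv k) = 0"
    using e_e_inv[of j k] by (simp add: commutator_def)
  ultimately show ?thesis
    unfolding y_def commutator_mult_right by simp
qed

lemma e_y_commute: "j \<noteq> k \<Longrightarrow> y k * e j = e j * y k"
  using commutator_e_y[of j k] by (simp add: commutator_def)

lemma weight_y: "weight l (of_bool (k = l)) (y k)"
  using weight_mult[OF weight_E[of l "Some k" "Some k"] weight_e_inv[of l k]] by (simp add: y_def)

lemma y_commute: "y j * y k = y k * y j"
proof (cases "j = k")
  case False
  have "commutator (h j) (y k) = 0"
    using weight_y[of j k] False by (simp add: weight_def)
  moreover have "commutator (e_inv j) (y k) = 0"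
    using commute_e_inv[OF e_y_commute[OF False]] by (simp add: commutator_def)
  ultimately have "commutator (y j) (y k) = 0"
    unfolding y_def[of j] commutator_mult_left by simp
  then show ?thesis by (simp add: commutator_eq_0_iff)
qed simp

lemma h_eq: "h k = y k * e k"
  by (simp add: y_def mult.assoc)

definition bmon :: "'n \<Rightarrow> int \<Rightarrow> nat \<Rightarrow> 'q" where
  "bmon k a b = epow k a * y k ^ b"

lemma e_bmon: "e k * bmon k a b = bmon k (a + 1) b"
  by (simp add: bmon_def e_epow mult.assoc[symmetric])

lemma e_inv_bmon: "e_inv k * bmon k a b = bmon k (a - 1) b"
  by (simp add: bmon_def e_inv_epow mult.assoc[symmetric])

text \<open>\<open>[_, y_k]\<close> is the derivative with respect to \<open>e_k\<close>. Induction goes in both directions from \<open>a = 0\<close>;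
  the downward step uses \<open>[e_k^-1, y_k] = - e_k^-2\<close>.\<close>

lemma commutator_epow_y: "commutator (epow k a) (y k) = of_int a *\<^sub>C epow k (a - 1)"
proof (induction a rule: int_induct[where k = 0])
  case base
  then show ?case by simp
next
  case (step1 a)
  have "commutator (epow k (a + 1)) (y k) = commutator (e k * epow k a) (y k)"
    by (simp add: e_epow)
  also have "\<dots> = of_int a *\<^sub>C (e k * epow k (a - 1)) + epow k a"
    unfolding commutator_mult_left step1.IH commutator_e_y by (simp add: mult_scaleC_right)
  also have "\<dots> = of_int (a + 1) *\<^sub>C epow k a"
    by (simp add: e_epow scaleC_add_left scaleC_one)
  finally show ?case by simp
next
  case (step2 a)
  have "0 = commutator (e_inv k * e k) (y k)" by simp
  also have "\<dots> = e_inv k + commutator (e_inv k) (y k) * e k"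
    unfolding commutator_mult_left commutator_e_y by simp
  finally have "commutator (e_inv k) (y k) * e k = - e_inv k"
    by (simp add: eq_neg_iff_add_eq_0 add.commute)
  then have "commutator (e_inv k) (y k) * e k * e_inv k = - e_inv k * e_inv k"
    by simp
  then have inv: "commutator (e_inv k) (y k) = - (e_inv k * e_inv k)"
    by (simp add: mult.assoc)
  have "commutator (epow k (a - 1)) (y k) = commutator (e_inv k * epow k a) (y k)"
    by (simp add: e_inv_epow)
  also have "\<dots> = of_int a *\<^sub>C (e_inv k * epow k (a - 1)) - e_inv k * (e_inv k * epow k a)"
    unfolding commutator_mult_left step2.IH inv by (simp add: mult_scaleC_right mult.assoc)
  also have "\<dots> = of_int (a - 1) *\<^sub>C epow k (a - 1 - 1)"
    by (simp add: e_inv_epow complex_vector.scale_left_diff_distrib scaleC_one)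
  finally show ?case .
qed

lemma y_bmon: "y k * bmon k a b = bmon k a (Suc b) - of_int a *\<^sub>C bmon k (a - 1) b"
proof -
  have "y k * epow k a = epow k a * y k - of_int a *\<^sub>C epow k (a - 1)"
    using commutator_epow_y[of k a] by (simp add: commutator_def algebra_simps)
  then have "y k * epow k a * y k ^ b = epow k a * (y k * y k ^ b) - of_int a *\<^sub>C (epow k (a - 1) * y k ^ b)"
    by (simp add: left_diff_distrib mult.assoc mult_scaleC_left)
  then show ?thesis by (simp add: bmon_def mult.assoc)
qed

lemma commutator_e_bmon: "commutator (e k) (bmon k a b) = of_nat b *\<^sub>C bmon k a (b - 1)"
proof -
  have "commutator (e k) (y k ^ b) = of_nat b *\<^sub>C y k ^ (b - 1)"
  proof (induction b)
    case (Suc b)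
    have "y k * y k ^ (b - 1) = y k ^ b" if "b \<noteq> 0"
      using that by (cases b) simp_all
    then have "of_nat b *\<^sub>C (y k * y k ^ (b - 1)) = of_nat b *\<^sub>C y k ^ b"
      by (cases "b = 0") simp_all
    with Suc show ?case
      by (simp add: commutator_mult_right commutator_e_y mult_scaleC_right scaleC_add_left scaleC_one)
  qed simp
  moreover have "commutator (e k) (epow k a) = 0"
    using epow_commute[of "e k" k a] by (simp add: commutator_def)
  ultimately show ?thesis
    unfolding bmon_def commutator_mult_right by (simp add: mult_scaleC_right)
qed

lemma weight_power: "weight l c a \<Longrightarrow> weight l (of_nat m * c) (a ^ m)"
  by (induction m) (auto simp: weight_one distrib_right dest: weight_mult)

lemma weight_bmon: "weight l (of_bool (k = l) * (of_nat b - of_int a)) (bmon k a b)"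
proof -
  have "weight l (- of_bool (k = l)) (e k)"
    using weight_E[of l None "Some k"] by simp
  then have "weight l (- (of_bool (k = l) * of_int a)) (epow k a)"
    using weight_power[of l _ "e k" "nat a"] weight_power[OF weight_e_inv[of l k], of "nat (- a)"]
    by (cases "a \<ge> 0") (fastforce simp: epow_def mult.commute)+
  from weight_mult[OF this weight_power[OF weight_y[of l k]]] show ?thesis
    by (simp add: bmon_def algebra_simps)
qed

lemma bmon_commute: "z * e k = e k * z \<Longrightarrow> z * y k = y k * z \<Longrightarrow> z * bmon k a b = bmon k a b * z"
proof -
  assume z: "z * e k = e k * z" "z * y k = y k * z"
  have "z * (epow k a * y k ^ b) = epow k a * (z * y k ^ b)"
    using epow_commute[OF z(1), of a] by (simp only: mult.assoc[symmetric])
  then show ?thesis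
    using commute_power[OF z(2), of b] by (simp add: bmon_def mult.assoc)
qed

definition Bmon :: "('n \<Rightarrow> int) \<Rightarrow> ('n \<Rightarrow> nat) \<Rightarrow> 'q" where
  "Bmon \<alpha> \<beta> = prod_list (map (\<lambda>k. bmon k (\<alpha> k) (\<beta> k)) ks)"

lemma Bmon_split:
  obtains L R where "\<And>a b. Bmon (\<alpha>(k := a)) (\<beta>(k := b)) = L * bmon k a b * R"
    and "e k * L = L * e k" "e_inv k * L = L * e_inv k" "y k * L = L * y k" "e k * R = R * e k"
proof -
  obtain L R where LR: "\<And>A. prod_list (map ((\<lambda>k. bmon k (\<alpha> k) (\<beta> k))(k := A)) ks) = L * A * R"
     "\<And>z. (\<And>j. j \<noteq> k \<Longrightarrow> z * bmon j (\<alpha> j) (\<beta> j) = bmon j (\<alpha> j) (\<beta> j) * z) \<Longrightarrow> z * L = L * z \<and> z * R = R * z"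
    using prod_list_split[OF ks(1), of k "\<lambda>k. bmon k (\<alpha> k) (\<beta> k)"] ks(2) by auto
  have upd: "(\<lambda>j. bmon j ((\<alpha>(k := a)) j) ((\<beta>(k := b)) j)) = (\<lambda>k. bmon k (\<alpha> k) (\<beta> k))(k := bmon k a b)" for a b
    by auto
  show thesis
  proof (rule that)
    show "Bmon (\<alpha>(k := a)) (\<beta>(k := b)) = L * bmon k a b * R" for a b
      unfolding Bmon_def upd by (rule LR(1))
    have "e k * L = L * e k \<and> e k * R = R * e k"
      by (intro LR(2) bmon_commute) (simp_all add: e_e e_y_commute)
    then show "e k * L = L * e k" "e k * R = R * e k" by simp_all
    have "e_inv k * L = L * e_inv k \<and> e_inv k * R = R * e_inv k"
      by (intro LR(2) bmon_commute) (simp_all add: e_e_inv commute_e_inv[OF e_y_commute])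
    then show "e_inv k * L = L * e_inv k" by simp
    have "y k * L = L * y k \<and> y k * R = R * y k"
      by (intro LR(2) bmon_commute) (auto simp: y_commute e_y_commute)
    then show "y k * L = L * y k" by simp
  qed
qed

lemma move_left: "z * L = L * z \<Longrightarrow> z * (L * a * R) = L * (z * a) * (R::'q)"
  by (simp only: mult.assoc[symmetric])

lemma e_Bmon: "e k * Bmon \<alpha> \<beta> = Bmon (\<alpha>(k := \<alpha> k + 1)) \<beta>"
proof -
  obtain L R where *: "\<And>a b. Bmon (\<alpha>(k := a)) (\<beta>(k := b)) = L * bmon k a b * R" "e k * L = L * e k"
    using Bmon_split[of \<alpha> k \<beta>] by metis
  show ?thesis
    using *(1)[of "\<alpha> k" "\<beta> k"] *(1)[of "\<alpha> k + 1" "\<beta> k"] move_left[OF *(2)] by (simp add: e_bmon)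
qed

lemma e_inv_Bmon: "e_inv k * Bmon \<alpha> \<beta> = Bmon (\<alpha>(k := \<alpha> k - 1)) \<beta>"
proof -
  obtain L R where *: "\<And>a b. Bmon (\<alpha>(k := a)) (\<beta>(k := b)) = L * bmon k a b * R" "e_inv k * L = L * e_inv k"
    using Bmon_split[of \<alpha> k \<beta>] by metis
  show ?thesis
    using *(1)[of "\<alpha> k" "\<beta> k"] *(1)[of "\<alpha> k - 1" "\<beta> k"] move_left[OF *(2)] by (simp add: e_inv_bmon)
qed

lemma y_Bmon: "y k * Bmon \<alpha> \<beta> = Bmon \<alpha> (\<beta>(k := Suc (\<beta> k)))
     - of_int (\<alpha> k) *\<^sub>C Bmon (\<alpha>(k := \<alpha> k - 1)) \<beta>"
proof -
  obtain L R where *: "\<And>a b. Bmon (\<alpha>(k := a)) (\<beta>(k := b)) = L * bmon k a b * R" "y k * L = L * y k"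
    using Bmon_split[of \<alpha> k \<beta>] by metis
  show ?thesis
    using *(1)[of "\<alpha> k" "\<beta> k"] *(1)[of "\<alpha> k - 1" "\<beta> k"] *(1)[of "\<alpha> k" "Suc (\<beta> k)"] move_left[OF *(2)]
    by (simp add: y_bmon left_diff_distrib right_diff_distrib mult_scaleC)
qed

lemma commutator_e_Bmon: "commutator (e k) (Bmon \<alpha> \<beta>) = of_nat (\<beta> k) *\<^sub>C Bmon \<alpha> (\<beta>(k := \<beta> k - 1))"
proof -
  obtain L R where *: "\<And>a b. Bmon (\<alpha>(k := a)) (\<beta>(k := b)) = L * bmon k a b * R" "e k * L = L * e k"
     "e k * R = R * e k"
    using Bmon_split[of \<alpha> k \<beta>] by metis
  have "commutator (e k) L = 0" "commutator (e k) R = 0"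
    using *(2,3) by (simp_all add: commutator_def)
  then have "commutator (e k) (L * A * R) = L * commutator (e k) A * R" for A
    by (simp add: commutator_mult_right)
  then show ?thesis
    using *(1)[of "\<alpha> k" "\<beta> k"] *(1)[of "\<alpha> k" "\<beta> k - 1"]
    by (simp add: commutator_e_bmon mult_scaleC)
qed

lemma weight_prod_list:
  "(\<And>z. z \<in> set zs \<Longrightarrow> weight l (c z) (F z)) \<Longrightarrow> weight l (sum_list (map c zs)) (prod_list (map F zs))"
  by (induction zs) (simp_all add: weight_one weight_mult)

lemma weight_Bmon: "weight l (of_nat (\<beta> l) - of_int (\<alpha> l)) (Bmon \<alpha> \<beta>)"
proof -
  have "weight l (sum_list (map (\<lambda>k. of_bool (k = l) * (of_nat (\<beta> k) - of_int (\<alpha> k))) ks)) (Bmon \<alpha> \<beta>)"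
    unfolding Bmon_def by (rule weight_prod_list) (rule weight_bmon)
  also have "sum_list (map (\<lambda>k. of_bool (k = l) * (of_nat (\<beta> k) - of_int (\<alpha> k))) ks)
     = (\<Sum>k\<in>UNIV. if k = l then of_nat (\<beta> k) - of_int (\<alpha> k) else (0::complex))"
    unfolding ks(2)[symmetric] sum.distinct_set_conv_list[OF ks(1)] by (intro arg_cong[of _ _ sum_list] map_cong) auto
  finally show ?thesis by simp
qed

lemma Bmon_0: "Bmon (\<lambda>_. 0) (\<lambda>_. 0) = 1"
proof -
  have "prod_list (map (\<lambda>k. bmon k 0 0) js) = 1" for js
    by (induction js) (simp_all add: bmon_def)
  then show ?thesis by (simp add: Bmon_def)
qed

lemma subalgebra_B: "subalgebra B"
  unfolding B_alg_def
  by (rule hull_in) (auto simp: subalgebra_def intro: complex_vector.subspace_Inter)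

lemma B_alg_gens: "h k \<in> B" "e k \<in> B" "e_inv k \<in> B"
  unfolding B_alg_def by (auto intro!: hull_inc)

lemma B_alg_one: "1 \<in> B"
  and B_alg_mult: "a \<in> B \<Longrightarrow> b \<in> B \<Longrightarrow> a * b \<in> B"
  and B_alg_subspace: "complex_vector.subspace B"
  using subalgebra_B unfolding subalgebra_def by blast+

lemma B_alg_power: "a \<in> B \<Longrightarrow> a ^ m \<in> B"
  by (induction m) (simp_all add: B_alg_one B_alg_mult)

lemma Bmon_in_B_alg: "Bmon \<alpha> \<beta> \<in> B"
proof -
  have "bmon k a b \<in> B" for k a b
    by (simp add: bmon_def epow_def y_def B_alg_mult B_alg_power B_alg_gens)
  then have "prod_list (map (\<lambda>k. bmon k (\<alpha> k) (\<beta> k)) js) \<in> B" for js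
    by (induction js) (simp_all add: B_alg_one B_alg_mult)
  then show ?thesis by (simp add: Bmon_def)
qed

text \<open>The span of the monomials is closed under left multiplication by \<open>e_k\<close>, \<open>e_k^-1\<close> and \<open>y_k\<close>, hence by
  \<open>h_k = y_k e_k\<close>. The elements with this closure property form a subalgebra, which contains \<open>B\<close>; as the
  span contains \<open>1\<close>, it contains \<open>B\<close> too.\<close>

lemma B_alg_eq_span: "B = cspan (range (\<lambda>(\<alpha>, \<beta>). Bmon \<alpha> \<beta>))" (is "_ = cspan ?S")
proof
  let ?T = "{b. \<forall>v\<in>cspan ?S. b * v \<in> cspan ?S}"
  have base: "Bmon \<alpha> \<beta> \<in> cspan ?S" for \<alpha> \<beta>
    by (rule complex_vector.span_base) auto
  have T: "b \<in> ?T" if b: "\<And>\<alpha> \<beta>. b * Bmon \<alpha> \<beta> \<in> cspan ?S" for b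
  proof -
    have "b * v \<in> cspan ?S" if "v \<in> cspan ?S" for v
      using that
    proof (induction rule: complex_vector.span_induct_alt)
      case base
      then show ?case by (simp add: complex_vector.span_zero)
    next
      case (step c z v)
      then show ?case
        using b by (auto simp: distrib_left mult_scaleC_right
            intro!: complex_vector.span_add complex_vector.span_scale)
    qed
    then show ?thesis by simp
  qed
  have subalg: "subalgebra ?T"
    unfolding subalgebra_def complex_vector.subspace_def
    by (auto simp: distrib_right mult_scaleC_left mult.assoc
        intro: complex_vector.span_add complex_vector.span_scale complex_vector.span_zero)
  have e: "e k \<in> ?T" and e_inv: "e_inv k \<in> ?T" and yT: "y k \<in> ?T" for k
    by (rule T, simp add: e_Bmon e_inv_Bmon y_Bmon base complex_vector.span_diff complex_vector.span_scale)+
  have "y k * e k \<in> ?T" for k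
    using subalg e yT unfolding subalgebra_def by blast
  then have "h k \<in> ?T" for k by (simp only: h_eq)
  with e e_inv have "B \<subseteq> ?T"
    unfolding B_alg_def by (intro hull_minimal subalg) blast
  moreover have "1 \<in> cspan ?S"
    using base[of "\<lambda>_. 0" "\<lambda>_. 0"] by (simp add: Bmon_0)
  ultimately show "B \<subseteq> cspan ?S"
    by force
next
  show "cspan ?S \<subseteq> B"
    using Bmon_in_B_alg by (intro complex_vector.span_minimal B_alg_subspace) auto
qed

section \<open>Symbols of fractions\<close>

definition e_product :: "'n list \<Rightarrow> 'n option sl uea" where
  "e_product js = prod_list (map (\<lambda>k. uea_of (sl_unit None (Some k))) js)"

definition eps :: "'n option pt \<Rightarrow> 'n list \<Rightarrow> complex" where
  "eps \<xi> js = prod_list (map (\<lambda>k. \<xi> None (Some k)) js)"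

abbreviation E_prod :: 'q where "E_prod \<equiv> \<phi> (e_product ks)"

lemma length_ks: "length ks = CARD('n)"
  using distinct_card[OF ks(1)] by (simp add: ks(2))

lemma length_remove: "int (length (remove1 k ks)) = int CARD('n) - 1"
proof -
  have "k \<in> set ks" using ks(2) by simp
  moreover from this have "length ks > 0" by (cases ks) auto
  ultimately show ?thesis
    unfolding length_ks[symmetric] by (simp add: length_remove1 of_nat_diff Suc_le_eq)
qed

lemma phi_e_product: "\<phi> (e_product js) = prod_list (map e js)"
  unfolding e_product_def hom_prod_list E_eq ..

lemma commute_E_prod: "(\<And>k. z * e k = e k * z) \<Longrightarrow> z * E_prod = E_prod * z"
  unfolding phi_e_product by (rule commute_prod_list) auto

lemma e_e_product_remove: "e k * \<phi> (e_product (remove1 k ks)) = E_prod"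
proof -
  have "e k * prod_list (map e (remove1 k js)) = prod_list (map e js)" if "k \<in> set js" for js
    using that
  proof (induction js)
    case (Cons j js)
    have "e k * (e j * p) = e j * (e k * p)" for p
      by (simp add: e_e[of k j] mult.assoc[symmetric])
    with Cons show ?case by auto
  qed simp
  then show ?thesis using ks(2) by (simp add: phi_e_product)
qed

lemma e_inv_E_prod: "e_inv k * E_prod = \<phi> (e_product (remove1 k ks))"
  unfolding e_e_product_remove[of k, symmetric] by simp

end

text \<open>A traceless \<open>\<xi>\<close> at which the symbols of all denominators are nonzero.\<close>

locale symbol_point = ore_localization \<phi> for \<phi> :: "'n::finite option sl uea \<Rightarrow> 'q::complex_algebra_1" +
  fixes \<xi> :: "'n option pt"
  assumes trace_zero: "(\<Sum>i\<in>UNIV. \<xi> i i) = 0"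
    and nonzero: "\<xi> None (Some k) \<noteq> 0"
begin

lemmas symbol_E = has_symbol_sl_unit[of \<xi>, OF trace_zero]

lemma eps_nonzero: "eps \<xi> js \<noteq> 0"
  by (induction js) (simp_all add: eps_def nonzero)

lemma eps_remove: "eps \<xi> (remove1 k ks) = eps \<xi> ks / \<xi> None (Some k)"
proof -
  have "eps \<xi> (remove1 k js) * \<xi> None (Some k) = eps \<xi> js" if "k \<in> set js" for js
    using that by (induction js) (auto simp: eps_def)
  then show ?thesis using ks(2) nonzero[of k] by (simp add: field_simps)
qed

lemma symbol_e_product: "has_symbol \<xi> (int (length js)) (eps \<xi> js) (e_product js)"
proof -
  have "has_symbol \<xi> (sum_list (map (\<lambda>_. 1) js)) (eps \<xi> js) (e_product js)"
    unfolding e_product_def eps_def by (rule has_symbol_prod_list) (rule symbol_E)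
  also have "sum_list (map (\<lambda>_. 1) js) = int (length js)"
    by (induction js) simp_all
  finally show ?thesis .
qed

lemma symbol_E_prod: "has_symbol \<xi> (int CARD('n)) (eps \<xi> ks) (e_product ks)"
  using symbol_e_product[of ks] by (simp add: length_ks)

text \<open>Elements of the localization get symbols by clearing denominators: \<open>E_prod\<close> is the product of all
  \<open>e_k\<close>, of order \<open>n\<close>, and \<open>M\<close> is an exponent for which \<open>E_prod^M q\<close> comes from the enveloping algebra.\<close>

definition frac_symbol_at :: "nat \<Rightarrow> int \<Rightarrow> complex \<Rightarrow> 'q \<Rightarrow> bool" where
  "frac_symbol_at M d s q \<longleftrightarrow> (\<exists>u. E_prod ^ M * q = \<phi> u \<and> has_symbol \<xi> (int CARD('n) * int M + d) (eps \<xi> ks ^ M * s) u)"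

definition frac_symbol :: "int \<Rightarrow> complex \<Rightarrow> 'q \<Rightarrow> bool" where
  "frac_symbol d s q \<longleftrightarrow> (\<exists>M. frac_symbol_at M d s q)"

lemma frac_symbol_at_add_left: "frac_symbol_at M d s q \<Longrightarrow> frac_symbol_at (m + M) d s q"
proof -
  assume "frac_symbol_at M d s q"
  then obtain u where u: "E_prod ^ M * q = \<phi> u" "has_symbol \<xi> (int CARD('n) * int M + d) (eps \<xi> ks ^ M * s) u"
    unfolding frac_symbol_at_def by blast
  have "E_prod ^ (m + M) * q = \<phi> (e_product ks ^ m * u)"
    by (simp add: power_add mult.assoc u(1) hom_mult hom_power)
  moreover have "has_symbol \<xi> (int m * int CARD('n) + (int CARD('n) * int M + d)) (eps \<xi> ks ^ m * (eps \<xi> ks ^ M * s)) (e_product ks ^ m * u)"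
    by (intro has_symbol_mult has_symbol_power symbol_E_prod u(2))
  then have "has_symbol \<xi> (int CARD('n) * int (m + M) + d) (eps \<xi> ks ^ (m + M) * s) (e_product ks ^ m * u)"
    by (simp add: algebra_simps power_add)
  ultimately show ?thesis unfolding frac_symbol_at_def by blast
qed

lemma frac_symbol_add:
  assumes "frac_symbol d s q" "frac_symbol d s' q'" shows "frac_symbol d (s + s') (q + q')"
proof -
  obtain M M' where "frac_symbol_at M d s q" "frac_symbol_at M' d s' q'"
    using assms unfolding frac_symbol_def by blast
  then have "frac_symbol_at (M' + M) d s q" "frac_symbol_at (M' + M) d s' q'"
    using frac_symbol_at_add_left[of M d s q M'] frac_symbol_at_add_left[of M' d s' q' M] by (simp_all add: add.commute)
  then obtain u u' where u: "E_prod ^ (M' + M) * q = \<phi> u" "has_symbol \<xi> (int CARD('n) * int (M' + M) + d) (eps \<xi> ks ^ (M' + M) * s) u"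
      "E_prod ^ (M' + M) * q' = \<phi> u'" "has_symbol \<xi> (int CARD('n) * int (M' + M) + d) (eps \<xi> ks ^ (M' + M) * s') u'"
    unfolding frac_symbol_at_def by blast
  have "E_prod ^ (M' + M) * (q + q') = \<phi> (u + u')"
    by (simp add: distrib_left u hom_add)
  moreover have "has_symbol \<xi> (int CARD('n) * int (M' + M) + d) (eps \<xi> ks ^ (M' + M) * (s + s')) (u + u')"
    using has_symbol_add[OF u(2,4)] by (simp add: distrib_left)
  ultimately show ?thesis unfolding frac_symbol_def frac_symbol_at_def by blast
qed

lemma frac_symbol_scaleC:
  assumes "frac_symbol d s q" shows "frac_symbol d (c * s) (c *\<^sub>C q)"
proof -
  obtain M u where u: "E_prod ^ M * q = \<phi> u" "has_symbol \<xi> (int CARD('n) * int M + d) (eps \<xi> ks ^ M * s) u"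
    using assms unfolding frac_symbol_def frac_symbol_at_def by blast
  have "E_prod ^ M * (c *\<^sub>C q) = \<phi> (c *\<^sub>C u)"
    by (simp add: mult_scaleC_right u hom_scaleC)
  moreover have "has_symbol \<xi> (int CARD('n) * int M + d) (eps \<xi> ks ^ M * (c * s)) (c *\<^sub>C u)"
    using has_symbol_scaleC[OF u(2), of c] by (simp add: mult.left_commute)
  ultimately show ?thesis unfolding frac_symbol_def frac_symbol_at_def by blast
qed

lemma frac_symbol_one: "frac_symbol 0 1 1"
  unfolding frac_symbol_def frac_symbol_at_def
  by (intro exI[of _ 0] exI[of _ 1]) (simp add: hom_one has_symbol_one)

lemma frac_symbol_zero: "frac_symbol d 0 0"
  unfolding frac_symbol_def frac_symbol_at_def
  by (intro exI[of _ 0]) (simp add: hom_zero has_symbol_zero)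

lemma frac_symbol_sum: "(\<And>i. i \<in> I \<Longrightarrow> frac_symbol d (s i) (q i)) \<Longrightarrow> frac_symbol d (\<Sum>i\<in>I. s i) (\<Sum>i\<in>I. q i)"
  by (induction I rule: infinite_finite_induct) (simp_all add: frac_symbol_zero frac_symbol_add)

lemma frac_symbol_lower:
  assumes "frac_symbol d s q" "d < d'" shows "frac_symbol d' 0 q"
proof -
  have step: "frac_symbol (d + 1) 0 q" if q: "frac_symbol d s q" for d s
  proof -
    obtain M u where u: "E_prod ^ M * q = \<phi> u" "has_symbol \<xi> (int CARD('n) * int M + d) (eps \<xi> ks ^ M * s) u"
      using q unfolding frac_symbol_def frac_symbol_at_def by blast
    have "has_symbol \<xi> (int CARD('n) * int M + (d + 1)) (eps \<xi> ks ^ M * 0) u"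
      using has_symbol_lower[OF u(2)] by (simp add: add.assoc)
    with u(1) show ?thesis unfolding frac_symbol_def frac_symbol_at_def by blast
  qed
  have "frac_symbol (d + 1 + int m) 0 q" for m
  proof (induction m)
    case 0
    then show ?case using step[OF assms(1)] by simp
  next
    case (Suc m)
    then show ?case using step[of "d + 1 + int m" 0] by (simp add: algebra_simps)
  qed
  from this[of "nat (d' - d - 1)"] assms(2) show ?thesis by simp
qed

text \<open>If \<open>q = 0\<close>, the numerator \<open>u\<close> is annihilated by some element of the Ore set. The symbol of that
  element is a nonzero product of powers of the \<open>\<xi>_0k\<close>, so the symbol of \<open>u\<close> vanishes.\<close>

lemma frac_symbol_zero_imp:
  assumes "frac_symbol d s 0" shows "s = 0"
proof -
  obtain M u where u: "E_prod ^ M * 0 = \<phi> u" "has_symbol \<xi> (int CARD('n) * int M + d) (eps \<xi> ks ^ M * s) u"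
    using assms unfolding frac_symbol_def frac_symbol_at_def by blast
  then have "\<phi> u = 0" by simp
  then obtain t where t: "t \<in> ore_set" "t * u = 0" using hom_eq_0D by blast
  then obtain i js where t': "t = prod_list (map (\<lambda>k. uea_of (sl_unit None (Some k)) ^ i k) js)"
    unfolding ore_set_def by blast
  have "has_symbol \<xi> (sum_list (map (\<lambda>k. int (i k) * 1) js)) (prod_list (map (\<lambda>k. \<xi> None (Some k) ^ i k) js)) t"
    unfolding t' by (intro has_symbol_prod_list has_symbol_power symbol_E)
  from has_symbol_mult[OF this u(2)] t(2)
  have "prod_list (map (\<lambda>k. \<xi> None (Some k) ^ i k) js) * (eps \<xi> ks ^ M * s) = 0"
    by (intro has_symbol_zero_unique) simp
  moreover have "prod_list (map (\<lambda>k. \<xi> None (Some k) ^ i k) js) \<noteq> 0"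
    by (induction js) (simp_all add: nonzero)
  ultimately show ?thesis using eps_nonzero by simp
qed

text \<open>Moving powers of \<open>E_prod\<close> past an element of the localization is delicate, so multiplicativity of
  symbols is stated for the left multiplication by \<open>a\<close>; in this form it is closed under products.\<close>

definition raises :: "int \<Rightarrow> complex \<Rightarrow> 'q \<Rightarrow> bool" where
  "raises d s a \<longleftrightarrow> (\<forall>d' s' q. frac_symbol d' s' q \<longrightarrow> frac_symbol (d + d') (s * s') (a * q))"

lemma raises_one: "raises 0 1 1"
  by (simp add: raises_def)

lemma raises_mult:
  assumes "raises d s a" "raises d' s' a'" shows "raises (d + d') (s * s') (a * a')"
  unfolding raises_def
proof (intro allI impI)
  fix d'' s'' q assume "frac_symbol d'' s'' q"
  then have "frac_symbol (d + (d' + d'')) (s * (s' * s'')) (a * (a' * q))"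
    using assms unfolding raises_def by simp
  then show "frac_symbol (d + d' + d'') (s * s' * s'') (a * a' * q)"
    by (simp add: ac_simps)
qed

lemma raises_power: "raises d s a \<Longrightarrow> raises (int m * d) (s ^ m) (a ^ m)"
  by (induction m) (auto simp: raises_one distrib_right dest: raises_mult)

lemma raises_prod_list:
  "(\<And>z. z \<in> set zs \<Longrightarrow> raises (d z) (s z) (F z)) \<Longrightarrow>
     raises (sum_list (map d zs)) (prod_list (map s zs)) (prod_list (map F zs))"
  by (induction zs) (simp_all add: raises_one raises_mult)

text \<open>For \<open>a\<close> commuting with \<open>E_prod\<close>, the denominators of \<open>a\<close> and of \<open>q\<close> can be cleared separately.\<close>

lemma raises_commuting:
  assumes a: "\<And>k. a * e k = e k * a" "E_prod ^ m * a = \<phi> r"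
    and r: "has_symbol \<xi> (int CARD('n) * int m + d) (eps \<xi> ks ^ m * s) r"
  shows "raises d s a"
  unfolding raises_def
proof (intro allI impI)
  fix d' s' q assume "frac_symbol d' s' q"
  then obtain M u where u: "E_prod ^ M * q = \<phi> u" "has_symbol \<xi> (int CARD('n) * int M + d') (eps \<xi> ks ^ M * s') u"
    unfolding frac_symbol_def frac_symbol_at_def by blast
  have "a * E_prod ^ M = E_prod ^ M * a"
    by (rule commute_power) (rule commute_E_prod[OF a(1)])
  then have "E_prod ^ (m + M) * (a * q) = (E_prod ^ m * a) * (E_prod ^ M * q)"
    by (simp add: power_add mult.assoc) (simp add: mult.assoc[symmetric])
  then have "E_prod ^ (m + M) * (a * q) = \<phi> (r * u)"
    by (simp add: a(2) u(1) hom_mult)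
  moreover have "has_symbol \<xi> (int CARD('n) * int (m + M) + (d + d')) (eps \<xi> ks ^ (m + M) * (s * s')) (r * u)"
    using has_symbol_mult[OF r u(2)] by (simp add: algebra_simps power_add)
  ultimately show "frac_symbol (d + d') (s * s') (a * q)"
    unfolding frac_symbol_def frac_symbol_at_def by blast
qed

lemma raises_e: "raises 1 (\<xi> None (Some k)) (e k)"
  by (rule raises_commuting[of _ 0 "uea_of (sl_unit None (Some k))"])
     (simp_all add: e_e symbol_E, simp_all add: E_eq)

lemma raises_e_inv: "raises (- 1) (inverse (\<xi> None (Some k))) (e_inv k)"
proof (rule raises_commuting[of _ 1 "e_product (remove1 k ks)"])
  show "e_inv k * e j = e j * e_inv k" for j by (rule e_e_inv[symmetric])
  have "e_inv k * E_prod = E_prod * e_inv k"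
    by (rule commute_E_prod) (rule e_e_inv[symmetric])
  then show "E_prod ^ 1 * e_inv k = \<phi> (e_product (remove1 k ks))"
    by (simp add: e_inv_E_prod)
  show "has_symbol \<xi> (int CARD('n) * int 1 + - 1) (eps \<xi> ks ^ 1 * inverse (\<xi> None (Some k))) (e_product (remove1 k ks))"
    using symbol_e_product[of "remove1 k ks"] by (simp add: length_remove eps_remove divide_inverse)
qed

lemma raises_epow: "raises a (\<xi> None (Some k) powi a) (epow k a)"
  using raises_power[OF raises_e[of k], of "nat a"] raises_power[OF raises_e_inv[of k], of "nat (- a)"]
  by (cases "a \<ge> 0") (simp_all add: epow_def power_int_def)

text \<open>Here \<open>E_prod^M h_k = (h_k + M) E_prod^M\<close>, and the constant \<open>M\<close> has smaller order than \<open>h_k\<close>.\<close>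

lemma raises_h: "raises 1 (\<xi> (Some k) (Some k)) (h k)"
  unfolding raises_def
proof (intro allI impI)
  fix d' s' q assume "frac_symbol d' s' q"
  then obtain M u where u: "E_prod ^ M * q = \<phi> u" "has_symbol \<xi> (int CARD('n) * int M + d') (eps \<xi> ks ^ M * s') u"
    unfolding frac_symbol_def frac_symbol_at_def by blast
  have "weight k (sum_list (map (\<lambda>j. - of_bool (j = k)) ks)) E_prod"
    unfolding phi_e_product
  proof (rule weight_prod_list)
    show "weight k (- of_bool (j = k)) (e j)" for j
      using weight_E[of k None "Some j"] by simp
  qed
  moreover have "sum_list (map (\<lambda>j. - of_bool (j = k)) ks) = (\<Sum>j\<in>UNIV. if j = k then - 1 else (0::complex))"
    unfolding ks(2)[symmetric] sum.distinct_set_conv_list[OF ks(1)] by (intro arg_cong[of _ _ sum_list] map_cong) auto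
  ultimately have "weight k (- 1) E_prod" by simp
  from weight_power[OF this, of M] have "E_prod ^ M * h k = h k * E_prod ^ M + of_nat M *\<^sub>C E_prod ^ M"
    by (simp add: weight_def commutator_def algebra_simps)
  then have "E_prod ^ M * (h k * q) = h k * (E_prod ^ M * q) + of_nat M *\<^sub>C (E_prod ^ M * q)"
    by (simp add: mult.assoc[symmetric] distrib_right mult_scaleC_left)
  also have "\<dots> = \<phi> ((uea_of (sl_unit (Some k) (Some k)) + of_nat M *\<^sub>C 1) * u)"
    by (simp add: u(1) hom_mult hom_add hom_scaleC hom_one E_eq distrib_right mult_scaleC_left)
  finally have 1: "E_prod ^ M * (h k * q) = \<phi> ((uea_of (sl_unit (Some k) (Some k)) + of_nat M *\<^sub>C 1) * u)" .
  have "has_symbol \<xi> (0 + 1) 0 (of_nat M *\<^sub>C (1 :: 'n option sl uea))"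
    by (rule has_symbol_lower, rule has_symbol_scaleC, rule has_symbol_one)
  from has_symbol_mult[OF has_symbol_add[OF symbol_E[of "Some k" "Some k"] this[simplified]] u(2)]
  have "has_symbol \<xi> (int CARD('n) * int M + (1 + d')) (eps \<xi> ks ^ M * (\<xi> (Some k) (Some k) * s'))
     ((uea_of (sl_unit (Some k) (Some k)) + of_nat M *\<^sub>C 1) * u)"
    by (simp add: algebra_simps)
  with 1 show "frac_symbol (1 + d') (\<xi> (Some k) (Some k) * s') (h k * q)"
    unfolding frac_symbol_def frac_symbol_at_def by blast
qed

lemma raises_y: "raises 0 (\<xi> (Some k) (Some k) / \<xi> None (Some k)) (y k)"
  using raises_mult[OF raises_h[of k] raises_e_inv[of k]] by (simp add: y_def divide_inverse)

lemma raises_x: "raises 1 (\<xi> (Some i) (Some j) * \<xi> None (Some i) / \<xi> None (Some j) - \<xi> (Some i) (Some i)) (x i j)"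
  (is "raises 1 ?s _")
proof -
  let ?u = "\<lambda>i j. uea_of (sl_unit i j) :: 'n option sl uea"
  let ?r = "?u (Some i) (Some j) * ?u None (Some i) * e_product (remove1 j ks) + (- 1) *\<^sub>C (?u (Some i) (Some i) * e_product ks)"
  have com: "x i j * e k = e k * x i j" for k
    using commutator_e_x[of k i j] by (simp add: commutator_def)
  have "E_prod ^ 1 * x i j = x i j * E_prod"
    using commute_E_prod[OF com] by simp
  also have "\<dots> = \<phi> ?r"
    by (simp add: x_elt_def left_diff_distrib mult.assoc e_inv_E_prod hom_add hom_diff hom_mult hom_scaleC
        complex_vector.scale_minus_left scaleC_one) (simp add: E_eq)
  finally have 1: "E_prod ^ 1 * x i j = \<phi> ?r" .
  have "has_symbol \<xi> (1 + 1 + int (length (remove1 j ks))) (\<xi> (Some i) (Some j) * \<xi> None (Some i) * eps \<xi> (remove1 j ks))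
     (?u (Some i) (Some j) * ?u None (Some i) * e_product (remove1 j ks))"
    by (intro has_symbol_mult symbol_E symbol_e_product)
  moreover have "has_symbol \<xi> (1 + int CARD('n)) (- 1 * (\<xi> (Some i) (Some i) * eps \<xi> ks))
     ((- 1) *\<^sub>C (?u (Some i) (Some i) * e_product ks))"
    by (intro has_symbol_scaleC has_symbol_mult symbol_E symbol_E_prod)
  ultimately have "has_symbol \<xi> (1 + int CARD('n)) (\<xi> (Some i) (Some j) * \<xi> None (Some i) * eps \<xi> (remove1 j ks)
      + - 1 * (\<xi> (Some i) (Some i) * eps \<xi> ks)) ?r"
    by (intro has_symbol_add) (simp_all add: length_remove)
  moreover have "\<xi> (Some i) (Some j) * \<xi> None (Some i) * eps \<xi> (remove1 j ks) + - 1 * (\<xi> (Some i) (Some i) * eps \<xi> ks)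
    = eps \<xi> ks ^ 1 * ?s"
    by (simp add: eps_remove algebra_simps)
  ultimately have 2: "has_symbol \<xi> (int CARD('n) * int 1 + 1) (eps \<xi> ks ^ 1 * ?s) ?r"
    by (simp add: add.commute)
  show ?thesis by (rule raises_commuting[OF com 1 2])
qed

lemma has_symbol_sum: "(\<And>i. i \<in> I \<Longrightarrow> has_symbol \<xi> d (s i) (u i)) \<Longrightarrow> has_symbol \<xi> d (\<Sum>i\<in>I. s i) (\<Sum>i\<in>I. u i)"
  by (induction I rule: infinite_finite_induct) (simp_all add: has_symbol_zero has_symbol_add)

lemma raises_omega: "raises 2 (\<xi> (Some k) None * \<xi> None (Some k)
    + (\<Sum>j\<in>UNIV. \<xi> (Some k) (Some j) * \<xi> (Some j) (Some j) * \<xi> None (Some k) / \<xi> None (Some j))) (\<omega> k)"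
  (is "raises 2 ?s _")
proof -
  let ?u = "\<lambda>i j. uea_of (sl_unit i j) :: 'n option sl uea"
  let ?r = "?u (Some k) None * ?u None (Some k) * e_product ks
     + (\<Sum>j\<in>UNIV. ?u (Some k) (Some j) * (?u (Some j) (Some j) + (- 1) *\<^sub>C 1) * ?u None (Some k) * e_product (remove1 j ks))"
  have com: "\<omega> k * e l = e l * \<omega> k" for l
    using commutator_e_omega[of l k] by (simp add: commutator_def)
  have "E_prod ^ 1 * \<omega> k = \<omega> k * E_prod"
    using commute_E_prod[OF com] by simp
  also have "\<dots> = \<phi> ?r"
    by (simp add: omega_elt_def distrib_right sum_distrib_right mult.assoc e_inv_E_prod hom_add hom_diff hom_sum hom_mult hom_scaleC
        hom_one complex_vector.scale_minus_left scaleC_one) (simp add: E_eq)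
  finally have 1: "E_prod ^ 1 * \<omega> k = \<phi> ?r" .
  have m1: "has_symbol \<xi> (0 + 1) 0 ((- 1) *\<^sub>C (1 :: 'n option sl uea))"
    by (rule has_symbol_lower, rule has_symbol_scaleC, rule has_symbol_one)
  have h: "has_symbol \<xi> 1 (\<xi> (Some j) (Some j)) (?u (Some j) (Some j) + (- 1) *\<^sub>C 1)" for j
    using has_symbol_add[OF symbol_E[of "Some j" "Some j"] m1[simplified]] by simp
  have "has_symbol \<xi> (1 + 1 + int CARD('n)) (\<xi> (Some k) None * \<xi> None (Some k) * eps \<xi> ks) (?u (Some k) None * ?u None (Some k) * e_product ks)"
    by (intro has_symbol_mult symbol_E symbol_E_prod)
  moreover have "has_symbol \<xi> (1 + 1 + int CARD('n))
     (\<xi> (Some k) (Some j) * \<xi> (Some j) (Some j) * \<xi> None (Some k) * eps \<xi> (remove1 j ks))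
     (?u (Some k) (Some j) * (?u (Some j) (Some j) + (- 1) *\<^sub>C 1) * ?u None (Some k) * e_product (remove1 j ks))" for j
  proof -
    have "has_symbol \<xi> (1 + 1 + 1 + int (length (remove1 j ks)))
       (\<xi> (Some k) (Some j) * \<xi> (Some j) (Some j) * \<xi> None (Some k) * eps \<xi> (remove1 j ks))
       (?u (Some k) (Some j) * (?u (Some j) (Some j) + (- 1) *\<^sub>C 1) * ?u None (Some k) * e_product (remove1 j ks))"
      by (intro has_symbol_mult symbol_E symbol_e_product h)
    then show ?thesis by (simp add: length_remove)
  qed
  ultimately have "has_symbol \<xi> (1 + 1 + int CARD('n)) (\<xi> (Some k) None * \<xi> None (Some k) * eps \<xi> ks
      + (\<Sum>j\<in>UNIV. \<xi> (Some k) (Some j) * \<xi> (Some j) (Some j) * \<xi> None (Some k) * eps \<xi> (remove1 j ks))) ?r"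
    by (intro has_symbol_add has_symbol_sum)
  moreover have "\<xi> (Some k) None * \<xi> None (Some k) * eps \<xi> ks
      + (\<Sum>j\<in>UNIV. \<xi> (Some k) (Some j) * \<xi> (Some j) (Some j) * \<xi> None (Some k) * eps \<xi> (remove1 j ks))
      = eps \<xi> ks ^ 1 * ?s"
    by (simp add: eps_remove distrib_left sum_distrib_left mult.commute mult.left_commute)
  ultimately have 2: "has_symbol \<xi> (int CARD('n) * int 1 + 2) (eps \<xi> ks ^ 1 * ?s) ?r"
    by (simp add: add.commute)
  show ?thesis by (rule raises_commuting[OF com 1 2])
qed

end

section \<open>Independence of the monomials\<close>

text \<open>The order of the symbol of a generator. It is also its degree in the filtration that is used for
  straightening, although \<open>e_0k\<close> and \<open>e_k0\<close> have order \<open>1\<close> but filtration degrees \<open>0\<close> and \<open>2\<close>.\<close>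

fun gen_degree :: "'n gen \<Rightarrow> int" where
  "gen_degree (X_gen i j) = 1"
| "gen_degree (Omega_gen k) = 2"

fun gen_symbol :: "'n::finite option pt \<Rightarrow> 'n gen \<Rightarrow> complex" where
  "gen_symbol \<xi> (X_gen i j) = \<xi> (Some i) (Some j) * \<xi> None (Some i) / \<xi> None (Some j) - \<xi> (Some i) (Some i)"
| "gen_symbol \<xi> (Omega_gen k) = \<xi> (Some k) None * \<xi> None (Some k)
    + (\<Sum>j\<in>UNIV. \<xi> (Some k) (Some j) * \<xi> (Some j) (Some j) * \<xi> None (Some k) / \<xi> None (Some j))"

text \<open>A point \<open>(u, w, z)\<close> gives values to the symbols of the \<open>e_k\<close>, the \<open>y_k\<close> and the generators of \<open>W\<close>; an
  exponent \<open>(\<alpha>, \<beta>, \<gamma>)\<close> has one component for each of these three groups of variables.\<close>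

type_synonym 'n point = "('n \<Rightarrow> complex) \<times> ('n \<Rightarrow> complex) \<times> ('n gen \<Rightarrow> complex)"
type_synonym 'n exponent = "('n \<Rightarrow> int) \<times> ('n \<Rightarrow> nat) \<times> ('n gen \<Rightarrow> nat)"

definition torus :: "'n point set" where
  "torus = {(u, w, z). (\<forall>k. u k \<noteq> 0) \<and> (\<forall>k. w k \<noteq> 0) \<and> (\<forall>a. z a \<noteq> 0)}"

fun torus_mult :: "'n point \<Rightarrow> 'n point \<Rightarrow> 'n point" where
  "torus_mult (u, w, z) (u', w', z') = (\<lambda>k. u k * u' k, \<lambda>k. w k * w' k, \<lambda>a. z a * z' a)"

fun character :: "'n::finite exponent \<Rightarrow> 'n point \<Rightarrow> complex" where
  "character (\<alpha>, \<beta>, \<gamma>) (u, w, z) =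
     (\<Prod>k\<in>UNIV. u k powi \<alpha> k) * (\<Prod>k\<in>UNIV. w k ^ \<beta> k) * (\<Prod>a\<in>gens. z a ^ \<gamma> a)"

text \<open>The order of the symbol; \<open>y_k = h_k e_k^-1\<close> has order \<open>0\<close>.\<close>

fun total_degree :: "'n::finite exponent \<Rightarrow> int" where
  "total_degree (\<alpha>, \<beta>, \<gamma>) = (\<Sum>k\<in>UNIV. \<alpha> k) + (\<Sum>a\<in>gens. int (\<gamma> a) * gen_degree a)"

definition all_exponents :: "'n exponent set" where
  "all_exponents = {(\<alpha>, \<beta>, \<gamma>). \<gamma> \<in> exponents}"

lemma finite_gens: "finite (gens :: 'n::finite gen set)"
proof -
  have "gens \<subseteq> range (\<lambda>(i, j). X_gen i j) \<union> range (Omega_gen :: 'n \<Rightarrow> _)"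
    unfolding gens_def by auto
  then show ?thesis by (rule finite_subset) simp
qed

lemma powi_2_inj: "(2::complex) powi a = 2 powi b \<Longrightarrow> a = b"
proof -
  assume "(2::complex) powi a = 2 powi b"
  then have "norm ((2::complex) powi a) = norm ((2::complex) powi b)" by simp
  then have *: "(2::real) powi a = 2 powi b" by (simp add: norm_power_int)
  show "a = b"
  proof (rule ccontr)
    assume "a \<noteq> b"
    then have "(2::real) powi a < 2 powi b \<or> (2::real) powi b < 2 powi a"
      by (metis linorder_neqE_linordered_idom one_less_numeral_iff power_int_strict_increasing semiring_norm(76))
    with * show False by simp
  qed
qed

lemma character_mult:
  "character i (torus_mult p q) = character i p * character i q"
  by (cases i; cases p; cases q)
     (simp add: power_int_mult_distrib power_mult_distrib prod.distrib)

lemma character_distinct: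
  assumes "i \<in> all_exponents" "j \<in> all_exponents" "i \<noteq> j"
  shows "\<exists>p\<in>torus. character i p \<noteq> character j p"
proof -
  obtain \<alpha> \<beta> \<gamma> where i: "i = (\<alpha>, \<beta>, \<gamma>)" by (cases i)
  obtain \<alpha>' \<beta>' \<gamma>' where j: "j = (\<alpha>', \<beta>', \<gamma>')" by (cases j)
  have g: "\<gamma> a = 0" "\<gamma>' a = 0" if "a \<notin> gens" for a
    using assms(1,2) that by (auto simp: i j all_exponents_def exponents_def)
  consider k where "\<alpha> k \<noteq> \<alpha>' k" | k where "\<beta> k \<noteq> \<beta>' k" | a where "a \<in> gens" "\<gamma> a \<noteq> \<gamma>' a"
    using assms(3) g unfolding i j by (metis ext)
  then show ?thesis
  proof cases
    case 1
    let ?p = "(\<lambda>l. if l = k then 2 else 1, \<lambda>_. 1, \<lambda>_. 1) :: 'a point"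
    have "(if l = k then 2 else 1) powi n = (if l = k then 2 powi n else (1::complex))" for l n by simp
    then have "character i ?p = 2 powi \<alpha> k" "character j ?p = 2 powi \<alpha>' k"
      by (simp_all add: i j)
    with 1 have "character i ?p \<noteq> character j ?p" using powi_2_inj by auto
    then show ?thesis by (intro bexI[of _ ?p]) (simp_all add: torus_def)
  next
    case 2
    let ?p = "(\<lambda>_. 1, \<lambda>l. if l = k then 2 else 1, \<lambda>_. 1) :: 'a point"
    have "(if l = k then 2 else 1) ^ n = (if l = k then 2 ^ n else (1::complex))" for l n by simp
    then have "character i ?p = 2 powi int (\<beta> k)" "character j ?p = 2 powi int (\<beta>' k)"
      by (simp_all add: i j)
    with 2 have "character i ?p \<noteq> character j ?p"
      using powi_2_inj[of "int (\<beta> k)" "int (\<beta>' k)"] by (metis of_nat_eq_iff)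
    then show ?thesis by (intro bexI[of _ ?p]) (simp_all add: torus_def)
  next
    case 3
    let ?p = "(\<lambda>_. 1, \<lambda>_. 1, \<lambda>l. if l = a then 2 else 1) :: 'a point"
    have "(if l = a then 2 else 1) ^ n = (if l = a then 2 ^ n else (1::complex))" for l n by simp
    then have "character i ?p = 2 powi int (\<gamma> a)" "character j ?p = 2 powi int (\<gamma>' a)"
      using 3(1) by (simp_all add: i j finite_gens)
    with 3 have "character i ?p \<noteq> character j ?p"
      using powi_2_inj[of "int (\<gamma> a)" "int (\<gamma>' a)"] by (metis of_nat_eq_iff)
    then show ?thesis by (intro bexI[of _ ?p]) (simp_all add: torus_def)
  qed
qed

text \<open>The symbols of the generators take arbitrary values: \<open>\<xi>_0k = u_k\<close> and \<open>\<xi>_kk = w_k u_k\<close> are prescribed, the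
  symbol of \<open>x_ij\<close> is then solved for \<open>\<xi>_ij\<close>, the symbol of \<open>\<omega>_k\<close> for \<open>\<xi>_k0\<close>, and the trace condition for \<open>\<xi>_00\<close>.\<close>

lemma point_of_torus:
  fixes u w :: "'n::finite \<Rightarrow> complex"
  assumes u: "\<And>k. u k \<noteq> 0"
  obtains \<xi> where "(\<Sum>i\<in>UNIV. \<xi> i i) = 0" "\<And>k. \<xi> None (Some k) = u k"
    "\<And>k. \<xi> (Some k) (Some k) / \<xi> None (Some k) = w k" "\<And>a. a \<in> gens \<Longrightarrow> gen_symbol \<xi> a = z a"
proof -
  define v where "v k = w k * u k" for k
  define G where "G i j = (if i = j then v i else (z (X_gen i j) + v i) * u j / u i)" for i j
  define \<xi> where "\<xi> = (\<lambda>a b. case a of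
      None \<Rightarrow> (case b of None \<Rightarrow> - (\<Sum>k\<in>UNIV. v k) | Some k \<Rightarrow> u k)
    | Some i \<Rightarrow> (case b of None \<Rightarrow> (z (Omega_gen i) - (\<Sum>j\<in>UNIV. G i j * v j * u i / u j)) / u i | Some j \<Rightarrow> G i j))"
  have G: "G k k = v k" for k by (simp add: G_def)
  show thesis
  proof (rule that[of \<xi>])
    show "(\<Sum>i\<in>UNIV. \<xi> i i) = 0"
      unfolding sum_option by (simp add: \<xi>_def G)
    show "\<xi> None (Some k) = u k" for k by (simp add: \<xi>_def)
    show "\<xi> (Some k) (Some k) / \<xi> None (Some k) = w k" for k
      using u[of k] by (simp add: \<xi>_def G v_def)
    show "gen_symbol \<xi> a = z a" if "a \<in> gens" for a
    proof (cases a)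
      case (X_gen i j)
      with that have "i \<noteq> j" by (auto simp: gens_def)
      then show ?thesis using X_gen u[of i] u[of j] by (simp add: \<xi>_def G) (simp add: G_def)
    next
      case (Omega_gen k)
      then show ?thesis using u[of k] by (simp add: \<xi>_def G)
    qed
  qed
qed

locale ordered_generators = ore_localization \<phi> for \<phi> :: "'n::finite option sl uea \<Rightarrow> 'q::complex_algebra_1" +
  fixes gs :: "'n gen list"
  assumes gs: "distinct gs" "set gs = gens"
begin

abbreviation mon :: "('n gen \<Rightarrow> nat) \<Rightarrow> 'q" where "mon \<equiv> ordered_monomial \<phi> gs"

fun pbw :: "'n exponent \<Rightarrow> 'q" where
  "pbw (\<alpha>, \<beta>, \<gamma>) = Bmon \<alpha> \<beta> * mon \<gamma>"

lemma frac_symbol_pbw: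
  assumes "symbol_point \<phi> \<xi>"
    and "\<And>k. \<xi> None (Some k) = u k" "\<And>k. \<xi> (Some k) (Some k) / \<xi> None (Some k) = w k"
    and "\<And>a. a \<in> gens \<Longrightarrow> gen_symbol \<xi> a = z a"
  shows "symbol_point.frac_symbol \<phi> \<xi> (total_degree i) (character i (u, w, z)) (pbw i)"
proof -
  interpret symbol_point \<phi> \<xi> by fact
  obtain \<alpha> \<beta> \<gamma> where i: "i = (\<alpha>, \<beta>, \<gamma>)" by (cases i)
  have "raises (\<alpha> k + int (\<beta> k) * 0) (u k powi \<alpha> k * w k ^ \<beta> k) (bmon k (\<alpha> k) (\<beta> k))" for k
    unfolding bmon_def assms(2,3)[symmetric]
    by (intro raises_mult raises_epow raises_power raises_y)
  then have "raises (\<alpha> k) (u k powi \<alpha> k * w k ^ \<beta> k) (bmon k (\<alpha> k) (\<beta> k))" for k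
    by simp
  then have "raises (sum_list (map \<alpha> ks)) (prod_list (map (\<lambda>k. u k powi \<alpha> k * w k ^ \<beta> k) ks)) (Bmon \<alpha> \<beta>)"
    unfolding Bmon_def by (rule raises_prod_list)
  then have B: "raises (\<Sum>k\<in>UNIV. \<alpha> k) (\<Prod>k\<in>UNIV. u k powi \<alpha> k * w k ^ \<beta> k) (Bmon \<alpha> \<beta>)"
    unfolding ks(2)[symmetric] sum.distinct_set_conv_list[OF ks(1)] prod.distinct_set_conv_list[OF ks(1)] .
  have gen: "raises (gen_degree a) (gen_symbol \<xi> a) (gen_val \<phi> a)" for a
    using raises_x raises_omega by (cases a) simp_all
  have "raises (sum_list (map (\<lambda>a. int (\<gamma> a) * gen_degree a) gs)) (prod_list (map (\<lambda>a. z a ^ \<gamma> a) gs)) (mon \<gamma>)"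
    unfolding ordered_monomial_def
  proof (rule raises_prod_list)
    fix a assume "a \<in> set gs"
    then have "z a = gen_symbol \<xi> a" using assms(4) gs(2) by simp
    then show "raises (int (\<gamma> a) * gen_degree a) (z a ^ \<gamma> a) (gen_val \<phi> a ^ \<gamma> a)"
      using raises_power[OF gen[of a]] by simp
  qed
  then have G: "raises (\<Sum>a\<in>gens. int (\<gamma> a) * gen_degree a) (\<Prod>a\<in>gens. z a ^ \<gamma> a) (mon \<gamma>)"
    unfolding gs(2)[symmetric] sum.distinct_set_conv_list[OF gs(1)] prod.distinct_set_conv_list[OF gs(1)] .
  from raises_mult[OF B G] frac_symbol_one
  have "frac_symbol (((\<Sum>k\<in>UNIV. \<alpha> k) + (\<Sum>a\<in>gens. int (\<gamma> a) * gen_degree a)) + 0)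
     (((\<Prod>k\<in>UNIV. u k powi \<alpha> k * w k ^ \<beta> k) * (\<Prod>a\<in>gens. z a ^ \<gamma> a)) * 1) (Bmon \<alpha> \<beta> * mon \<gamma> * 1)"
    unfolding raises_def by blast
  then show ?thesis by (simp add: i prod.distrib)
qed

text \<open>In a relation with nonzero coefficients let \<open>d\<close> be the largest total degree that occurs. The
  symbol of order \<open>d\<close> of the relation is the relation between the characters of the terms of degree
  \<open>d\<close>, and it holds at every point of the torus.\<close>

theorem independent_pbw: "indep_family pbw all_exponents"
  unfolding indep_family_def
proof (intro allI impI ballI, rule ccontr)
  fix J c i
  assume J: "finite J" "J \<subseteq> all_exponents" "(\<Sum>i\<in>J. c i *\<^sub>C pbw i) = 0" and i: "i \<in> J" "c i \<noteq> 0"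
  define K where "K = {j \<in> J. c j \<noteq> 0}"
  define d where "d = Max (total_degree ` K)"
  define K' where "K' = {j \<in> K. total_degree j = d}"
  have "i \<in> K" using i by (simp add: K_def)
  then have K: "finite K" "K \<noteq> {}" using J(1) by (simp add: K_def, blast)
  have max: "total_degree j \<le> d" if "j \<in> K" for j
    using that K unfolding d_def by simp
  have "d \<in> total_degree ` K"
    unfolding d_def using K by (intro Max_in) auto
  then obtain j where j: "j \<in> K'" unfolding K'_def by auto
  have vanish: "(\<Sum>i\<in>K'. c i * character i p) = 0" if p: "p \<in> torus" for p
  proof -
    obtain u w z where p': "p = (u, w, z)" by (cases p)
    with p have u: "u k \<noteq> 0" for k by (simp add: torus_def)
    obtain \<xi> where \<xi>: "(\<Sum>i\<in>UNIV. \<xi> i i) = 0" "\<And>k. \<xi> None (Some k) = u k"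
       "\<And>k. \<xi> (Some k) (Some k) / \<xi> None (Some k) = w k" "\<And>a. a \<in> gens \<Longrightarrow> gen_symbol \<xi> a = z a"
      using point_of_torus[of u w z] u by blast
    have sp: "symbol_point \<phi> \<xi>"
      by unfold_locales (use \<xi>(1,2) u in auto)
    interpret symbol_point \<phi> \<xi> by (rule sp)
    note frac_symbol = frac_symbol_pbw[OF sp \<xi>(2,3,4)]
    have "frac_symbol d (if i \<in> K' then c i * character i p else 0) (c i *\<^sub>C pbw i)" if iJ: "i \<in> J" for i
    proof -
      consider "i \<in> K'" | "i \<in> K" "i \<notin> K'" | "c i = 0" using iJ by (auto simp: K_def)
      then show ?thesis
      proof cases
        case 1
        then have "total_degree i = d" by (simp add: K'_def)
        then show ?thesis using frac_symbol_scaleC[OF frac_symbol[of i], of "c i"] 1 by (simp add: p')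
      next
        case 2
        then have "total_degree i < d" using max[of i] by (auto simp: K'_def)
        from frac_symbol_scaleC[OF frac_symbol_lower[OF frac_symbol this], of "c i"] show ?thesis using 2 by simp
      next
        case 3
        then show ?thesis by (simp add: frac_symbol_zero)
      qed
    qed
    then have "frac_symbol d (\<Sum>i\<in>J. if i \<in> K' then c i * character i p else 0) (\<Sum>i\<in>J. c i *\<^sub>C pbw i)"
      by (rule frac_symbol_sum)
    then have "(\<Sum>i\<in>J. if i \<in> K' then c i * character i p else 0) = 0"
      unfolding J(3) by (rule frac_symbol_zero_imp)
    moreover have "J \<inter> K' = K'" by (auto simp: K'_def K_def)
    ultimately show ?thesis using J(1) by (simp add: sum.inter_restrict[symmetric])
  qed
  have sub: "K' \<subseteq> all_exponents" using J(2) by (auto simp: K'_def K_def)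
  have "c j = 0"
  proof (rule characters_independent[where I = K' and P = torus and pm = torus_mult and ch = character])
    show "finite K'" using K(1) by (simp add: K'_def)
    show "torus_mult p q \<in> torus" if "p \<in> torus" "q \<in> torus" for p q
      using that by (cases p; cases q) (simp add: torus_def)
    show "\<exists>p\<in>torus. character i p \<noteq> 0" for i
      by (cases i, intro bexI[of _ "(\<lambda>_. 1, \<lambda>_. 1, \<lambda>_. 1)"]) (simp_all add: torus_def)
    show "\<exists>p\<in>torus. character i p \<noteq> character j p" if "i \<in> K'" "j \<in> K'" "i \<noteq> j" for i j
      using that sub by (intro character_distinct) auto
  qed (use j vanish character_mult in auto)
  moreover have "c j \<noteq> 0" using j by (simp add: K'_def K_def)
  ultimately show False by simp
qed

section \<open>Straightening\<close>

text \<open>This is one plus the degree of \<open>e_ij\<close> in the grading of the Lie algebra in which \<open>e_0k\<close> has degree \<open>-1\<close>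
  and \<open>e_k0\<close> degree \<open>1\<close>. The summand one makes commutators lower the filtration degree, and no letter
  has negative degree.\<close>

definition E_degree :: "'n option \<Rightarrow> 'n option \<Rightarrow> int" where
  "E_degree i j = 1 + of_bool (j = None) - of_bool (i = None)"

inductive letter_degree :: "'q \<Rightarrow> int \<Rightarrow> bool" where
  "letter_degree (E i j) (E_degree i j)"
| "letter_degree (e_inv k) 0"

text \<open>Degrees are integers, so that \<open>d + d' - 1\<close> in
  \<open>filt_commutator\<close> makes sense for \<open>d = d' = 0\<close>, where it says that the commutator is zero.\<close>

inductive filt :: "int \<Rightarrow> 'q \<Rightarrow> bool" where
  zero: "filt d 0"
| one: "0 \<le> d \<Longrightarrow> filt d 1"
| add: "filt d p \<Longrightarrow> filt d q \<Longrightarrow> filt d (p + q)"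
| scale: "filt d p \<Longrightarrow> filt d (c *\<^sub>C p)"
| letter: "letter_degree a w \<Longrightarrow> filt d q \<Longrightarrow> w + d \<le> d' \<Longrightarrow> filt d' (a * q)"

lemma letter_degree_nonneg: "letter_degree a w \<Longrightarrow> 0 \<le> w"
  by (induction rule: letter_degree.induct) (auto simp: E_degree_def)

lemma filt_mono: "filt d q \<Longrightarrow> d \<le> d' \<Longrightarrow> filt d' q"
proof (induction arbitrary: d' rule: filt.induct)
  case (letter a w d q d0)
  then show ?case using filt.letter[of a w d q d'] by simp
qed (auto intro: filt.intros)

lemma filt_negative: "filt d q \<Longrightarrow> d < 0 \<Longrightarrow> q = 0"
  by (induction rule: filt.induct) (auto dest: letter_degree_nonneg)

lemma filt_letter: "letter_degree a w \<Longrightarrow> filt w a"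
  using filt.letter[of a w 0 1 w] filt.one[of 0] by simp

lemma filt_mult: "filt d p \<Longrightarrow> filt d' q \<Longrightarrow> filt (d + d') (p * q)"
proof (induction rule: filt.induct)
  case (one d)
  then show ?case using filt_mono by simp
next
  case (letter a w d p d0)
  then show ?case using filt.letter[of a w "d + d'" "p * q" "d0 + d'"] by (simp add: mult.assoc)
qed (auto intro: filt.intros simp: distrib_right mult_scaleC_left)

lemma filt_uminus: "filt d p \<Longrightarrow> filt d (- p)"
  using filt.scale[of d p "- 1"] by (simp add: complex_vector.scale_minus_left scaleC_one)

lemma filt_diff: "filt d p \<Longrightarrow> filt d q \<Longrightarrow> filt d (p - q)"
  using filt.add[of d p "- q"] filt_uminus[of d q] by simp

lemma filt_sum: "(\<And>i. i \<in> I \<Longrightarrow> filt d (F i)) \<Longrightarrow> filt d (\<Sum>i\<in>I. F i)"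
  by (induction I rule: infinite_finite_induct) (auto intro: filt.intros)

lemma filt_E: "filt (E_degree i j) (E i j)" and filt_e_inv: "filt 0 (e_inv k)"
  by (auto intro: filt_letter letter_degree.intros)

lemma filt_commutator_E: "filt (E_degree i j + E_degree l m - 1) (commutator (E i j) (E l m))"
proof -
  have "filt (E_degree i j + E_degree l m - 1) (if j = l then E i m else 0)"
    using filt_E[of i m] by (auto simp: E_degree_def intro: filt.zero filt_mono)
  moreover have "filt (E_degree i j + E_degree l m - 1) (if m = i then E l j else 0)"
    using filt_E[of l j] by (auto simp: E_degree_def intro: filt.zero filt_mono)
  ultimately show ?thesis unfolding commutator_E by (rule filt_diff)
qed

lemma commutator_e_inv: "commutator (e_inv k) a = - (e_inv k * commutator (e k) a * e_inv k)"
  by (simp add: commutator_def algebra_simps)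

lemma filt_commutator_letters:
  assumes "letter_degree a w" "letter_degree b v"
  shows "filt (w + v - 1) (commutator a b)"
proof -
  have e_inv_E: "filt (E_degree i j - 1) (commutator (e_inv k) (E i j))" for k i j
  proof -
    have "filt (E_degree i j - 1) (commutator (e k) (E i j))"
      using filt_commutator_E[of None "Some k" i j] by (simp add: E_degree_def)
    from filt_mult[OF filt_mult[OF filt_e_inv this] filt_e_inv] show ?thesis
      unfolding commutator_e_inv by (intro filt_uminus) simp
  qed
  have e_inv_e_inv: "commutator (e_inv k) (e_inv l) = 0" for k l
    using e_inv_e_inv[of k l] by (simp add: commutator_def)
  have E_e_inv: "filt (E_degree i j - 1) (commutator (E i j) (e_inv k))" for k i j
    unfolding commutator_swap[of "E i j"] by (rule filt_uminus[OF e_inv_E])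
  from assms(1) show ?thesis
  proof cases
    case (1 i j)
    from assms(2) show ?thesis
      by cases (simp_all add: 1 filt_commutator_E E_e_inv)
  next
    case (2 k)
    from assms(2) show ?thesis
      by cases (simp_all add: 2 e_inv_E e_inv_e_inv filt.zero)
  qed
qed

lemma filt_commutator: "filt d p \<Longrightarrow> filt d' q \<Longrightarrow> filt (d + d' - 1) (commutator p q)"
proof (induction rule: filt.induct)
  case (letter a w d p d0)
  have "filt (w + d' - 1) (commutator a q)"
    using letter.prems
  proof (induction rule: filt.induct)
    case (letter b v d q d1)
    have "filt (w + v - 1 + d) (commutator a b * q)"
      using filt_commutator_letters letter \<open>letter_degree a w\<close> by (intro filt_mult) auto
    moreover have "filt (v + (w + d - 1)) (b * commutator a q)"
      using letter filt_letter by (intro filt_mult) auto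
    ultimately show ?case
      unfolding commutator_mult_right using letter(3) by (intro filt.add) (auto elim: filt_mono)
  qed (auto intro: filt.intros simp: commutator_add_right commutator_scaleC_right)
  then have "filt (w + d' - 1 + d) (commutator a q * p)"
    using letter by (intro filt_mult) auto
  moreover have "filt (w + (d + d' - 1)) (a * commutator p q)"
    using letter filt_letter by (intro filt_mult) auto
  ultimately show ?case
    unfolding commutator_mult_left using letter(3) by (intro filt.add) (auto elim: filt_mono)
qed (auto intro: filt.intros simp: commutator_add_left commutator_scaleC_left)

lemma filt_gen: "filt (gen_degree a) (gen_val \<phi> a)"
proof (cases a)
  case (X_gen i j)
  have "filt (1 + 0 + 0) (g i j * e i * e_inv j)"
    using filt_E[of "Some i" "Some j"] filt_E[of None "Some i"]
    by (intro filt_mult filt_e_inv) (simp_all add: E_degree_def)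
  then show ?thesis
    using filt_E[of "Some i" "Some i"] X_gen by (auto simp: x_elt_def E_degree_def intro: filt_diff)
next
  case (Omega_gen k)
  have "filt (2 + 0) (f k * e k)"
    using filt_E[of "Some k" None] filt_E[of None "Some k"]
    by (intro filt_mult) (simp_all add: E_degree_def)
  moreover have "filt (1 + 1 + 0 + 0) (g k j * (h j - 1) * e k * e_inv j)" for j
    using filt_E[of "Some k" "Some j"] filt_E[of None "Some k"] filt_E[of "Some j" "Some j"]
    by (intro filt_mult filt_diff filt_e_inv filt.one) (simp_all add: E_degree_def)
  ultimately show ?thesis
    using Omega_gen by (auto simp: omega_elt_def intro!: filt.add filt_sum)
qed

definition gprod :: "'n gen list \<Rightarrow> 'q" where
  "gprod as = prod_list (map (gen_val \<phi>) as)"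

definition gweight :: "'n gen list \<Rightarrow> int" where
  "gweight as = sum_list (map gen_degree as)"

lemma gprod_simps [simp]: "gprod [] = 1" "gprod (a # as) = gen_val \<phi> a * gprod as"
    "gprod (as @ bs) = gprod as * gprod bs"
  and gweight_simps [simp]: "gweight [] = 0" "gweight (a # as) = gen_degree a + gweight as"
    "gweight (as @ bs) = gweight as + gweight bs"
  by (simp_all add: gprod_def gweight_def)

lemma filt_gprod: "filt (gweight as) (gprod as)"
  by (induction as) (auto intro: filt.one filt_mult filt_gen)

text \<open>Moving one generator to its new place costs a commutator, which has smaller degree; the remaining
  word is shorter.\<close>

lemma gprod_permute:
  "mset as = mset bs \<Longrightarrow> filt (gweight as - 1) (gprod as - gprod bs)"
proof (induction as arbitrary: bs)
  case Nil
  then show ?case by (simp add: filt.zero)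
next
  case (Cons a as)
  then have "a \<in> set bs" by (metis list.set_intros(1) set_mset_mset)
  then obtain us vs where bs: "bs = us @ a # vs" by (meson split_list)
  with Cons.prems have m: "mset as = mset (us @ vs)" by simp
  have w: "gweight as = gweight us + gweight vs"
  proof -
    have "gweight as = (\<Sum>a\<in>#mset as. gen_degree a)" for as
      by (simp add: gweight_def sum_mset_sum_list[symmetric])
    from this[of as] this[of "us @ vs"] m show ?thesis by simp
  qed
  have eq: "gprod (a # as) - gprod bs = gen_val \<phi> a * (gprod as - gprod (us @ vs)) + commutator (gen_val \<phi> a) (gprod us) * gprod vs"
    by (simp add: bs commutator_def algebra_simps)
  have "filt (gen_degree a + (gweight as - 1)) (gen_val \<phi> a * (gprod as - gprod (us @ vs)))"
    by (intro filt_mult filt_gen Cons.IH m)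
  moreover have "gen_degree a + (gweight as - 1) = gweight (a # as) - 1" by simp
  moreover have "filt (gen_degree a + gweight us - 1 + gweight vs) (commutator (gen_val \<phi> a) (gprod us) * gprod vs)"
    by (intro filt_mult filt_commutator filt_gen filt_gprod)
  moreover have "gen_degree a + gweight us - 1 + gweight vs = gweight (a # as) - 1" using w by simp
  ultimately show ?case
    unfolding eq by (intro filt.add) simp_all
qed

lemma W_alg_one: "1 \<in> W"
  and W_alg_mult: "u \<in> W \<Longrightarrow> v \<in> W \<Longrightarrow> u * v \<in> W"
  and W_alg_subspace: "complex_vector.subspace W"
  by (auto simp: W_alg_iff commutator_mult_right complex_vector.subspace_def commutator_add_right commutator_scaleC_right)

lemma gprod_in_W: "gprod as \<in> W"
  by (induction as) (simp_all add: W_alg_one W_alg_mult gen_val_in_W)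

lemma W_B_commute:
  assumes "u \<in> W" "b \<in> B" shows "u * b = b * u"
proof -
  let ?C = "{b. u * b = b * u}"
  have "subalgebra ?C"
  proof -
    have "u * (p * q) = p * q * u" if "u * p = p * u" "u * q = q * u" for p q
      using that by (metis mult.assoc)
    then show ?thesis
      unfolding subalgebra_def complex_vector.subspace_def
      by (auto simp: distrib_left distrib_right mult_scaleC)
  qed
  moreover have "h k \<in> ?C" "e k \<in> ?C" for k
    using assms(1) by (simp_all add: W_alg_iff commutator_def)
  moreover from this(2) have "e_inv k \<in> ?C" for k
    by (simp add: commute_e_inv)
  ultimately have "B \<subseteq> ?C"
    unfolding B_alg_def by (intro hull_minimal) auto
  with assms(2) show ?thesis by blast
qed

text \<open>Combinations of words in the \<open>x_ij\<close> and \<open>\<omega>_k\<close>, not yet sorted, with coefficients in \<open>B\<close>.\<close>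

definition normal :: "int \<Rightarrow> 'q set" where
  "normal d = cspan {b * gprod as | b as. b \<in> B \<and> set as \<subseteq> gens \<and> gweight as \<le> d}"

lemma normal_base: "b \<in> B \<Longrightarrow> set as \<subseteq> gens \<Longrightarrow> gweight as \<le> d \<Longrightarrow> b * gprod as \<in> normal d"
  unfolding normal_def by (rule complex_vector.span_base) blast

lemma normal_mono: "d \<le> d' \<Longrightarrow> normal d \<subseteq> normal d'"
  unfolding normal_def by (rule complex_vector.span_mono) force

lemma normal_mult:
  assumes "p \<in> normal d" "q \<in> normal d'" shows "p * q \<in> normal (d + d')"
  using assms unfolding normal_def
proof (rule span_mult[rotated 1])
  fix p q
  assume "p \<in> {b * gprod as | b as. b \<in> B \<and> set as \<subseteq> gens \<and> gweight as \<le> d}"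
     "q \<in> {b * gprod as | b as. b \<in> B \<and> set as \<subseteq> gens \<and> gweight as \<le> d'}"
  then obtain b as b' as' where pq: "p = b * gprod as" "q = b' * gprod as'" "b \<in> B" "b' \<in> B"
     "set as \<subseteq> gens" "set as' \<subseteq> gens" "gweight as \<le> d" "gweight as' \<le> d'" by blast
  have "p * q = b * (gprod as * b') * gprod as'" by (simp add: pq mult.assoc)
  also have "\<dots> = (b * b') * gprod (as @ as')"
    by (simp add: W_B_commute[OF gprod_in_W pq(4)] mult.assoc)
  finally have "p * q \<in> normal (d + d')"
    using normal_base[of "b * b'" "as @ as'" "d + d'"] pq by (simp add: B_alg_mult)
  then show "p * q \<in> cspan {b * gprod as | b as. b \<in> B \<and> set as \<subseteq> gens \<and> gweight as \<le> d + d'}"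
    unfolding normal_def .
qed

lemma normal_subspace: "complex_vector.subspace (normal d)"
  unfolding normal_def by (rule complex_vector.subspace_span)

lemmas normal_add = complex_vector.subspace_add[OF normal_subspace]
  and normal_diff = complex_vector.subspace_diff[OF normal_subspace]
  and normal_scale = complex_vector.subspace_scale[OF normal_subspace]
  and normal_sum = complex_vector.subspace_sum[OF normal_subspace]

lemma normal_B: "b \<in> B \<Longrightarrow> 0 \<le> d \<Longrightarrow> b \<in> normal d"
  using normal_base[of b "[]" d] by simp

text \<open>\<open>e_ij = (x_ij + h_i) e_j e_i^-1\<close> for \<open>i \<noteq> j\<close>.\<close>

lemma normal_g: "g i j \<in> normal 1"
proof (cases "i = j")
  case True
  then show ?thesis by (simp add: normal_B B_alg_gens)
next
  case False
  have "(x i j + h i) * (e j * e_inv i) = g i j * e i * (e_inv j * e j) * e_inv i"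
    by (simp only: x_elt_def diff_add_cancel mult.assoc)
  then have "g i j = x i j * (e j * e_inv i) + h i * (e j * e_inv i)"
    by (simp add: mult.assoc distrib_right)
  also have "x i j * (e j * e_inv i) = (e j * e_inv i) * gprod [X_gen i j]"
    using W_B_commute[OF gen_val_in_W[of "X_gen i j"]] by (simp add: B_alg_mult B_alg_gens)
  also have "e j * e_inv i * gprod [X_gen i j] + h i * (e j * e_inv i) \<in> normal 1"
    by (intro normal_add normal_base normal_B B_alg_mult B_alg_gens) (use False in \<open>auto simp: gens_def\<close>)
  finally show ?thesis .
qed

lemma normal_f: "f k \<in> normal 2"
proof -
  have "f k * e k * e_inv k = (\<omega> k - (\<Sum>j\<in>UNIV. g k j * (h j - 1) * e k * e_inv j)) * e_inv k"
    by (simp add: omega_elt_def)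
  then have "f k = \<omega> k * e_inv k - (\<Sum>j\<in>UNIV. g k j * ((h j - 1) * e k * e_inv j * e_inv k))"
    by (simp add: left_diff_distrib sum_distrib_right mult.assoc)
  moreover have "\<omega> k * e_inv k = e_inv k * gprod [Omega_gen k]"
    using W_B_commute[OF gen_val_in_W[of "Omega_gen k"]] by (simp add: B_alg_gens)
  moreover have "e_inv k * gprod [Omega_gen k] \<in> normal 2"
    by (intro normal_base) (auto simp: gens_def B_alg_gens)
  moreover have "g k j * ((h j - 1) * e k * e_inv j * e_inv k) \<in> normal (1 + 1)" for j
    by (intro normal_mult normal_g normal_B B_alg_mult B_alg_gens complex_vector.subspace_diff[OF B_alg_subspace] B_alg_one) simp_all
  ultimately show ?thesis
    by (auto intro!: normal_diff normal_sum)
qed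

lemma normal_letter: "letter_degree a w \<Longrightarrow> a \<in> normal w"
proof (induction rule: letter_degree.induct)
  case (1 i j)
  have "E None None \<in> B"
    unfolding E_None_None
    by (intro complex_vector.subspace_neg[OF B_alg_subspace] complex_vector.subspace_sum[OF B_alg_subspace] B_alg_gens)
  then show ?case
    using normal_g normal_f
    by (cases i; cases j) (simp_all add: E_degree_def normal_B B_alg_gens)
next
  case (2 k)
  then show ?case by (simp add: normal_B B_alg_gens)
qed

lemma filt_normal: "filt d q \<Longrightarrow> q \<in> normal d"
proof (induction rule: filt.induct)
  case (zero d)
  then show ?case by (rule complex_vector.subspace_0[OF normal_subspace])
next
  case (letter a w d q d')
  then show ?case using normal_mult[OF normal_letter letter(4)] normal_mono by blast
qed (simp_all add: normal_B B_alg_one normal_add normal_scale)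

definition ordered_span :: "'q set" where
  "ordered_span = cspan {b * mon \<gamma> | b \<gamma>. b \<in> B \<and> \<gamma> \<in> exponents}"

lemma ordered_span_base: "b \<in> B \<Longrightarrow> \<gamma> \<in> exponents \<Longrightarrow> b * mon \<gamma> \<in> ordered_span"
  unfolding ordered_span_def by (rule complex_vector.span_base) blast

lemma ordered_span_subspace: "complex_vector.subspace ordered_span"
  unfolding ordered_span_def by (rule complex_vector.subspace_span)

lemma B_mult_ordered_span:
  assumes b: "b \<in> B" and v: "v \<in> ordered_span" shows "b * v \<in> ordered_span"
proof -
  let ?S = "{b * mon \<gamma> | b \<gamma>. b \<in> B \<and> \<gamma> \<in> exponents}"
  have "b * v \<in> cspan ?S"
  proof (rule span_mult)
    show "b \<in> cspan {b}" by (simp add: complex_vector.span_base)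
    show "v \<in> cspan ?S" using v unfolding ordered_span_def .
    fix b' p assume "b' \<in> {b}" "p \<in> ?S"
    then obtain b0 \<gamma> where "b' * p = b * b0 * mon \<gamma>" "b0 \<in> B" "\<gamma> \<in> exponents"
      by (auto simp: mult.assoc)
    then show "b' * p \<in> cspan ?S"
      using ordered_span_base[OF B_alg_mult[OF b]] unfolding ordered_span_def by simp
  qed
  then show ?thesis unfolding ordered_span_def .
qed

lemma mon_eq_gprod: "mon \<gamma> = gprod (concat (map (\<lambda>a. replicate (\<gamma> a) a) gs))"
proof -
  have "gprod (replicate m a) = gen_val \<phi> a ^ m" for m a
    by (induction m) simp_all
  then have "prod_list (map (\<lambda>g. gen_val \<phi> g ^ \<gamma> g) as) = gprod (concat (map (\<lambda>a. replicate (\<gamma> a) a) as))" for as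
    by (induction as) simp_all
  then show ?thesis unfolding ordered_monomial_def by simp
qed

lemma mset_sorted:
  assumes "set as \<subseteq> gens"
  shows "mset (concat (map (\<lambda>a. replicate (count (mset as) a) a) gs)) = mset as"
proof (rule multiset_eqI)
  fix b :: "'n gen"
  have "count (mset (concat (map (\<lambda>a. replicate (\<gamma> a) a) bs))) b = (if b \<in> set bs then \<gamma> b else 0)"
    if "distinct bs" for bs \<gamma>
    using that by (induction bs) (auto simp: count_eq_zero_iff)
  from this[OF gs(1), of "count (mset as)"]
  show "count (mset (concat (map (\<lambda>a. replicate (count (mset as) a) a) gs))) b = count (mset as) b"
    using assms gs(2) by (auto simp: count_eq_zero_iff)
qed

text \<open>The induction hypothesis absorbs the error terms of sorting. The index is shifted by one so that
  the induction starts in degree \<open>-1\<close>, where the filtration is zero.\<close>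

lemma filt_ordered_span: "filt (int n - 1) q \<Longrightarrow> q \<in> ordered_span"
proof (induction n arbitrary: q)
  case 0
  then have "q = 0" using filt_negative[of "-1" q] by simp
  then show ?case using complex_vector.subspace_0[OF ordered_span_subspace] by simp
next
  case (Suc n)
  have "b * gprod as \<in> ordered_span" if b: "b \<in> B" and as: "set as \<subseteq> gens" "gweight as \<le> int n" for b as
  proof -
    let ?\<gamma> = "count (mset as)"
    have "filt (gweight as - 1) (gprod as - mon ?\<gamma>)"
      unfolding mon_eq_gprod by (rule gprod_permute) (rule mset_sorted[OF as(1), symmetric])
    then have "gprod as - mon ?\<gamma> \<in> ordered_span"
      using as(2) by (intro Suc.IH) (auto elim: filt_mono)
    then have "b * (gprod as - mon ?\<gamma>) \<in> ordered_span" by (rule B_mult_ordered_span[OF b])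
    moreover have "?\<gamma> \<in> exponents"
      using as(1) by (auto simp: exponents_def count_eq_zero_iff)
    then have "b * mon ?\<gamma> \<in> ordered_span" by (rule ordered_span_base[OF b])
    ultimately have "b * (gprod as - mon ?\<gamma>) + b * mon ?\<gamma> \<in> ordered_span"
      by (rule complex_vector.subspace_add[OF ordered_span_subspace])
    then show ?thesis by (simp add: right_diff_distrib)
  qed
  then have "normal (int n) \<subseteq> ordered_span"
    unfolding normal_def by (intro complex_vector.span_minimal ordered_span_subspace) auto
  then show ?case using filt_normal Suc.prems by auto
qed

lemma filt_exhausts: "\<exists>n. filt (int n) (\<phi> u)"
proof (induction u rule: uea_induct)
  case zero
  then show ?case by (simp add: hom_zero filt.zero)
next
  case (add u v)
  then obtain m n where "filt (int m) (\<phi> u)" "filt (int n) (\<phi> v)" by blast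
  then have "filt (int (m + n)) (\<phi> u + \<phi> v)"
    by (intro filt.add) (auto elim: filt_mono)
  then show ?case unfolding hom_add by blast
next
  case (scale c u)
  then show ?case unfolding hom_scaleC by (blast intro: filt.scale)
next
  case one
  then show ?case by (intro exI[of _ 0]) (simp add: hom_one filt.one)
next
  case (mult A u)
  then obtain n where n: "filt (int n) (\<phi> u)" by blast
  have "filt 2 (E i j)" for i j
    by (rule filt_mono[OF filt_E]) (simp add: E_degree_def)
  then have "filt 2 (\<phi> (uea_of A))"
    unfolding emb_def[symmetric] emb_expand by (intro filt_sum filt.scale)
  from filt_mult[OF this n] have "filt (int (2 + n)) (\<phi> (uea_of A * u))"
    by (simp add: hom_mult)
  then show ?case by blast
qed

text \<open>Every element is \<open>\<phi>(s)^-1 \<phi>(r)\<close>, the image of \<open>r\<close> lies in the filtration, and \<open>\<phi>(s)\<close> is a product of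
  powers of the \<open>e_k\<close>, which can be cancelled one after the other as \<open>e_k^-1 \<in> B\<close>.\<close>

lemma ordered_span_UNIV: "ordered_span = UNIV"
proof -
  have "q \<in> ordered_span" for q
  proof -
    have phi: "\<phi> r \<in> ordered_span" for r
    proof -
      obtain n where "filt (int n) (\<phi> r)" using filt_exhausts by blast
      then show ?thesis using filt_ordered_span[of "Suc n" "\<phi> r"] by simp
    qed
    obtain s r where s: "s \<in> ore_set" "q = inv_elt (\<phi> s) * \<phi> r" using fraction by blast
    have "\<phi> s * q = \<phi> r"
      using inv_elt_inverse[OF hom_ore_invertible[OF s(1)]] by (simp add: s(2) mult.assoc[symmetric])
    then have sq: "\<phi> s * q \<in> ordered_span" using phi by simp
    have pow: "q \<in> ordered_span" if "e k ^ m * q \<in> ordered_span" for k m q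
      using that
    proof (induction m arbitrary: q)
      case (Suc m)
      from B_mult_ordered_span[OF B_alg_gens(3)[of k] Suc.prems] have "e k ^ m * q \<in> ordered_span"
        by (simp add: mult.assoc)
      then show ?case by (rule Suc.IH)
    qed simp
    obtain i js where "s = prod_list (map (\<lambda>k. uea_of (sl_unit None (Some k)) ^ i k) js)"
      using s(1) unfolding ore_set_def by blast
    then have phi_s: "\<phi> s = prod_list (map (\<lambda>k. e k ^ i k) js)"
      by (simp add: hom_prod_list hom_power E_eq)
    have "q \<in> ordered_span" if "prod_list (map (\<lambda>k. e k ^ i k) js) * q \<in> ordered_span" for js
      using that
    proof (induction js)
      case (Cons k js)
      then have "e k ^ i k * (prod_list (map (\<lambda>k. e k ^ i k) js) * q) \<in> ordered_span" by (simp add: mult.assoc)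
      from Cons.IH[OF pow[OF this]] show ?case .
    qed simp
    with sq show ?thesis unfolding phi_s by blast
  qed
  then show ?thesis by blast
qed

lemma span_pbw: "cspan (pbw ` all_exponents) = UNIV"
proof -
  have "b * mon \<gamma> \<in> cspan (pbw ` all_exponents)" if "b \<in> B" "\<gamma> \<in> exponents" for b \<gamma>
  proof (rule span_mult)
    show "b \<in> cspan (range (\<lambda>(\<alpha>, \<beta>). Bmon \<alpha> \<beta>))"
      using that(1) by (simp add: B_alg_eq_span)
    show "mon \<gamma> \<in> cspan {mon \<gamma>}" by (simp add: complex_vector.span_base)
    fix b' m assume "b' \<in> range (\<lambda>(\<alpha>, \<beta>). Bmon \<alpha> \<beta>)" "m \<in> {mon \<gamma>}"
    then obtain \<alpha> \<beta> where "b' * m = pbw (\<alpha>, \<beta>, \<gamma>)" by auto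
    moreover have "(\<alpha>, \<beta>, \<gamma>) \<in> all_exponents"
      using that(2) by (simp add: all_exponents_def)
    ultimately show "b' * m \<in> cspan (pbw ` all_exponents)"
      by (metis complex_vector.span_base imageI)
  qed
  then have "ordered_span \<subseteq> cspan (pbw ` all_exponents)"
    unfolding ordered_span_def by (intro complex_vector.span_minimal complex_vector.subspace_span) auto
  then show ?thesis unfolding ordered_span_UNIV by (rule top.extremum_uniqueI)
qed

section \<open>The basis of the centralizer W\<close>

lemma mon_in_W: "mon \<gamma> \<in> W"
  unfolding mon_eq_gprod by (rule gprod_in_W)

lemma independent_mon: "indep_family mon exponents"
proof -
  have "indep_family (\<lambda>\<gamma>. pbw (\<lambda>_. 0, \<lambda>_. 0, \<gamma>)) exponents"
    by (rule indep_family_reindex[OF independent_pbw]) (auto simp: all_exponents_def inj_on_def)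
  then show ?thesis by (simp add: Bmon_0)
qed

text \<open>Expand an element of \<open>W\<close> in the basis of the localization. Commuting with \<open>e_k\<close> lowers \<open>\<beta>_k\<close> and
  multiplies by \<open>\<beta>_k\<close>; distinct exponents with \<open>\<beta>_k > 0\<close> stay distinct, so no such exponent occurs.
  Commuting with \<open>h_k\<close> is diagonal with eigenvalue \<open>\<beta>_k - \<alpha>_k\<close>, so \<open>\<alpha> = 0\<close> as well.\<close>

lemma span_mon: "cspan (mon ` exponents) = W"
proof
  show "cspan (mon ` exponents) \<subseteq> W"
    using mon_in_W by (intro complex_vector.span_minimal W_alg_subspace) auto
next
  show "W \<subseteq> cspan (mon ` exponents)"
  proof
    fix u assume u: "u \<in> W"
    have com: "commutator (e k) u = 0" "commutator (h k) u = 0" for k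
      using u by (simp_all add: W_alg_iff)
    have "u \<in> cspan (pbw ` all_exponents)" by (simp add: span_pbw)
    then obtain J c where J: "finite J" "J \<subseteq> all_exponents" "u = (\<Sum>i\<in>J. c i *\<^sub>C pbw i)"
      by (rule family_spanE[OF indep_family_inj_on[OF independent_pbw]])
    have com_mon: "commutator (e k) (mon \<gamma>) = 0" "commutator (h k) (mon \<gamma>) = 0" for k \<gamma>
      using mon_in_W by (simp_all add: W_alg_iff)
    have \<beta>: "\<beta> k = 0" if i: "(\<alpha>, \<beta>, \<gamma>) \<in> J" "c (\<alpha>, \<beta>, \<gamma>) \<noteq> 0" for \<alpha> \<beta> \<gamma> k
    proof (rule ccontr)
      assume nz: "\<beta> k \<noteq> 0"
      define s :: "'n exponent \<Rightarrow> 'n exponent" where "s = (\<lambda>(\<alpha>, \<beta>, \<gamma>). (\<alpha>, \<beta>(k := \<beta> k - 1), \<gamma>))"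
      define m :: "'n exponent \<Rightarrow> nat" where "m = (\<lambda>(\<alpha>, \<beta>, \<gamma>). \<beta> k)"
      define J' where "J' = {i \<in> J. m i \<noteq> 0}"
      have "commutator (e k) (pbw i) = of_nat (m i) *\<^sub>C pbw (s i)" for i
        by (cases i) (simp add: commutator_mult_right com_mon commutator_e_Bmon mult_scaleC_left s_def m_def)
      then have "commutator (e k) u = (\<Sum>i\<in>J. (c i * of_nat (m i)) *\<^sub>C pbw (s i))"
        by (simp add: J(3) commutator_sum_right commutator_scaleC_right scaleC_scaleC)
      also have "\<dots> = (\<Sum>i\<in>J'. (c i * of_nat (m i)) *\<^sub>C pbw (s i))"
        by (rule sum.mono_neutral_right) (use J(1) in \<open>auto simp: J'_def\<close>)
      finally have sum: "(\<Sum>i\<in>J'. (c i * of_nat (m i)) *\<^sub>C pbw (s i)) = 0" using com by simp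
      have "inj_on s J'"
      proof (rule inj_onI)
        fix i j assume ij: "i \<in> J'" "j \<in> J'" "s i = s j"
        obtain \<alpha> \<beta> \<gamma> where i: "i = (\<alpha>, \<beta>, \<gamma>)" by (cases i)
        obtain \<alpha>' \<beta>' \<gamma>' where j: "j = (\<alpha>', \<beta>', \<gamma>')" by (cases j)
        have eq: "\<beta>(k := \<beta> k - 1) = \<beta>'(k := \<beta>' k - 1)" "\<alpha> = \<alpha>'" "\<gamma> = \<gamma>'"
          using ij(3) by (simp_all add: s_def i j)
        have "\<beta> k \<noteq> 0" "\<beta>' k \<noteq> 0" using ij(1,2) by (simp_all add: J'_def m_def i j)
        with fun_cong[OF eq(1), of k] have "\<beta> k = \<beta>' k" by simp
        moreover have "\<beta> l = \<beta>' l" if "l \<noteq> k" for l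
          using fun_cong[OF eq(1), of l] that by simp
        ultimately have "\<beta> = \<beta>'" by (metis ext)
        with eq show "i = j" by (simp add: i j)
      qed
      moreover have "s ` J' \<subseteq> all_exponents"
        using J(2) by (auto simp: J'_def s_def all_exponents_def)
      ultimately have "indep_family (\<lambda>i. pbw (s i)) J'"
        by (rule indep_family_reindex[OF independent_pbw])
      from indep_familyD[OF this _ _ sum, of "(\<alpha>, \<beta>, \<gamma>)"]
      show False using i nz J(1) by (simp add: J'_def m_def)
    qed
    have \<alpha>: "\<alpha> k = 0" if i: "(\<alpha>, \<beta>, \<gamma>) \<in> J" "c (\<alpha>, \<beta>, \<gamma>) \<noteq> 0" for \<alpha> \<beta> \<gamma> k
    proof -
      define m :: "'n exponent \<Rightarrow> complex" where "m = (\<lambda>(\<alpha>, \<beta>, \<gamma>). of_nat (\<beta> k) - of_int (\<alpha> k))"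
      have "commutator (h k) (pbw i) = m i *\<^sub>C pbw i" for i
        using weight_Bmon[of k]
        by (cases i) (simp add: commutator_mult_right com_mon weight_def mult_scaleC_left m_def)
      then have "commutator (h k) u = (\<Sum>i\<in>J. (c i * m i) *\<^sub>C pbw i)"
        by (simp add: J(3) commutator_sum_right commutator_scaleC_right scaleC_scaleC)
      then have "c (\<alpha>, \<beta>, \<gamma>) * m (\<alpha>, \<beta>, \<gamma>) = 0"
        using indep_familyD[OF independent_pbw J(1,2), of "\<lambda>i. c i * m i"] com i(1) by simp
      then show ?thesis using i \<beta>[OF i] by (simp add: m_def)
    qed
    have "c i *\<^sub>C pbw i \<in> cspan (mon ` exponents)" if i: "i \<in> J" for i
    proof (cases "c i = 0")
      case False
      obtain \<alpha> \<beta> \<gamma> where i': "i = (\<alpha>, \<beta>, \<gamma>)" by (cases i)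
      have "\<alpha> = (\<lambda>_. 0)" "\<beta> = (\<lambda>_. 0)" using \<alpha>[of \<alpha> \<beta> \<gamma>] \<beta>[of \<alpha> \<beta> \<gamma>] i False by (auto simp: i')
      then have "pbw i = mon \<gamma>" by (simp add: i' Bmon_0)
      moreover have "\<gamma> \<in> exponents" using i J(2) by (auto simp: i' all_exponents_def)
      ultimately show ?thesis by (simp add: complex_vector.span_scale complex_vector.span_base)
    qed (simp add: complex_vector.span_zero)
    then show "u \<in> cspan (mon ` exponents)"
      unfolding J(3) by (rule complex_vector.span_sum)
  qed
qed

theorem mon_basis: "family_basis mon exponents W"
  unfolding family_basis_def
  using indep_family_inj_on[OF independent_mon] indep_family_independent[OF independent_mon] span_mon
  by blast

text \<open>Expand each coefficient in the basis \<open>e^\<alpha> y^\<beta>\<close> of \<open>B\<close>.\<close>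

lemma mon_B_independent:
  assumes J: "finite J" "J \<subseteq> exponents" and b: "\<And>\<gamma>. \<gamma> \<in> J \<Longrightarrow> b \<gamma> \<in> B"
    and sum: "(\<Sum>\<gamma>\<in>J. mon \<gamma> * b \<gamma>) = 0" and \<gamma>: "\<gamma> \<in> J"
  shows "b \<gamma> = 0"
proof -
  have indep: "indep_family (\<lambda>\<kappa>. pbw (fst \<kappa>, snd \<kappa>, \<lambda>_. 0)) UNIV"
    by (rule indep_family_reindex[OF independent_pbw]) (auto simp: all_exponents_def exponents_def inj_on_def prod_eq_iff)
  have "mon (\<lambda>_. 0) = 1"
  proof -
    have "prod_list (map (\<lambda>g. gen_val \<phi> g ^ 0) as) = 1" for as by (induction as) simp_all
    then show ?thesis by (simp add: ordered_monomial_def)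
  qed
  then have "inj_on (\<lambda>(\<alpha>, \<beta>). Bmon \<alpha> \<beta>) UNIV"
    using indep_family_inj_on[OF indep] by (simp add: case_prod_unfold)
  then have "\<exists>K c. finite K \<and> b = (\<Sum>\<kappa>\<in>K. c \<kappa> *\<^sub>C Bmon (fst \<kappa>) (snd \<kappa>))" if "b \<in> B" for b
    using that unfolding B_alg_eq_span case_prod_unfold by (elim family_spanE) blast+
  then have "\<forall>\<gamma>\<in>J. \<exists>K c. finite K \<and> b \<gamma> = (\<Sum>\<kappa>\<in>K. c \<kappa> *\<^sub>C Bmon (fst \<kappa>) (snd \<kappa>))"
    using b by simp
  then obtain K where "\<forall>\<gamma>\<in>J. \<exists>c. finite (K \<gamma>) \<and> b \<gamma> = (\<Sum>\<kappa>\<in>K \<gamma>. c \<kappa> *\<^sub>C Bmon (fst \<kappa>) (snd \<kappa>))"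
    by (rule bchoice[THEN exE])
  then obtain c where Kc: "\<forall>\<gamma>\<in>J. finite (K \<gamma>) \<and> b \<gamma> = (\<Sum>\<kappa>\<in>K \<gamma>. c \<gamma> \<kappa> *\<^sub>C Bmon (fst \<kappa>) (snd \<kappa>))"
    by (rule bchoice[THEN exE])
  have K: "finite (K \<gamma>)" "b \<gamma> = (\<Sum>\<kappa>\<in>K \<gamma>. c \<gamma> \<kappa> *\<^sub>C Bmon (fst \<kappa>) (snd \<kappa>))" if "\<gamma> \<in> J" for \<gamma>
    using Kc that by simp_all
  have "(\<Sum>\<gamma>\<in>J. \<Sum>\<kappa>\<in>K \<gamma>. c \<gamma> \<kappa> *\<^sub>C pbw (fst \<kappa>, snd \<kappa>, \<gamma>)) = (\<Sum>\<gamma>\<in>J. mon \<gamma> * b \<gamma>)"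
  proof (rule sum.cong[OF refl])
    fix \<gamma> assume \<gamma>: "\<gamma> \<in> J"
    have "mon \<gamma> * b \<gamma> = b \<gamma> * mon \<gamma>" by (rule W_B_commute[OF mon_in_W b[OF \<gamma>]])
    then show "(\<Sum>\<kappa>\<in>K \<gamma>. c \<gamma> \<kappa> *\<^sub>C pbw (fst \<kappa>, snd \<kappa>, \<gamma>)) = mon \<gamma> * b \<gamma>"
      by (simp add: K(2)[OF \<gamma>] sum_distrib_right mult_scaleC_left)
  qed
  then have "(\<Sum>(\<gamma>, \<kappa>)\<in>Sigma J K. c \<gamma> \<kappa> *\<^sub>C pbw (fst \<kappa>, snd \<kappa>, \<gamma>)) = 0"
    using sum J(1) K(1) by (simp add: sum.Sigma)
  then have "(\<Sum>i\<in>Sigma J K. (\<lambda>(\<gamma>, \<kappa>). c \<gamma> \<kappa>) i *\<^sub>C pbw ((\<lambda>(\<gamma>, \<kappa>). (fst \<kappa>, snd \<kappa>, \<gamma>)) i)) = 0"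
    by (simp add: case_prod_unfold)
  moreover have "indep_family (\<lambda>i. pbw ((\<lambda>(\<gamma>, \<kappa>). (fst \<kappa>, snd \<kappa>, \<gamma>)) i)) (Sigma J K)"
    using J(2) by (intro indep_family_reindex[OF independent_pbw]) (auto simp: inj_on_def all_exponents_def prod_eq_iff)
  moreover have "finite (Sigma J K)" using J(1) K(1) by blast
  ultimately have "c \<gamma> \<kappa> = 0" if "\<kappa> \<in> K \<gamma>" for \<kappa>
    using indep_familyD[of _ "Sigma J K" "Sigma J K" "\<lambda>(\<gamma>, \<kappa>). c \<gamma> \<kappa>" "(\<gamma>, \<kappa>)"] that \<gamma> by simp
  then show ?thesis by (simp add: K(2)[OF \<gamma>])
qed

end

section \<open>Tensor products of commuting subalgebras\<close>

lemma alg_on_simps [simp]: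
  "carrier (alg_on A) = A" "mult (alg_on A) = (*)" "one (alg_on A) = 1" "zero (alg_on A) = 0"
  "add (alg_on A) = (+)" "smult (alg_on A) = (*\<^sub>C)"
  by (simp_all add: alg_on_def)

lemma lookup_free_scale [simp]: "lookup (free_scale c p) x = c * lookup p x"
  by (simp add: free_scale_def map.rep_eq when_def)

lemma free_scale_pure: "free_scale c (pure_tensor a b) = Poly_Mapping.single (a, b) c"
  by (intro poly_mapping_eqI) (simp add: pure_tensor_def lookup_single when_def)

lemma keys_free_scale: "keys (free_scale c p) \<subseteq> keys p"
  by (auto simp: in_keys_iff)

lemma keys_pure_tensor: "keys (pure_tensor a b) = {(a, b)}"
  by (simp add: pure_tensor_def)

text \<open>The multiplication map \<open>a \<otimes> b \<mapsto> a b\<close> on the free vector space that underlies the tensor product.\<close>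

definition tensor_eval :: "('a::complex_algebra_1 \<times> 'a \<Rightarrow>\<^sub>0 complex) \<Rightarrow> 'a" where
  "tensor_eval p = (\<Sum>x\<in>keys p. lookup p x *\<^sub>C (fst x * snd x))"

lemma tensor_eval_superset:
  assumes "finite K" "keys p \<subseteq> K"
  shows "tensor_eval p = (\<Sum>x\<in>K. lookup p x *\<^sub>C (fst x * snd x))"
  unfolding tensor_eval_def
  by (rule sum.mono_neutral_left) (use assms in \<open>auto simp: in_keys_iff\<close>)

lemma tensor_eval_add: "tensor_eval (p + q) = tensor_eval p + tensor_eval q"
proof -
  let ?K = "keys p \<union> keys q"
  have "tensor_eval r = (\<Sum>x\<in>?K. lookup r x *\<^sub>C (fst x * snd x))"
    if "r \<in> {p, q, p + q}" for r
    by (rule tensor_eval_superset) (use that keys_add[of p q] in auto)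
  then show ?thesis by (simp add: lookup_add scaleC_add_left sum.distrib)
qed

lemma tensor_eval_free_scale: "tensor_eval (free_scale c p) = c *\<^sub>C tensor_eval p"
  by (subst tensor_eval_superset[of "keys p"])
     (auto simp: tensor_eval_def complex_vector.scale_sum_right scaleC_scaleC in_keys_iff)

lemma tensor_eval_zero [simp]: "tensor_eval 0 = 0"
  by (simp add: tensor_eval_def)

lemma tensor_eval_diff: "tensor_eval (p - q) = tensor_eval p - tensor_eval q"
  using tensor_eval_add[of "p - q" q] by simp

lemma tensor_eval_pure [simp]: "tensor_eval (pure_tensor a b) = a * b"
  by (simp add: tensor_eval_def pure_tensor_def scaleC_one)

lemma tensor_eval_sum: "tensor_eval (\<Sum>i\<in>I. F i) = (\<Sum>i\<in>I. tensor_eval (F i))"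
  by (induction I rule: infinite_finite_induct) (simp_all add: tensor_eval_add)

text \<open>The multiplication map is bijective as soon as the products \<open>a b\<close> span and \<open>A\<close> has a spanning family
  that is independent over \<open>B\<close>.\<close>

locale commuting_subalgebras =
  fixes A B :: "'a::complex_algebra_1 set" and w :: "'i \<Rightarrow> 'a" and I :: "'i set"
  assumes A: "subalgebra A" and B: "subalgebra B"
    and commute: "\<And>a b. a \<in> A \<Longrightarrow> b \<in> B \<Longrightarrow> a * b = b * a"
    and generate: "cspan {a * b | a b. a \<in> A \<and> b \<in> B} = UNIV"
    and basis_in: "w ` I \<subseteq> A"
    and basis_span: "\<And>a. a \<in> A \<Longrightarrow> \<exists>J c. finite J \<and> J \<subseteq> I \<and> a = (\<Sum>i\<in>J. c i *\<^sub>C w i)"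
    and basis_independent: "\<And>J b i. finite J \<Longrightarrow> J \<subseteq> I \<Longrightarrow> (\<And>i. i \<in> J \<Longrightarrow> b i \<in> B) \<Longrightarrow>
           (\<Sum>i\<in>J. w i * b i) = 0 \<Longrightarrow> i \<in> J \<Longrightarrow> b i = 0"
begin

lemma subspace: "complex_vector.subspace A" "complex_vector.subspace B"
  and one: "1 \<in> A" "1 \<in> B"
  and mult: "a \<in> A \<Longrightarrow> a' \<in> A \<Longrightarrow> a * a' \<in> A" "b \<in> B \<Longrightarrow> b' \<in> B \<Longrightarrow> b * b' \<in> B"
  using A B unfolding subalgebra_def by blast+

abbreviation F where "F \<equiv> free_product (alg_on A) (alg_on B)"
abbreviation N where "N \<equiv> bilinear_rel (alg_on A) (alg_on B)"

lemma carrier_F: "p \<in> carrier F \<longleftrightarrow> keys p \<subseteq> A \<times> B"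
  by (simp add: free_product_def)

lemma F_simps: "mult F = free_mult (alg_on A) (alg_on B)" "one F = pure_tensor 1 1" "add F = (+)"
  by (simp_all add: free_product_def)

lemma F_add: "p \<in> carrier F \<Longrightarrow> q \<in> carrier F \<Longrightarrow> p + q \<in> carrier F"
  using keys_add[of p q] unfolding carrier_F by blast

lemma F_diff: "p \<in> carrier F \<Longrightarrow> q \<in> carrier F \<Longrightarrow> p - q \<in> carrier F"
  unfolding carrier_F using keys_diff[of p q] by blast

lemma F_scale: "p \<in> carrier F \<Longrightarrow> free_scale c p \<in> carrier F"
  unfolding carrier_F using keys_free_scale[of c p] by blast

lemma F_pure: "a \<in> A \<Longrightarrow> b \<in> B \<Longrightarrow> pure_tensor a b \<in> carrier F"
  unfolding carrier_F by (simp add: keys_pure_tensor)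

lemma F_zero: "0 \<in> carrier F"
  unfolding carrier_F by simp

lemma F_sum: "(\<And>i. i \<in> J \<Longrightarrow> p i \<in> carrier F) \<Longrightarrow> (\<Sum>i\<in>J. p i) \<in> carrier F"
  by (induction J rule: infinite_finite_induct) (simp_all add: F_zero F_add)

lemma N_carrier: "p \<in> N \<Longrightarrow> p \<in> carrier F"
  by (induction rule: bilinear_rel.induct)
     (auto intro!: F_zero F_add F_diff F_scale F_pure
        complex_vector.subspace_add[OF subspace(1)] complex_vector.subspace_add[OF subspace(2)]
        complex_vector.subspace_scale[OF subspace(1)] complex_vector.subspace_scale[OF subspace(2)])

lemma N_eval: "p \<in> N \<Longrightarrow> tensor_eval p = 0"
  by (induction rule: bilinear_rel.induct)
     (simp_all add: tensor_eval_add tensor_eval_diff tensor_eval_free_scale distrib_left distrib_right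
        mult_scaleC)

lemma N_uminus: "p \<in> N \<Longrightarrow> - p \<in> N"
proof -
  assume "p \<in> N"
  then have "free_scale (- 1) p \<in> N" by (rule bilinear_rel.scale)
  moreover have "free_scale (- 1) p = - p"
    by (intro poly_mapping_eqI) (simp add: lookup_uminus)
  ultimately show ?thesis by simp
qed

lemma N_diff: "p \<in> N \<Longrightarrow> q \<in> N \<Longrightarrow> p - q \<in> N"
  using bilinear_rel.add[of p _ _ "- q"] N_uminus[of q] by simp

lemma N_sum: "(\<And>i. i \<in> J \<Longrightarrow> p i \<in> N) \<Longrightarrow> (\<Sum>i\<in>J. p i) \<in> N"
  by (induction J rule: infinite_finite_induct) (simp_all add: bilinear_rel.zero bilinear_rel.add)

lemma N_pure_zero: "a \<in> A \<Longrightarrow> pure_tensor a 0 \<in> N"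
proof -
  assume a: "a \<in> A"
  have "free_scale 0 (pure_tensor a (1::'a)) = 0" by (intro poly_mapping_eqI) simp
  then show ?thesis
    using bilinear_rel.smult_right[of a "alg_on A" 1 "alg_on B" 0] a one by simp
qed

lemma N_zero_pure: "b \<in> B \<Longrightarrow> pure_tensor 0 b \<in> N"
proof -
  assume b: "b \<in> B"
  have "free_scale 0 (pure_tensor (1::'a) b) = 0" by (intro poly_mapping_eqI) simp
  then show ?thesis
    using bilinear_rel.smult_left[of 1 "alg_on A" b "alg_on B" 0] b one by simp
qed

lemma N_pure_scale:
  assumes "a \<in> A" "b \<in> B" shows "pure_tensor (c *\<^sub>C a) b - pure_tensor a (c *\<^sub>C b) \<in> N"
  using N_diff[OF bilinear_rel.smult_left[of a "alg_on A" b "alg_on B" c] bilinear_rel.smult_right[of a "alg_on A" b "alg_on B" c]]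
    assms by simp

lemma N_pure_sum:
  assumes "b \<in> B" "finite J" "\<And>i. i \<in> J \<Longrightarrow> a i \<in> A"
  shows "pure_tensor (\<Sum>i\<in>J. a i) b - (\<Sum>i\<in>J. pure_tensor (a i) b) \<in> N"
  using assms(2,3)
proof (induction J rule: finite_induct)
  case empty
  then show ?case using N_zero_pure[OF assms(1)] by simp
next
  case (insert j J)
  have "(\<Sum>i\<in>J. a i) \<in> A"
    using insert by (intro complex_vector.subspace_sum[OF subspace(1)]) simp
  then have "pure_tensor (a j + (\<Sum>i\<in>J. a i)) b - pure_tensor (a j) b - pure_tensor (\<Sum>i\<in>J. a i) b \<in> N"
    using bilinear_rel.add_left[of "a j" "alg_on A" "\<Sum>i\<in>J. a i" b "alg_on B"] insert.prems assms(1) by simp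
  from bilinear_rel.add[OF this insert.IH] show ?case
    using insert by (simp add: algebra_simps)
qed

text \<open>Modulo the bilinearity relations, \<open>p\<close> is \<open>\<Sum>_i w_i \<otimes> b_i\<close>. The coefficients lie in \<open>B\<close> for all \<open>i\<close>, also
  outside \<open>J\<close>, which allows to enlarge \<open>J\<close> when two representations are added.\<close>

definition represents :: "'i set \<Rightarrow> ('i \<Rightarrow> 'a) \<Rightarrow> ('a \<times> 'a \<Rightarrow>\<^sub>0 complex) \<Rightarrow> bool" where
  "represents J b p \<longleftrightarrow> finite J \<and> J \<subseteq> I \<and> (\<forall>i. b i \<in> B) \<and> p - (\<Sum>i\<in>J. pure_tensor (w i) (b i)) \<in> N"

lemma represents_superset:
  assumes "represents J b p" "finite K" "K \<subseteq> I" "J \<subseteq> K"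
  shows "represents K (\<lambda>i. if i \<in> J then b i else 0) p"
proof -
  have "(\<Sum>i\<in>K. pure_tensor (w i) (if i \<in> J then b i else 0))
     = (\<Sum>i\<in>J. pure_tensor (w i) (b i)) + (\<Sum>i\<in>K - J. pure_tensor (w i) 0)"
    using assms(2,4) by (subst sum.subset_diff[of J K]) (auto simp: add.commute intro!: arg_cong2[of _ _ _ _ "(+)"] sum.cong)
  then have "p - (\<Sum>i\<in>K. pure_tensor (w i) (if i \<in> J then b i else 0))
     = (p - (\<Sum>i\<in>J. pure_tensor (w i) (b i))) - (\<Sum>i\<in>K - J. pure_tensor (w i) 0)"
    by (simp only: diff_diff_eq)
  also have "\<dots> \<in> N"
  proof (rule N_diff)
    show "p - (\<Sum>i\<in>J. pure_tensor (w i) (b i)) \<in> N" using assms(1) by (simp add: represents_def)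
    show "(\<Sum>i\<in>K - J. pure_tensor (w i) 0) \<in> N"
      using assms(3) basis_in by (intro N_sum N_pure_zero) auto
  qed
  finally have "p - (\<Sum>i\<in>K. pure_tensor (w i) (if i \<in> J then b i else 0)) \<in> N" .
  then show ?thesis
    using assms complex_vector.subspace_0[OF subspace(2)] unfolding represents_def by auto
qed

lemma represents_add:
  assumes "represents J b p" "represents K b' q"
  shows "\<exists>L b''. represents L b'' (p + q)"
proof -
  let ?L = "J \<union> K"
  define b1 b2 where "b1 = (\<lambda>i. if i \<in> J then b i else 0)" and "b2 = (\<lambda>i. if i \<in> K then b' i else 0)"
  have "finite ?L" "?L \<subseteq> I" using assms unfolding represents_def by auto
  then have 1: "represents ?L b1 p" and 2: "represents ?L b2 q"
    unfolding b1_def b2_def using assms by (auto intro!: represents_superset)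
  have "pure_tensor (w i) (b1 i + b2 i) - pure_tensor (w i) (b1 i) - pure_tensor (w i) (b2 i) \<in> N" if "i \<in> ?L" for i
  proof -
    have "i \<in> I" "b1 i \<in> B" "b2 i \<in> B"
      using that 1 2 unfolding represents_def by auto
    moreover from this(1) have "w i \<in> A" using basis_in by blast
    ultimately show ?thesis
      using bilinear_rel.add_right[of "w i" "alg_on A" "b1 i" "alg_on B" "b2 i"] by simp
  qed
  then have mid: "(\<Sum>i\<in>?L. pure_tensor (w i) (b1 i + b2 i) - pure_tensor (w i) (b1 i) - pure_tensor (w i) (b2 i)) \<in> N"
    by (rule N_sum)
  have "p - (\<Sum>i\<in>?L. pure_tensor (w i) (b1 i)) \<in> N" "q - (\<Sum>i\<in>?L. pure_tensor (w i) (b2 i)) \<in> N"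
    using 1 2 by (simp_all add: represents_def)
  from N_diff[OF bilinear_rel.add[OF this] mid] have "(p - (\<Sum>i\<in>?L. pure_tensor (w i) (b1 i))) + (q - (\<Sum>i\<in>?L. pure_tensor (w i) (b2 i)))
     - (\<Sum>i\<in>?L. pure_tensor (w i) (b1 i + b2 i) - pure_tensor (w i) (b1 i) - pure_tensor (w i) (b2 i)) \<in> N"
    .
  then have "p + q - (\<Sum>i\<in>?L. pure_tensor (w i) (b1 i + b2 i)) \<in> N"
    by (simp add: sum_subtractf sum.distrib algebra_simps)
  then have "represents ?L (\<lambda>i. b1 i + b2 i) (p + q)"
    using 1 2 complex_vector.subspace_add[OF subspace(2)] unfolding represents_def by auto
  then show ?thesis by blast
qed

lemma represents_single:
  assumes "a \<in> A" "b \<in> B" shows "\<exists>J b'. represents J b' (Poly_Mapping.single (a, b) c)"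
proof -
  obtain J d where J: "finite J" "J \<subseteq> I" "a = (\<Sum>i\<in>J. d i *\<^sub>C w i)"
    using basis_span[OF assms(1)] by blast
  have wA: "w i \<in> A" if "i \<in> J" for i using that J(2) basis_in by auto
  have cb: "c *\<^sub>C b \<in> B" using assms(2) by (rule complex_vector.subspace_scale[OF subspace(2)])
  have "free_scale c (pure_tensor a b) - pure_tensor a (c *\<^sub>C b) \<in> N"
    using N_uminus[OF bilinear_rel.smult_right[of a "alg_on A" b "alg_on B" c]] assms by simp
  moreover have "pure_tensor a (c *\<^sub>C b) - (\<Sum>i\<in>J. pure_tensor (d i *\<^sub>C w i) (c *\<^sub>C b)) \<in> N"
    unfolding J(3) using wA
    by (intro N_pure_sum cb J(1) complex_vector.subspace_scale[OF subspace(1)])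
  moreover have "(\<Sum>i\<in>J. pure_tensor (d i *\<^sub>C w i) (c *\<^sub>C b) - pure_tensor (w i) (d i *\<^sub>C c *\<^sub>C b)) \<in> N"
    using wA cb by (intro N_sum N_pure_scale)
  ultimately have "(free_scale c (pure_tensor a b) - pure_tensor a (c *\<^sub>C b))
      + ((pure_tensor a (c *\<^sub>C b) - (\<Sum>i\<in>J. pure_tensor (d i *\<^sub>C w i) (c *\<^sub>C b)))
      + (\<Sum>i\<in>J. pure_tensor (d i *\<^sub>C w i) (c *\<^sub>C b) - pure_tensor (w i) (d i *\<^sub>C c *\<^sub>C b))) \<in> N"
    by (intro bilinear_rel.add)
  then have "Poly_Mapping.single (a, b) c - (\<Sum>i\<in>J. pure_tensor (w i) (d i *\<^sub>C c *\<^sub>C b)) \<in> N"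
    by (simp add: sum_subtractf algebra_simps free_scale_pure)
  then have "represents J (\<lambda>i. d i *\<^sub>C c *\<^sub>C b) (Poly_Mapping.single (a, b) c)"
    using J assms(2) complex_vector.subspace_scale[OF subspace(2)] unfolding represents_def by (auto simp: scaleC_scaleC)
  then show ?thesis by blast
qed

lemma represents_exists: "p \<in> carrier F \<Longrightarrow> \<exists>J b. represents J b p"
proof (induction p rule: update_induct)
  case const
  have "represents {} (\<lambda>_. 0) 0"
    using bilinear_rel.zero complex_vector.subspace_0[OF subspace(2)] by (simp add: represents_def)
  then show ?case by blast
next
  case (update p x d)
  have eq: "Poly_Mapping.update x d p = p + Poly_Mapping.single x d"
    using update by (intro poly_mapping_eqI)
      (auto simp: lookup_update lookup_add lookup_single when_def in_keys_iff)
  have keys: "keys (Poly_Mapping.update x d p) = insert x (keys p)"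
    using update by (auto simp: in_keys_iff lookup_update split: if_splits)
  then have x: "fst x \<in> A" "snd x \<in> B" and p: "p \<in> carrier F"
    using update.prems unfolding carrier_F by auto
  obtain J b K b' where "represents J b p" "represents K b' (Poly_Mapping.single x d)"
    using update.IH[OF p] represents_single[OF x, of d] by auto
  then show ?case unfolding eq by (rule represents_add)
qed

text \<open>The kernel of multiplication consists of the bilinearity relations: in the normal form
  \<open>\<Sum>_i w_i \<otimes> b_i\<close> of an element of the kernel, all \<open>b_i\<close> vanish by independence over \<open>B\<close>.\<close>

lemma eval_zero_in_N:
  assumes "p \<in> carrier F" "tensor_eval p = 0" shows "p \<in> N"
proof -
  obtain J b where J: "finite J" "J \<subseteq> I" "\<And>i. b i \<in> B" "p - (\<Sum>i\<in>J. pure_tensor (w i) (b i)) \<in> N"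
    using represents_exists[OF assms(1)] unfolding represents_def by blast
  have "(\<Sum>i\<in>J. w i * b i) = 0"
    using N_eval[OF J(4)] assms(2) by (simp add: tensor_eval_diff tensor_eval_sum)
  then have "b i = 0" if "i \<in> J" for i
    using basis_independent[OF J(1,2), of b i] J(3) that by blast
  then have "(\<Sum>i\<in>J. pure_tensor (w i) (b i)) = (\<Sum>i\<in>J. pure_tensor (w i) 0)" by simp
  also have "\<dots> \<in> N" using J(2) basis_in by (intro N_sum N_pure_zero) auto
  finally have "(\<Sum>i\<in>J. pure_tensor (w i) (b i)) \<in> N" .
  from bilinear_rel.add[OF J(4) this] show ?thesis by simp
qed

text \<open>The fibres of the multiplication map are the cosets of its kernel, that is, the elements of the
  tensor product. So \<open>fibre\<close> is the inverse of multiplication.\<close>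

definition fibre :: "'a \<Rightarrow> ('a \<times> 'a \<Rightarrow>\<^sub>0 complex) set" where
  "fibre q = {p \<in> carrier F. tensor_eval p = q}"

lemma coset_eq_fibre:
  assumes "p \<in> carrier F" shows "N +>\<^bsub>F\<^esub> p = fibre (tensor_eval p)"
proof
  show "N +>\<^bsub>F\<^esub> p \<subseteq> fibre (tensor_eval p)"
    using assms by (auto simp: a_r_coset_def' F_simps fibre_def tensor_eval_add N_eval intro: F_add N_carrier)
next
  show "fibre (tensor_eval p) \<subseteq> N +>\<^bsub>F\<^esub> p"
  proof
    fix r assume r: "r \<in> fibre (tensor_eval p)"
    then have "r - p \<in> N"
      using assms by (intro eval_zero_in_N F_diff) (auto simp: fibre_def tensor_eval_diff)
    moreover have "r = (r - p) \<oplus>\<^bsub>F\<^esub> p" by (simp add: F_simps)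
    ultimately show "r \<in> N +>\<^bsub>F\<^esub> p" unfolding a_r_coset_def' by blast
  qed
qed

lemma fibre_nonempty: "\<exists>p. p \<in> fibre q"
proof -
  have "q \<in> cspan {a * b | a b. a \<in> A \<and> b \<in> B}" by (simp add: generate)
  then show ?thesis
  proof (induction rule: complex_vector.span_induct_alt)
    case base
    then show ?case using F_zero by (auto simp: fibre_def intro: exI[of _ 0])
  next
    case (step c x y)
    then obtain a b p where "x = a * b" "a \<in> A" "b \<in> B" "p \<in> fibre y" by blast
    then have "free_scale c (pure_tensor a b) + p \<in> fibre (c *\<^sub>C x + y)"
      by (simp add: fibre_def F_add F_scale F_pure tensor_eval_add tensor_eval_free_scale)
    then show ?case by blast
  qed
qed

lemma free_mult_closed:
  assumes "p \<in> carrier F" "q \<in> carrier F"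
  shows "free_mult (alg_on A) (alg_on B) p q \<in> carrier F"
  unfolding free_mult_def case_prod_unfold
proof (intro F_sum F_scale F_pure)
  fix x y assume "x \<in> keys p" "y \<in> keys q"
  then have "fst x \<in> A" "snd x \<in> B" "fst y \<in> A" "snd y \<in> B"
    using assms by (auto simp: carrier_F)
  then show "fst x \<otimes>\<^bsub>alg_on A\<^esub> fst y \<in> A" "snd x \<otimes>\<^bsub>alg_on B\<^esub> snd y \<in> B"
    by (simp_all add: mult)
qed

lemma tensor_eval_free_mult:
  assumes "p \<in> carrier F" "q \<in> carrier F"
  shows "tensor_eval (free_mult (alg_on A) (alg_on B) p q) = tensor_eval p * tensor_eval q"
proof -
  have "tensor_eval (free_mult (alg_on A) (alg_on B) p q) = (\<Sum>x\<in>keys p. \<Sum>y\<in>keys q.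
     (lookup p x * lookup q y) *\<^sub>C ((fst x * fst y) * (snd x * snd y)))"
    unfolding free_mult_def case_prod_unfold by (simp add: tensor_eval_sum tensor_eval_free_scale)
  also have "\<dots> = (\<Sum>x\<in>keys p. \<Sum>y\<in>keys q.
     (lookup p x *\<^sub>C (fst x * snd x)) * (lookup q y *\<^sub>C (fst y * snd y)))"
  proof (intro sum.cong refl)
    fix x y assume xy: "x \<in> keys p" "y \<in> keys q"
    then have "fst y * snd x = snd x * fst y"
      using assms by (intro commute) (auto simp: carrier_F)
    then have "(fst x * fst y) * (snd x * snd y) = (fst x * snd x) * (fst y * snd y)"
      by (metis mult.assoc)
    then show "(lookup p x * lookup q y) *\<^sub>C ((fst x * fst y) * (snd x * snd y))
       = (lookup p x *\<^sub>C (fst x * snd x)) * (lookup q y *\<^sub>C (fst y * snd y))"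
      by (simp add: mult_scaleC scaleC_scaleC mult.commute)
  qed
  also have "\<dots> = tensor_eval p * tensor_eval q"
    by (simp add: tensor_eval_def sum_distrib_left sum_distrib_right)
       (rule sum.swap)
  finally show ?thesis .
qed

lemma Union_fibre:
  assumes "\<And>p. p \<in> fibre q \<Longrightarrow> G p = fibre r" shows "(\<Union>p\<in>fibre q. G p) = fibre r"
  using assms fibre_nonempty[of q] by auto

theorem tensor_iso:
  "alg_isomorphic (alg_on (UNIV :: 'a set)) (tensor_alg (alg_on A) (alg_on B))"
proof -
  let ?T = "tensor_alg (alg_on A) (alg_on B)"
  have carrier: "carrier ?T = (\<lambda>p. N +>\<^bsub>F\<^esub> p) ` carrier F"
    unfolding tensor_alg_def Let_def by (auto simp: FactRing_def A_RCOSETS_def')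
  have mult: "x \<otimes>\<^bsub>?T\<^esub> y = (\<Union>p\<in>x. \<Union>q\<in>y. N +>\<^bsub>F\<^esub> (p \<otimes>\<^bsub>F\<^esub> q))" for x y
    unfolding tensor_alg_def Let_def by (simp add: FactRing_def rcoset_mult_def)
  have add: "x \<oplus>\<^bsub>?T\<^esub> y = (\<Union>p\<in>x. \<Union>q\<in>y. {p + q})" for x y
    unfolding tensor_alg_def Let_def by (simp add: FactRing_def set_add_def' F_simps)
  have one: "\<one>\<^bsub>?T\<^esub> = N +>\<^bsub>F\<^esub> pure_tensor 1 1"
    unfolding tensor_alg_def Let_def by (simp add: FactRing_def F_simps)
  have smult: "c \<odot>\<^bsub>?T\<^esub> x = (\<Union>p\<in>x. N +>\<^bsub>F\<^esub> free_scale c p)" for c x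
    unfolding tensor_alg_def Let_def by simp
  have F1: "pure_tensor 1 1 \<in> carrier F"
    using A B by (intro F_pure) (simp_all add: subalgebra_def)
  have fibre_carrier: "fibre q \<in> carrier ?T" for q
  proof -
    obtain p where "p \<in> fibre q" using fibre_nonempty by blast
    then have "fibre q = N +>\<^bsub>F\<^esub> p" "p \<in> carrier F"
      using coset_eq_fibre[of p] by (auto simp: fibre_def)
    then show ?thesis unfolding carrier by blast
  qed
  have hom: "fibre \<in> ring_hom (alg_on UNIV) ?T"
  proof (rule ring_hom_memI)
    fix q r :: 'a
    show "fibre q \<in> carrier ?T" by (rule fibre_carrier)
    show "fibre (q \<otimes>\<^bsub>alg_on UNIV\<^esub> r) = fibre q \<otimes>\<^bsub>?T\<^esub> fibre r"
      unfolding mult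
    proof (rule Union_fibre[symmetric], rule Union_fibre)
      fix p p' assume "p \<in> fibre q" "p' \<in> fibre r"
      then show "N +>\<^bsub>F\<^esub> (p \<otimes>\<^bsub>F\<^esub> p') = fibre (q \<otimes>\<^bsub>alg_on UNIV\<^esub> r)"
        by (simp add: F_simps coset_eq_fibre free_mult_closed tensor_eval_free_mult fibre_def[of q] fibre_def[of r])
    qed
    show "fibre (q \<oplus>\<^bsub>alg_on UNIV\<^esub> r) = fibre q \<oplus>\<^bsub>?T\<^esub> fibre r"
    proof
      show "fibre q \<oplus>\<^bsub>?T\<^esub> fibre r \<subseteq> fibre (q \<oplus>\<^bsub>alg_on UNIV\<^esub> r)"
        unfolding add by (auto simp: fibre_def F_add tensor_eval_add)
    next
      obtain p where p: "p \<in> fibre q" using fibre_nonempty by blast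
      show "fibre (q \<oplus>\<^bsub>alg_on UNIV\<^esub> r) \<subseteq> fibre q \<oplus>\<^bsub>?T\<^esub> fibre r"
      proof
        fix s assume "s \<in> fibre (q \<oplus>\<^bsub>alg_on UNIV\<^esub> r)"
        then have "s - p \<in> fibre r"
          using p by (auto simp: fibre_def F_diff tensor_eval_diff)
        moreover have "s = p + (s - p)" by simp
        ultimately show "s \<in> fibre q \<oplus>\<^bsub>?T\<^esub> fibre r"
          unfolding add using p by blast
      qed
    qed
  next
    show "fibre \<one>\<^bsub>alg_on UNIV\<^esub> = \<one>\<^bsub>?T\<^esub>"
      unfolding one coset_eq_fibre[OF F1] by simp
  qed
  have "bij_betw fibre UNIV (carrier ?T)"
    unfolding bij_betw_def
  proof
    show "inj fibre"
    proof (rule injI)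
      fix q r assume eq: "fibre q = fibre r"
      obtain p where "p \<in> fibre q" using fibre_nonempty by blast
      with eq show "q = r" by (auto simp: fibre_def)
    qed
    show "range fibre = carrier ?T"
      using fibre_carrier coset_eq_fibre unfolding carrier by auto
  qed
  with hom have "fibre \<in> ring_iso (alg_on UNIV) ?T"
    by (simp add: ring_iso_def)
  moreover have "fibre (c \<odot>\<^bsub>alg_on UNIV\<^esub> q) = c \<odot>\<^bsub>?T\<^esub> fibre q" for c q
    unfolding smult
    by (intro Union_fibre[symmetric]) (auto simp: coset_eq_fibre F_scale tensor_eval_free_scale fibre_def[of q])
  ultimately show ?thesis
    unfolding alg_isomorphic_def by blast
qed

end

context ordered_generators
begin

section \<open>Tensor decomposition and center\<close>

lemma commuting_subalgebras_W_B: "commuting_subalgebras W B mon exponents"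
proof
  show "subalgebra W"
    by (simp add: subalgebra_def W_alg_subspace W_alg_one W_alg_mult)
  show "subalgebra B" by (rule subalgebra_B)
  show "a * b = b * a" if "a \<in> W" "b \<in> B" for a b
    by (rule W_B_commute[OF that])
  have "ordered_span \<subseteq> cspan {a * b | a b. a \<in> W \<and> b \<in> B}"
    unfolding ordered_span_def
  proof (rule complex_vector.span_mono, clarify)
    fix b \<gamma> assume "b \<in> B"
    then show "\<exists>a b'. b * mon \<gamma> = a * b' \<and> a \<in> W \<and> b' \<in> B"
      using mon_in_W W_B_commute[OF mon_in_W] by metis
  qed
  then show "cspan {a * b | a b. a \<in> W \<and> b \<in> B} = UNIV"
    unfolding ordered_span_UNIV by (rule top.extremum_uniqueI)
  show "mon ` exponents \<subseteq> W" using mon_in_W by auto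
  show "\<exists>J c. finite J \<and> J \<subseteq> exponents \<and> a = (\<Sum>i\<in>J. c i *\<^sub>C mon i)" if "a \<in> W" for a
    using family_spanE[OF indep_family_inj_on[OF independent_mon], of a] that unfolding span_mon by metis
  show "b i = 0" if "finite J" "J \<subseteq> exponents" "\<And>i. i \<in> J \<Longrightarrow> b i \<in> B"
      "(\<Sum>i\<in>J. mon i * b i) = 0" "i \<in> J" for J b i
    by (rule mon_B_independent[OF that])
qed

text \<open>An element of \<open>ZW\<close> commutes with \<open>W\<close> and, lying in \<open>W\<close>, also with \<open>B\<close>; conversely a central element
  centralizes \<open>B\<close>, hence lies in \<open>W\<close>.\<close>

lemma center_eq: "center (UNIV :: 'q set) = center W"
proof
  show "center UNIV \<subseteq> center W"
    by (auto simp: center_def W_alg_iff commutator_def)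
next
  show "center W \<subseteq> center UNIV"
  proof
    fix z assume z: "z \<in> center W"
    have "ordered_span \<subseteq> {q. z * q = q * z}"
      unfolding ordered_span_def
    proof (rule complex_vector.span_minimal)
      show "complex_vector.subspace {q. z * q = q * z}"
        by (auto simp: complex_vector.subspace_def distrib_left distrib_right mult_scaleC)
      show "{b * mon \<gamma> | b \<gamma>. b \<in> B \<and> \<gamma> \<in> exponents} \<subseteq> {q. z * q = q * z}"
      proof clarify
        fix b \<gamma> assume b: "b \<in> B"
        have "z * b = b * z" using z by (intro W_B_commute b) (simp add: center_def)
        moreover have "z * mon \<gamma> = mon \<gamma> * z" using z mon_in_W[of \<gamma>] by (simp add: center_def)
        ultimately show "z * (b * mon \<gamma>) = b * mon \<gamma> * z" by (metis mult.assoc)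
      qed
    qed
    then show "z \<in> center UNIV" by (auto simp: ordered_span_UNIV center_def)
  qed
qed

end

lemma alg_isomorphic_refl: "alg_isomorphic (alg_on A) (alg_on A)"
proof -
  have "id \<in> ring_iso (alg_on A) (alg_on A)"
    by (auto simp: ring_iso_def ring_hom_def bij_betw_def)
  then show ?thesis unfolding alg_isomorphic_def by (intro bexI[of _ id]) simp_all
qed

theorem theorem8:
  fixes \<phi> :: "'n::finite option sl uea \<Rightarrow> 'q::complex_algebra_1"
    and gs :: "'n gen list"
  assumes "CARD('n) \<ge> 2"
    and "is_localization ore_set \<phi>"
    and "distinct gs" and "set gs = gens"
  shows "alg_isomorphic (alg_on (UNIV :: 'q set)) (tensor_alg (alg_on (W_alg \<phi>)) (alg_on (B_alg \<phi>)))
       \<and> alg_isomorphic (alg_on (center (UNIV :: 'q set))) (alg_on (center (W_alg \<phi>)))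
       \<and> family_basis (ordered_monomial \<phi> gs) exponents (W_alg \<phi>)"
proof -
  interpret ordered_generators \<phi> gs
    by unfold_locales (use assms in auto)
  interpret commuting_subalgebras "W_alg \<phi>" "B_alg \<phi>" mon exponents
    by (rule commuting_subalgebras_W_B)
  show ?thesis
    using tensor_iso alg_isomorphic_refl mon_basis unfolding center_eq by blast
qed

end
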